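(* Let $(X_n)_{n\ge 1}$ be independent identically distributed real random variables with $\mathbf{E}X_1=0$, $\mathbf{E}X_1^2=1$, and let $S_n=(X_1+\dots+X_n)/\sqrt n$. Assume that $\mathbf{E}|X_1|^s<+\infty$ for some real $s\ge 2$, and put $m=[s]$. Suppose $S_{n_0}$ has a bounded density $\rho_{n_0}$ for some $n_0$. Then for all $n$ large enough, $S_n$ have continuous densities $\rho_n$ satisfying, as $n\to\infty$, $$(1+|x|^m)\,\big(\rho_n(x)-\varphi_m(x)\big)=o\big(n^{-(s-2)/2}\big)$$ uniformly for all $x\in\mathbf{R}$. Moreover, uniformly for all $x \in \mathbf{R}$, $$(1+|x|^s)\big(\rho_n(x)-\varphi_m(x)\big)=o\big(n^{-(s-2)/2}\big)+\left(1+|x|^{s-m}\right)\big(O(n^{-(m-1)/2})+o(n^{-(s-2)})\big).$$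
   Context: $[s]$ denotes the integer part of $s$. The cumulants of $X_1$ are $\gamma_k=i^{-k}\frac{d^k}{dt^k}\log \mathbf{E}e^{itX_1}\big|_{t=0}$, $k=1,\dots,m$ (principal branch of the logarithm near $t=0$). Let $\varphi(x)=\frac1{\sqrt{2\pi}}e^{-x^2/2}$ and let $H_k$ be the Chebyshev–Hermite polynomials, $H_k(x)=(-1)^k e^{x^2/2}\frac{d^k}{dx^k}e^{-x^2/2}$. For $1\le k\le m-2$, $$q_k(x)=\varphi(x)\sum H_{k+2j}(x)\,\frac{1}{p_1!\cdots p_k!}\Big(\frac{\gamma_3}{3!}\Big)^{p_1}\cdots\Big(\frac{\gamma_{k+2}}{(k+2)!}\Big)^{p_k},$$ where the sum runs over all non-negative integer solutions $(p_1,\dots,p_k)$ of $p_1+2p_2+\dots+kp_k=k$, and $j=p_1+\dots+p_k$. The approximating function (depending on $n$) is $$\varphi_m(x)=\varphi(x)+\sum_{k=1}^{m-2}q_k(x)\,n^{-k/2}$$ (so $\varphi_2=\varphi$). *)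

theory Defs
  imports "HOL-Probability.Probability" "HOL-Library.Landau_Symbols"
begin

definition normalized_sum :: "(nat \<Rightarrow> 'a \<Rightarrow> real) \<Rightarrow> nat \<Rightarrow> 'a \<Rightarrow> real" where
  "normalized_sum X n \<omega> = (\<Sum>i=1..n. X i \<omega>) / sqrt (real n)"

text \<open>
  The logarithm is the principal branch. Since an iterated derivative at \<open>0\<close> depends only on
  the germ at \<open>0\<close>, the values of the logarithm far from \<open>0\<close> play no role.
  The number under \<open>Re\<close> is real whenever the absolute moment of order \<open>k\<close> is finite.
\<close>
definition cumulant :: "real measure \<Rightarrow> nat \<Rightarrow> real" where
  "cumulant N k =
     Re (inverse (\<i> ^ k) * ((\<lambda>g t. vector_derivative g (at t)) ^^ k) (\<lambda>t. Ln (char N t)) 0)"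

definition hermite :: "nat \<Rightarrow> real \<Rightarrow> real" where
  "hermite k x = (-1) ^ k * exp (x\<^sup>2 / 2) * (deriv ^^ k) (\<lambda>y. exp (- y\<^sup>2 / 2)) x"

text \<open>
  A solution \<open>(p\<^sub>1, \<dots>, p\<^sub>k)\<close> of \<open>p\<^sub>1 + 2 p\<^sub>2 + \<dots> + k p\<^sub>k = k\<close> is an extensional function
  on \<open>{1..k}\<close>, so that each solution is counted once.
\<close>
definition weighted_partitions :: "nat \<Rightarrow> (nat \<Rightarrow> nat) set" where
  "weighted_partitions k = {p \<in> {1..k} \<rightarrow>\<^sub>E UNIV. (\<Sum>i=1..k. i * p i) = k}"

lemma finite_weighted_partitions: "finite (weighted_partitions k)"
proof (rule finite_subset)
  show "weighted_partitions k \<subseteq> {1..k} \<rightarrow>\<^sub>E {..k}"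
  proof
    fix p assume p: "p \<in> weighted_partitions k"
    have "p i \<le> k" if i: "i \<in> {1..k}" for i
    proof -
      have "p i \<le> i * p i" using i by simp
      also have "\<dots> \<le> (\<Sum>i=1..k. i * p i)"
        using i by (intro member_le_sum) auto
      finally show ?thesis using p by (simp add: weighted_partitions_def)
    qed
    then show "p \<in> {1..k} \<rightarrow>\<^sub>E {..k}"
      using p by (auto simp: weighted_partitions_def PiE_iff)
  qed
qed (simp add: finite_PiE)

definition edgeworth_term :: "real measure \<Rightarrow> nat \<Rightarrow> real \<Rightarrow> real" where
  "edgeworth_term N k x = std_normal_density x *
     (\<Sum>p\<in>weighted_partitions k.
        hermite (k + 2 * (\<Sum>i=1..k. p i)) x
        * (1 / (\<Prod>i=1..k. fact (p i)))
        * (\<Prod>i=1..k. (cumulant N (i + 2) / fact (i + 2)) ^ p i))"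

definition edgeworth_density :: "real measure \<Rightarrow> nat \<Rightarrow> nat \<Rightarrow> real \<Rightarrow> real" where
  "edgeworth_density N m n x =
     std_normal_density x + (\<Sum>k=1..m-2. edgeworth_term N k x * real n powr (- real k / 2))"

text \<open>
  Landau symbols along this filter on pairs \<open>(n, x)\<close> express asymptotics for \<open>n \<rightarrow> \<infinity>\<close> that are
  uniform in \<open>x\<close>, as made explicit by the lemmas below.
\<close>
abbreviation uniformly_in_x :: "(nat \<times> real) filter" where
  "uniformly_in_x \<equiv> sequentially \<times>\<^sub>F top"

lemma eventually_uniformly_in_x:
  "eventually P uniformly_in_x \<longleftrightarrow> (\<forall>\<^sub>F n in sequentially. \<forall>x. P (n, x))"
proof
  assume "eventually P uniformly_in_x"
  then obtain Q R where "eventually Q sequentially" and "eventually R (top :: real filter)"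
    and imp: "\<And>n x. Q n \<Longrightarrow> R x \<Longrightarrow> P (n, x)"
    unfolding eventually_prod_filter by blast
  moreover from this have "\<And>x. R x" by simp
  ultimately show "\<forall>\<^sub>F n in sequentially. \<forall>x. P (n, x)" by (auto elim!: eventually_mono)
next
  assume "\<forall>\<^sub>F n in sequentially. \<forall>x. P (n, x)"
  then show "eventually P uniformly_in_x"
    unfolding eventually_prod_filter
    by (intro exI[of _ "\<lambda>n. \<forall>x. P (n, x)"] exI[of _ "\<lambda>_. True"]) simp
qed

lemma smallo_uniformly_in_x:
  "(\<lambda>(n, x). r n x) \<in> o[uniformly_in_x](\<lambda>(n, x). g n) \<longleftrightarrow>
     (\<forall>c>0. \<forall>\<^sub>F n in sequentially. \<forall>x. \<bar>r n x :: real\<bar> \<le> c * \<bar>g n :: real\<bar>)"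
  by (simp add: smallo_def eventually_uniformly_in_x)

lemma bigo_uniformly_in_x:
  "(\<lambda>(n, x). r n x) \<in> O[uniformly_in_x](\<lambda>(n, x). g n) \<longleftrightarrow>
     (\<exists>c>0. \<forall>\<^sub>F n in sequentially. \<forall>x. \<bar>r n x :: real\<bar> \<le> c * \<bar>g n :: real\<bar>)"
  by (simp add: bigo_def eventually_uniformly_in_x)

end

theory Submission
  imports Defs "HOL-Complex_Analysis.Complex_Analysis" "HOL-Real_Asymp.Real_Asymp"
begin

text \<open>
  Let \<open>f\<close> be the characteristic function of \<open>X\<^sub>1\<close>, let \<open>T\<close> be the Taylor polynomial of degree \<open>m\<close> of
  \<open>log f\<close> at \<open>0\<close>, and let \<open>E = exp T\<close>. With \<open>f\<^sub>n(t) = f(t/\<surd>n)\<^sup>n\<close> and \<open>g\<^sub>n\<close> the Fourier transform of the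
  approximating function, the density error is the inverse Fourier transform of \<open>f\<^sub>n - g\<^sub>n\<close>.
  No derivatives of \<open>f\<close> are used to extract the weight \<open>|x|\<^sup>s\<close>: for \<open>d = \<pi>/|x|\<close> the \<open>(m+1)\<close>-st difference
  of step \<open>d\<close> multiplies the inverse Fourier transform at \<open>x\<close> by \<open>(-2)\<^bsup>m+1\<^esup>\<close>, so it suffices that the \<open>L\<^sup>1\<close> norm
  of this difference of \<open>f\<^sub>n - g\<^sub>n\<close> is \<open>d\<^sup>s o(n\<^bsup>-(s-2)/2\<^esup>)\<close>, uniformly in \<open>d \<le> 1\<close>. As \<open>m + 1 > s\<close>, this treats
  integer and fractional \<open>s\<close> alike, and gives the bound \<open>o(n\<^bsup>-(s-2)/2\<^esup>)\<close> for the weight \<open>1 + |x|\<^sup>s\<close>;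
  the two further error terms of the theorem can be taken to be \<open>0\<close>.

  By the Leibniz rule for differences, a suitably weighted sum of differences at the grid points
  \<open>t, t + d, \<dots>, t + (m+1)d\<close> is a submultiplicative norm. For \<open>|t| \<le> c\<surd>n\<close> it is therefore enough to estimate
  the single factors in \<open>f\<^sub>n - E\<^sub>n = (f - E) \<Sum> f\<^sup>i E\<^bsup>n-1-i\<^esup>\<close>, whereas \<open>E\<^sub>n - g\<^sub>n\<close> is entire and controlled by Cauchy's
  inequality. For \<open>|t| > c\<surd>n\<close> one has \<open>|f(t/\<surd>n)| \<le> \<theta> < 1\<close>, and \<open>|f|\<close> to the power \<open>2n\<^sub>0\<close> is integrable
  because \<open>S\<^bsub>n\<^sub>0\<^esub>\<close> has a bounded density.
\<close>

section \<open>Finite differences\<close>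

text \<open>The estimate for one factor is raised to the power n, so no constant may be lost in a
  product: the norm has to be submultiplicative with constant exactly 1, and a factor may exceed its
  Gaussian size by at most exp(O((1 + |t|)/n)). Every difference of positive order must therefore
  contribute a factor 1/n. For order 1 this comes from the vanishing mean (for \<open>E\<close>,
  from the missing linear term in the exponent), for orders from 2 on already from the scaling by
  sqrt n. The resulting factors exp(C (1 + |t|)) are harmless, since exp(-t^2/8) absorbs them.

  The factor f - E is not smooth enough for Cauchy's inequality. The Taylor polynomial
  \<open>moment_poly\<close> of f is put in between: f - \<open>moment_poly\<close> is an integral
  of Taylor remainders of the exponential, measured by \<open>eta\<close>, and
  \<open>moment_poly\<close> - E is entire with a zero of order at least m + 1 at 0. The little-o
  survives the integration over t because \<open>eta\<close> at J (1 + |t|)/sqrt n stays bounded and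
  tends to 0 for each t, so that dominated convergence applies.\<close>

definition fdiff :: "real \<Rightarrow> (real \<Rightarrow> complex) \<Rightarrow> real \<Rightarrow> complex" where
  "fdiff d f t = f (t + d) - f t"

lemma fdiff_pow_Suc: "(fdiff d ^^ Suc k) f t = (fdiff d ^^ k) f (t + d) - (fdiff d ^^ k) f t"
  by (simp add: fdiff_def)

lemma fdiff_pow_Suc2: "(fdiff d ^^ Suc k) f = (fdiff d ^^ k) (fdiff d f)"
  unfolding funpow_Suc_right by simp

lemma fdiff_pow_add: "(fdiff d ^^ k) (\<lambda>t. f t + g t) t = (fdiff d ^^ k) f t + (fdiff d ^^ k) g t"
  by (induction k arbitrary: t) (simp_all add: fdiff_def)

lemma fdiff_pow_diff: "(fdiff d ^^ k) (\<lambda>t. f t - g t) t = (fdiff d ^^ k) f t - (fdiff d ^^ k) g t"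
  by (induction k arbitrary: t) (simp_all add: fdiff_def)

lemma fdiff_pow_cmult: "(fdiff d ^^ k) (\<lambda>t. c * f t) t = c * (fdiff d ^^ k) f t"
  by (induction k arbitrary: t) (simp_all add: fdiff_def algebra_simps)

lemma fdiff_pow_sum: "(fdiff d ^^ k) (\<lambda>t. \<Sum>i\<in>A. f i t) t = (\<Sum>i\<in>A. (fdiff d ^^ k) (f i) t)"
  by (induction k arbitrary: t) (simp_all add: fdiff_def sum_subtractf)

lemma fdiff_pow_scale: "(fdiff d ^^ k) (\<lambda>t. f (t / r)) t = (fdiff (d / r) ^^ k) f (t / r)"
  by (induction k arbitrary: t) (simp_all add: fdiff_def add_divide_distrib)

lemma fdiff_pow_const: "(fdiff d ^^ Suc k) (\<lambda>t. c) t = 0"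
proof (induction k arbitrary: t)
  case (Suc k)
  show ?case by (subst fdiff_pow_Suc) (simp only: Suc.IH diff_self)
qed (simp add: fdiff_def)

lemma fdiff_pow_iexp:
  "(fdiff d ^^ k) (\<lambda>t. iexp (t * x)) t = iexp (t * x) * (iexp (d * x) - 1) ^ k"
  by (induction k arbitrary: t) (simp_all add: fdiff_def exp_add algebra_simps)

lemma
  assumes "\<And>t. integrable M (F t)"
  shows fdiff_pow_integrable: "integrable M (\<lambda>x. (fdiff d ^^ k) (\<lambda>t. F t x) t)"
    and fdiff_pow_integral:
      "(fdiff d ^^ k) (\<lambda>t. \<integral>x. F t x \<partial>M) t = (\<integral>x. (fdiff d ^^ k) (\<lambda>t. F t x) t \<partial>M)"
proof -
  have "integrable M (\<lambda>x. (fdiff d ^^ k) (\<lambda>t. F t x) t) \<and>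
    (fdiff d ^^ k) (\<lambda>t. \<integral>x. F t x \<partial>M) t = (\<integral>x. (fdiff d ^^ k) (\<lambda>t. F t x) t \<partial>M)" for t
    by (induction k arbitrary: t) (auto simp: fdiff_def assms)
  then show "integrable M (\<lambda>x. (fdiff d ^^ k) (\<lambda>t. F t x) t)"
    "(fdiff d ^^ k) (\<lambda>t. \<integral>x. F t x \<partial>M) t = (\<integral>x. (fdiff d ^^ k) (\<lambda>t. F t x) t \<partial>M)"
    by auto
qed

text \<open>As in the product rule for one difference, one of the two factors is evaluated at a
  shifted point. The right-hand side still involves only values at t, t + d, ..., t + k d; hence a
  norm built from grid values can be submultiplicative.\<close>

lemma fdiff_pow_mult:
  "(fdiff d ^^ k) (\<lambda>t. f t * g t) t =
     (\<Sum>j\<le>k. of_nat (k choose j) * (fdiff d ^^ j) f t * (fdiff d ^^ (k - j)) g (t + real j * d))"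
proof (induction k arbitrary: t)
  case 0
  then show ?case by simp
next
  case (Suc k)
  let ?F = "\<lambda>j. (fdiff d ^^ j) f" and ?G = "\<lambda>j. (fdiff d ^^ j) g"
  let ?b = "\<lambda>j. of_nat (k choose j) :: complex"
  have "(fdiff d ^^ Suc k) (\<lambda>t. f t * g t) t =
     (\<Sum>j\<le>k. ?b j * ?F j (t + d) * ?G (k - j) (t + d + real j * d)) -
     (\<Sum>j\<le>k. ?b j * ?F j t * ?G (k - j) (t + real j * d))"
    by (simp only: fdiff_pow_Suc Suc.IH)
  \<comment> \<open>The increment of F G is (increment of F) times the shifted G, plus F times
    (increment of G). Pascal's rule later merges the two sums.\<close>
  also have "\<dots> = (\<Sum>j\<le>k. ?b j * ?F (Suc j) t * ?G (k - j) (t + real (Suc j) * d)) +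
       (\<Sum>j\<le>k. ?b j * ?F j t * ?G (Suc k - j) (t + real j * d))"
    unfolding sum_subtractf[symmetric] sum.distrib[symmetric]
    by (intro sum.cong refl) (auto simp: Suc_diff_le fdiff_def algebra_simps)
  also have "(\<Sum>j\<le>k. ?b j * ?F j t * ?G (Suc k - j) (t + real j * d)) =
      ?F 0 t * ?G (Suc k) t + (\<Sum>j\<le>k. of_nat (k choose Suc j) * ?F (Suc j) t * ?G (k - j) (t + real (Suc j) * d))"
  proof -
    have "(\<Sum>j\<le>k. ?b j * ?F j t * ?G (Suc k - j) (t + real j * d)) =
      (\<Sum>j\<le>Suc k. ?b j * ?F j t * ?G (Suc k - j) (t + real j * d))" by simp
    also have "\<dots> = ?F 0 t * ?G (Suc k) t + (\<Sum>j\<le>k. of_nat (k choose Suc j) * ?F (Suc j) t * ?G (k - j) (t + real (Suc j) * d))"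
      by (subst sum.atMost_Suc_shift) (simp del: of_nat_Suc)
    finally show ?thesis .
  qed
  also have "(\<Sum>j\<le>k. ?b j * ?F (Suc j) t * ?G (k - j) (t + real (Suc j) * d)) +
     (?F 0 t * ?G (Suc k) t + (\<Sum>j\<le>k. of_nat (k choose Suc j) * ?F (Suc j) t * ?G (k - j) (t + real (Suc j) * d)))
     = ?F 0 t * ?G (Suc k) t + (\<Sum>j\<le>k. of_nat (Suc k choose Suc j) * ?F (Suc j) t * ?G (k - j) (t + real (Suc j) * d))"
    by (simp add: sum.distrib algebra_simps del: of_nat_Suc)
  also have "\<dots> = (\<Sum>j\<le>Suc k. of_nat (Suc k choose j) * ?F j t * ?G (Suc k - j) (t + real j * d))"
    by (subst sum.atMost_Suc_shift) (simp del: of_nat_Suc)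
  finally show ?case .
qed

lemma fdiff_pow_mult':
  "(fdiff d ^^ k) (\<lambda>t. f t * g t) (t + a) =
     (\<Sum>j\<le>k. of_nat (k choose j) * (fdiff d ^^ j) f (t + a) * (fdiff d ^^ (k - j)) g (t + a + real j * d))"
  by (rule fdiff_pow_mult)

section \<open>Mean value bounds for iterated differences\<close>

lemma vector_derivative_norm_bound:
  fixes f :: "real \<Rightarrow> 'a::real_normed_vector"
  assumes "convex S"
    and "\<And>x. x \<in> S \<Longrightarrow> (f has_vector_derivative f' x) (at x within S)"
    and "\<And>x. x \<in> S \<Longrightarrow> norm (f' x) \<le> B"
    and "x \<in> S" "y \<in> S"
  shows "norm (f x - f y) \<le> B * norm (x - y)"
proof (rule differentiable_bound[OF assms(1) _ _ assms(4,5)])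
  show "(f has_derivative (\<lambda>h. h *\<^sub>R f' x)) (at x within S)" if "x \<in> S" for x
    using assms(2)[OF that] by (simp add: has_vector_derivative_def)
  show "onorm (\<lambda>h. h *\<^sub>R f' x) \<le> B" if "x \<in> S" for x
  proof (rule onorm_le)
    fix h :: real
    show "norm (h *\<^sub>R f' x) \<le> B * norm h"
      using mult_right_mono[OF assms(3)[OF that], of "\<bar>h\<bar>"] by (simp add: mult.commute)
  qed
qed

text \<open>Here \<open>G k\<close> plays the role of the k-th derivative of \<open>G 0\<close>.
  Replacing the whole chain by its first differences lowers j by one and, by the mean value
  inequality, turns the bound B for the top derivative into d B.\<close>

lemma fdiff_pow_bound:
  assumes "d \<ge> 0"
    and "\<And>k u. k < j \<Longrightarrow> t \<le> u \<Longrightarrow> u \<le> t + real j * d \<Longrightarrow> (G k has_vector_derivative G (Suc k) u) (at u)"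
    and "\<And>u. t \<le> u \<Longrightarrow> u \<le> t + real j * d \<Longrightarrow> cmod (G j u) \<le> B"
  shows "cmod ((fdiff d ^^ j) (G 0) t) \<le> d ^ j * B"
  using assms(2,3)
proof (induction j arbitrary: G B)
  case 0
  from 0(2)[of t] show ?case by simp
next
  case (Suc j)
  define H where "H k u = G k (u + d) - G k u" for k u
  have "cmod ((fdiff d ^^ j) (H 0) t) \<le> d ^ j * (d * B)"
  proof (rule Suc.IH)
    fix k u assume k: "k < j" and u: "t \<le> u" "u \<le> t + real j * d"
    have ud: "u + d \<le> t + real (Suc j) * d" using u by (simp add: algebra_simps)
    have "((G k \<circ> (\<lambda>u. u + d)) has_vector_derivative 1 *\<^sub>R G (Suc k) (u + d)) (at u)"
      by (rule vector_diff_chain_at)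
        (auto intro!: derivative_eq_intros Suc.prems(1) less_SucI k u(1) add_increasing2 assms(1) ud)
    then have "((\<lambda>u. G k (u + d)) has_vector_derivative G (Suc k) (u + d)) (at u)"
      by (simp add: o_def)
    moreover have "(G k has_vector_derivative G (Suc k) u) (at u)"
      by (intro Suc.prems(1) less_SucI k u(1) order_trans[OF u(2)]) (simp add: mult_right_mono assms(1))
    ultimately show "(H k has_vector_derivative H (Suc k) u) (at u)"
      unfolding H_def by (rule has_vector_derivative_diff)
  next
    fix u assume u: "t \<le> u" "u \<le> t + real j * d"
    have ud: "u + d \<le> t + real (Suc j) * d" using u by (simp add: algebra_simps)
    have "cmod (G j (u + d) - G j u) \<le> B * norm (u + d - u)"
    proof (rule vector_derivative_norm_bound[where S = "{u..u+d}"])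
      fix v assume v: "v \<in> {u..u + d}"
      have v: "t \<le> v" "v \<le> t + real (Suc j) * d" using v u ud by auto
      show "(G j has_vector_derivative G (Suc j) v) (at v within {u..u + d})"
        by (rule has_vector_derivative_at_within, rule Suc.prems(1)[OF _ v]) simp
      show "cmod (G (Suc j) v) \<le> B"
        by (intro Suc.prems(2) v)
    qed (use assms(1) in auto)
    then show "cmod (H j u) \<le> d * B"
      using assms(1) by (simp add: H_def mult.commute)
  qed
  moreover have "H 0 = fdiff d (G 0)" by (auto simp: H_def fdiff_def)
  ultimately have "cmod ((fdiff d ^^ Suc j) (G 0) t) \<le> d ^ j * (d * B)"
    by (simp only: fdiff_pow_Suc2)
  then show ?case by (simp only: power_Suc2 mult.assoc)
qed

text \<open>With i at most J - j, a difference of order j started at t + i d uses no grid point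
  beyond t + J d.\<close>

definition dmax :: "nat \<Rightarrow> real \<Rightarrow> real \<Rightarrow> (real \<Rightarrow> complex) \<Rightarrow> nat \<Rightarrow> real" where
  "dmax J d t f j = Max ((\<lambda>i. cmod ((fdiff d ^^ j) f (t + real i * d))) ` {..J - j})"

lemma dmax_ge: "i + j \<le> J \<Longrightarrow> cmod ((fdiff d ^^ j) f (t + real i * d)) \<le> dmax J d t f j"
  unfolding dmax_def by (rule Max_ge) auto

lemma dmax_le:
  "(\<And>i. i \<le> J - j \<Longrightarrow> cmod ((fdiff d ^^ j) f (t + real i * d)) \<le> B) \<Longrightarrow> dmax J d t f j \<le> B"
  unfolding dmax_def by (subst Max_le_iff) auto

lemma dmax_nonneg: "0 \<le> dmax J d t f j"
proof -
  have "0 \<le> cmod ((fdiff d ^^ j) f (t + real 0 * d))" by simp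
  also have "\<dots> \<le> dmax J d t f j"
    unfolding dmax_def by (rule Max_ge) (simp, rule imageI, simp)
  finally show ?thesis .
qed

text \<open>
  Only the values at the grid points \<open>t, t + d, \<dots>, t + J d\<close> enter: when the norm is integrated over \<open>t\<close>,
  powers of \<open>f\<close> at these points stay integrable, while their suprema over \<open>[t, t + J d]\<close> need not be.
\<close>
definition gnorm :: "(nat \<Rightarrow> real) \<Rightarrow> nat \<Rightarrow> real \<Rightarrow> real \<Rightarrow> (real \<Rightarrow> complex) \<Rightarrow> real" where
  "gnorm v J d t f = (\<Sum>j\<le>J. dmax J d t f j / v j)"

text \<open>\<open>v_mult\<close> absorbs the binomial coefficients of the Leibniz rule, so that
  \<open>gnorm\<close> becomes submultiplicative without a constant; \<open>v_0\<close> bounds the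
  norm of the constant function 1 by 1.\<close>

locale diff_weight =
  fixes v :: "nat \<Rightarrow> real" and J :: nat
  assumes v_pos: "v j > 0" and v_0: "v 0 = 1"
    and v_mult: "j + k \<le> J \<Longrightarrow> real ((j + k) choose j) * v j * v k \<le> v (j + k)"
begin

lemma gnorm_nonneg: "0 \<le> gnorm v J d t f"
  unfolding gnorm_def by (intro sum_nonneg divide_nonneg_pos dmax_nonneg v_pos)

lemma gnorm_le:
  assumes "\<And>i j. i + j \<le> J \<Longrightarrow> cmod ((fdiff d ^^ j) f (t + real i * d)) \<le> v j * b j"
  shows "gnorm v J d t f \<le> (\<Sum>j\<le>J. b j)"
  unfolding gnorm_def
proof (rule sum_mono)
  fix j assume "j \<in> {..J}"
  then have "dmax J d t f j \<le> v j * b j"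
    by (intro dmax_le assms) auto
  then show "dmax J d t f j / v j \<le> b j"
    using v_pos[of j] by (simp add: divide_le_eq mult.commute)
qed

lemma norm_fdiff_le_gnorm:
  assumes "i + j \<le> J"
  shows "cmod ((fdiff d ^^ j) f (t + real i * d)) \<le> v j * gnorm v J d t f"
proof -
  have "cmod ((fdiff d ^^ j) f (t + real i * d)) \<le> dmax J d t f j"
    by (rule dmax_ge[OF assms])
  also have "dmax J d t f j / v j \<le> gnorm v J d t f"
    unfolding gnorm_def
    by (rule member_le_sum) (use assms in \<open>auto intro!: divide_nonneg_pos dmax_nonneg v_pos\<close>)
  then have "dmax J d t f j \<le> v j * gnorm v J d t f"
    using v_pos[of j] by (simp add: divide_le_eq mult.commute)
  finally show ?thesis .
qed

lemma gnorm_add: "gnorm v J d t (\<lambda>t. f t + g t) \<le> gnorm v J d t f + gnorm v J d t g"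
proof -
  have "gnorm v J d t (\<lambda>t. f t + g t) \<le> (\<Sum>j\<le>J. dmax J d t f j / v j + dmax J d t g j / v j)"
  proof (rule gnorm_le)
    fix i j assume "i + j \<le> J"
    then have "cmod ((fdiff d ^^ j) (\<lambda>t. f t + g t) (t + real i * d)) \<le> dmax J d t f j + dmax J d t g j"
      unfolding fdiff_pow_add by (intro order_trans[OF norm_triangle_ineq] add_mono dmax_ge)
    also have "\<dots> = v j * (dmax J d t f j / v j + dmax J d t g j / v j)"
      using v_pos[of j] by (simp add: field_simps)
    finally show "cmod ((fdiff d ^^ j) (\<lambda>t. f t + g t) (t + real i * d)) \<le> \<dots>" .
  qed
  then show ?thesis by (simp add: gnorm_def sum.distrib)
qed

lemma gnorm_sum: "finite A \<Longrightarrow> gnorm v J d t (\<lambda>t. \<Sum>i\<in>A. f i t) \<le> (\<Sum>i\<in>A. gnorm v J d t (f i))"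
proof (induction A rule: finite_induct)
  case empty
  have "gnorm v J d t (\<lambda>t. 0) \<le> (\<Sum>j\<le>J. 0)"
  proof (rule gnorm_le)
    fix i j
    show "cmod ((fdiff d ^^ j) (\<lambda>t. 0) (t + real i * d)) \<le> v j * 0"
      using fdiff_pow_cmult[where c=0 and f="\<lambda>_. 0" and k=j and d=d] by simp
  qed
  then show ?case by simp
next
  case (insert x F)
  then show ?case using gnorm_add[of d t "f x" "\<lambda>t. \<Sum>i\<in>F. f i t"] by simp
qed

text \<open>The Leibniz rule and \<open>v_mult\<close> give the terms of a Cauchy product truncated
  at i + j <= J. All terms are nonnegative, so the triangle of indices may be enlarged to the
  square, where the sum factors.\<close>

lemma gnorm_mult: "gnorm v J d t (\<lambda>t. f t * g t) \<le> gnorm v J d t f * gnorm v J d t g"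
proof -
  let ?A = "\<lambda>j. dmax J d t f j / v j" and ?B = "\<lambda>j. dmax J d t g j / v j"
  have nn: "0 \<le> ?A j" "0 \<le> ?B j" for j
    by (auto intro!: divide_nonneg_pos dmax_nonneg v_pos)
  have "gnorm v J d t (\<lambda>t. f t * g t) \<le> (\<Sum>k\<le>J. \<Sum>j\<le>k. ?A j * ?B (k - j))"
  proof (rule gnorm_le)
    fix i k assume ik: "i + k \<le> J"
    have "cmod ((fdiff d ^^ k) (\<lambda>t. f t * g t) (t + real i * d)) \<le>
      (\<Sum>j\<le>k. cmod (of_nat (k choose j) * (fdiff d ^^ j) f (t + real i * d) *
          (fdiff d ^^ (k - j)) g (t + real i * d + real j * d)))"
      unfolding fdiff_pow_mult' by (rule norm_sum)
    also have "\<dots> \<le> (\<Sum>j\<le>k. v k * (?A j * ?B (k - j)))"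
    proof (rule sum_mono)
      fix j assume j: "j \<in> {..k}"
      have "cmod ((fdiff d ^^ (k - j)) g (t + real (i + j) * d)) \<le> dmax J d t g (k - j)"
        by (rule dmax_ge) (use ik j in auto)
      then have "cmod (of_nat (k choose j) * (fdiff d ^^ j) f (t + real i * d) *
          (fdiff d ^^ (k - j)) g (t + real i * d + real j * d))
          \<le> real (k choose j) * dmax J d t f j * dmax J d t g (k - j)"
        unfolding norm_mult norm_of_nat
        by (intro mult_mono mult_nonneg_nonneg dmax_ge dmax_nonneg) (use ik j in \<open>auto simp: algebra_simps\<close>)
      also have "\<dots> = (real (k choose j) * v j * v (k - j)) * (?A j * ?B (k - j))"
        using v_pos[of j] v_pos[of "k - j"] by simp
      also have "\<dots> \<le> v k * (?A j * ?B (k - j))"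
        using v_mult[of j "k - j"] j ik by (intro mult_right_mono mult_nonneg_nonneg nn) auto
      finally show "cmod (of_nat (k choose j) * (fdiff d ^^ j) f (t + real i * d) *
          (fdiff d ^^ (k - j)) g (t + real i * d + real j * d)) \<le> v k * (?A j * ?B (k - j))" .
    qed
    finally show "cmod ((fdiff d ^^ k) (\<lambda>t. f t * g t) (t + real i * d)) \<le> v k * (\<Sum>j\<le>k. ?A j * ?B (k - j))"
      by (simp add: sum_distrib_left)
  qed
  also have "\<dots> = (\<Sum>(i, j)\<in>{(i, j). i + j \<le> J}. ?A i * ?B j)"
    by (rule sum.triangle_reindex_eq[symmetric])
  also have "\<dots> \<le> (\<Sum>(i, j)\<in>{..J} \<times> {..J}. ?A i * ?B j)"
    proof (rule sum_mono2)
    fix p show "0 \<le> (case p of (i, j) \<Rightarrow> ?A i * ?B j)"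
      by (cases p) (simp only: prod.case mult_nonneg_nonneg nn)
  qed auto
  also have "\<dots> = gnorm v J d t f * gnorm v J d t g"
    by (simp add: gnorm_def sum_product sum.cartesian_product)
  finally show ?thesis .
qed

lemma gnorm_one: "gnorm v J d t (\<lambda>t. 1) \<le> 1"
proof -
  have "gnorm v J d t (\<lambda>t. 1) \<le> (\<Sum>j\<le>J. if j = 0 then 1 else 0)"
  proof (rule gnorm_le)
    fix i j
    show "cmod ((fdiff d ^^ j) (\<lambda>t. 1) (t + real i * d)) \<le> v j * (if j = 0 then 1 else 0)"
      using fdiff_pow_const[where k="j - 1" and d=d and c=1] v_0 by (cases j) auto
  qed
  then show ?thesis by simp
qed

lemma gnorm_power: "gnorm v J d t (\<lambda>t. f t ^ n) \<le> gnorm v J d t f ^ n"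
proof (induction n)
  case 0
  then show ?case using gnorm_one by simp
next
  case (Suc n)
  have "gnorm v J d t (\<lambda>t. f t ^ Suc n) \<le> gnorm v J d t f * gnorm v J d t (\<lambda>t. f t ^ n)"
    by (simp add: gnorm_mult)
  also have "\<dots> \<le> gnorm v J d t f * gnorm v J d t f ^ n"
    by (intro mult_left_mono Suc gnorm_nonneg)
  finally show ?case by simp
qed

end

text \<open>
  The exponent \<open>min j s\<close> reflects that only the moment of order \<open>s\<close> is finite.
  A small \<open>y\<close> discounts the differences of positive order.
\<close>
definition std_weight :: "real \<Rightarrow> real \<Rightarrow> real \<Rightarrow> nat \<Rightarrow> real" where
  "std_weight d s y j = fact j * d powr min (real j) s / y ^ j"

text \<open>The factorials cancel the binomial coefficient, the powers of y multiply exactly, and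
  the exponent min j s is subadditive in j, which for d <= 1 gives the right direction.\<close>

lemma diff_weight_std_weight:
  assumes "0 < d" "d \<le> 1" "0 < y" "0 \<le> s"
  shows "diff_weight (std_weight d s y) J"
  unfolding std_weight_def[abs_def]
proof
  fix j k :: nat
  have "d powr min (real j) s * d powr min (real k) s = d powr (min (real j) s + min (real k) s)"
    by (simp add: powr_add)
  also have "\<dots> \<le> d powr min (real (j + k)) s"
    using assms by (intro powr_mono') (auto simp: min_def)
  finally have *: "d powr min (real j) s * d powr min (real k) s \<le> d powr min (real (j + k)) s" .
  have "real ((j + k) choose j) * (fact j * fact k) = fact (j + k)"
    using binomial_fact_lemma[of j "j + k"]
    by (metis add_diff_cancel_left' le_add1 mult.commute of_nat_fact of_nat_mult)
  then have "real ((j + k) choose j) * (fact j * d powr min (real j) s / y ^ j) * (fact k * d powr min (real k) s / y ^ k)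
    = fact (j + k) * (d powr min (real j) s * d powr min (real k) s) / y ^ (j + k)"
    by (simp add: power_add field_simps)
  also have "\<dots> \<le> fact (j + k) * d powr min (real (j + k)) s / y ^ (j + k)"
    using * assms by (intro divide_right_mono mult_left_mono) auto
  finally show "real ((j + k) choose j) * (fact j * d powr min (real j) s / y ^ j) * (fact k * d powr min (real k) s / y ^ k)
     \<le> fact (j + k) * d powr min (real (j + k)) s / y ^ (j + k)" .
qed (use assms in auto)

text \<open>Cauchy's inequality on unit circles. Since j >= 1, a constant \<open>c u\<close> chosen
  separately for each centre may be subtracted before differentiating; with \<open>c u\<close> the
  value of h at u, only the oscillation of h matters.\<close>

lemma fdiff_pow_holomorphic_bound:
  assumes "h holomorphic_on UNIV" "0 \<le> d" "1 \<le> j"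
    and B: "\<And>u z. t \<le> u \<Longrightarrow> u \<le> t + real j * d \<Longrightarrow> cmod (complex_of_real u - z) = 1 \<Longrightarrow> cmod (h z - c u) \<le> B"
  shows "cmod ((fdiff d ^^ j) (\<lambda>t. h (of_real t)) t) \<le> d ^ j * (fact j * B)"
proof -
  define G where "G k u = (deriv ^^ k) h (of_real u)" for k and u :: real
  have hol: "(deriv ^^ k) h holomorphic_on UNIV" for k
    by (rule holomorphic_higher_deriv) (use assms in auto)
  have "cmod ((fdiff d ^^ j) (G 0) t) \<le> d ^ j * (fact j * B)"
  proof (rule fdiff_pow_bound)
    fix k and u :: real
    have "((deriv ^^ k) h has_field_derivative deriv ((deriv ^^ k) h) (of_real u)) (at (of_real u))"
      by (rule holomorphic_derivI[OF hol]) auto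
    then show "(G k has_vector_derivative G (Suc k) u) (at u)"
      unfolding G_def using has_vector_derivative_real_field by fastforce
  next
    fix u assume u: "t \<le> u" "u \<le> t + real j * d"
    have "(deriv ^^ j) (\<lambda>z. h z - c u) (of_real u) = (deriv ^^ j) h (of_real u)"
      using higher_deriv_diff[OF assms(1) holomorphic_on_const[of "c u"], where n = j and z = "of_real u"] assms(3)
      by simp
    moreover have "cmod ((deriv ^^ j) (\<lambda>z. h z - c u) (of_real u)) \<le> fact j * B / 1 ^ j"
      by (rule Cauchy_inequality)
        (use assms(1) B[OF u] in \<open>auto intro!: holomorphic_intros holomorphic_on_imp_continuous_on
           intro: holomorphic_on_subset\<close>)
    ultimately show "cmod (G j u) \<le> fact j * B" by (simp add: G_def)
  qed (use assms in auto)
  moreover have "G 0 = (\<lambda>t. h (of_real t))" by (simp add: G_def fun_eq_iff)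
  ultimately show ?thesis by simp
qed

lemma fdiff_pow_lborel_integrable:
  assumes "integrable lborel h"
  shows "integrable lborel ((fdiff d ^^ k) h)"
proof (induction k)
  case (Suc k)
  have "integrable lborel (\<lambda>t. (fdiff d ^^ k) h (d + 1 * t))"
    by (rule lborel_integrable_real_affine[OF Suc]) simp
  then have "integrable lborel (\<lambda>t. (fdiff d ^^ k) h (t + d) - (fdiff d ^^ k) h t)"
    using Suc by (simp add: add.commute)
  then show ?case by (simp only: fdiff_pow_Suc[abs_def])
qed (use assms in simp)

text \<open>Translation invariance of Lebesgue measure moves each shift of h into the exponential,
  where it becomes the factor e^(i d x).\<close>

lemma fourier_fdiff_pow:
  assumes h: "integrable lborel h"
  shows "(\<integral>t. iexp (- (t * x)) * (fdiff d ^^ k) h t \<partial>lborel) =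
    (iexp (d * x) - 1) ^ k * (\<integral>t. iexp (- (t * x)) * h t \<partial>lborel)"
proof (induction k)
  case (Suc k)
  let ?g = "(fdiff d ^^ k) h"
  let ?f = "\<lambda>t. iexp (- (t * x)) * ?g t"
  have g[simp]: "integrable lborel ?g" by (rule fdiff_pow_lborel_integrable[OF h])
  have [measurable]: "?g \<in> borel_measurable borel" using borel_measurable_integrable[OF g] by simp
  have f: "integrable lborel ?f"
    by (rule Bochner_Integration.integrable_bound[OF g]) (auto simp: norm_mult)
  have f': "integrable lborel (\<lambda>t. ?f (d + 1 * t))"
    by (rule lborel_integrable_real_affine[OF f]) simp
  have "(\<integral>t. iexp (- (t * x)) * (fdiff d ^^ Suc k) h t \<partial>lborel) =
    (\<integral>t. iexp (d * x) * ?f (d + 1 * t) - ?f t \<partial>lborel)"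
    by (intro Bochner_Integration.integral_cong refl)
      (simp add: fdiff_def algebra_simps flip: exp_add)
  also have "\<dots> = (\<integral>t. iexp (d * x) * ?f (d + 1 * t) \<partial>lborel) - (\<integral>t. ?f t \<partial>lborel)"
    by (intro Bochner_Integration.integral_diff f f' integrable_mult_right)
  also have "(\<integral>t. iexp (d * x) * ?f (d + 1 * t) \<partial>lborel) = iexp (d * x) * (\<integral>t. ?f t \<partial>lborel)"
    using lborel_integral_real_affine[of 1 ?f d] by simp
  finally show ?case by (simp only: Suc.IH power_Suc left_diff_distrib mult_1 mult.assoc)
qed simp

section \<open>Fourier transforms\<close>

lemma has_vector_derivative_iff_tendsto:
  "(f has_vector_derivative D) (at t) \<longleftrightarrow> ((\<lambda>h. (f (t + h) - f t) /\<^sub>R h) \<longlongrightarrow> D) (at 0)"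
proof -
  have "((\<lambda>h. norm (f (t + h) - f t - h *\<^sub>R D) / norm h) \<longlongrightarrow> 0) (at 0) \<longleftrightarrow>
     ((\<lambda>h. norm ((f (t + h) - f t) /\<^sub>R h - D)) \<longlongrightarrow> 0) (at 0)"
  proof (rule tendsto_cong, rule eventually_at_filter[THEN iffD2], rule always_eventually, safe)
    fix h :: real assume "h \<noteq> 0"
    then have "(f (t + h) - f t) /\<^sub>R h - D = (f (t + h) - f t - h *\<^sub>R D) /\<^sub>R h"
      by (simp add: scaleR_diff_right)
    then show "norm (f (t + h) - f t - h *\<^sub>R D) / norm h = norm ((f (t + h) - f t) /\<^sub>R h - D)"
      by (simp add: divide_inverse mult.commute)
  qed
  also have "\<dots> \<longleftrightarrow> ((\<lambda>h. (f (t + h) - f t) /\<^sub>R h) \<longlongrightarrow> D) (at 0)"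
    by (subst (2) Lim_null) (simp add: tendsto_norm_zero_iff)
  finally show ?thesis
    by (simp add: has_vector_derivative_def has_derivative_at bounded_linear_scaleR_left)
qed

text \<open>Differentiation under the integral sign: |e^(ihx) - 1| <= |h x| makes |x g(x)| a
  majorant of the difference quotients. The measure is left general because both Lebesgue measure
  with a Gaussian and a probability distribution occur.\<close>

lemma has_vector_derivative_integral_iexp:
  fixes g :: "real \<Rightarrow> complex"
  assumes g: "integrable M g" and xg: "integrable M (\<lambda>x. of_real x * g x)" and [measurable_cong, simp]: "sets M = sets borel"
  shows "((\<lambda>t. \<integral>x. iexp (t * x) * g x \<partial>M) has_vector_derivative
    (\<integral>x. iexp (t * x) * (\<i> * of_real x * g x) \<partial>M)) (at t)"
proof -
  have [measurable]: "g \<in> borel_measurable M" using g by simp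
  have int[simp]: "integrable M (\<lambda>x. iexp (t * x) * g x)" for t
    by (rule Bochner_Integration.integrable_bound[OF g]) (auto simp: norm_mult)
  have lim: "(\<lambda>n. ((\<integral>x. iexp ((t + h n) * x) * g x \<partial>M) - (\<integral>x. iexp (t * x) * g x \<partial>M)) /\<^sub>R h n)
      \<longlonglongrightarrow> (\<integral>x. iexp (t * x) * (\<i> * of_real x * g x) \<partial>M)"
    if h: "h \<longlonglongrightarrow> 0" "\<And>n. h n \<noteq> 0" for h :: "nat \<Rightarrow> real"
  proof -
    have "(\<lambda>n. \<integral>x. iexp (t * x) * g x * ((iexp (h n * x) - 1) /\<^sub>R h n) \<partial>M)
      \<longlonglongrightarrow> (\<integral>x. iexp (t * x) * g x * (\<i> * of_real x) \<partial>M)"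
    proof (rule integral_dominated_convergence[where w = "\<lambda>x. cmod (of_real x * g x)"])
      show "AE x in M. (\<lambda>n. iexp (t * x) * g x * ((iexp (h n * x) - 1) /\<^sub>R h n))
        \<longlonglongrightarrow> iexp (t * x) * g x * (\<i> * of_real x)"
      proof (rule AE_I2, rule tendsto_mult[OF tendsto_const])
        fix x
        have "((\<lambda>s. iexp (s * x)) has_vector_derivative \<i> * of_real x) (at 0)"
          by (auto intro!: derivative_eq_intros simp: has_vector_derivative_complex_iff Re_exp Im_exp)
        then have "((\<lambda>s. (iexp (s * x) - 1) /\<^sub>R s) \<longlongrightarrow> \<i> * of_real x) (at 0)"
          by (simp add: has_vector_derivative_iff_tendsto)
        then show "(\<lambda>n. (iexp (h n * x) - 1) /\<^sub>R h n) \<longlonglongrightarrow> \<i> * of_real x"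
          using h by (subst (asm) LIMSEQ_SEQ_conv[symmetric]) blast
      qed
    next
      fix n
      show "AE x in M. cmod (iexp (t * x) * g x * ((iexp (h n * x) - 1) /\<^sub>R h n)) \<le> cmod (of_real x * g x)"
      proof (rule AE_I2)
        fix x
        have "cmod (iexp (h n * x) - 1) \<le> \<bar>h n * x\<bar>"
          using iexp_approx1[of "h n * x" 0] by simp
        then have "cmod ((iexp (h n * x) - 1) /\<^sub>R h n) \<le> \<bar>x\<bar>"
          using h(2)[of n] by (simp add: abs_mult divide_simps mult.commute)
        then show "cmod (iexp (t * x) * g x * ((iexp (h n * x) - 1) /\<^sub>R h n)) \<le> cmod (of_real x * g x)"
          unfolding norm_mult by (simp add: mult_left_mono mult.commute[of "cmod (g x)"] mult_right_mono)
      qed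
    qed (use xg in \<open>auto simp del: of_real_mult\<close>)
    also have "(\<lambda>n. \<integral>x. iexp (t * x) * g x * ((iexp (h n * x) - 1) /\<^sub>R h n) \<partial>M) =
      (\<lambda>n. ((\<integral>x. iexp ((t + h n) * x) * g x \<partial>M) - (\<integral>x. iexp (t * x) * g x \<partial>M)) /\<^sub>R h n)"
    proof
      fix n
      have "(\<integral>x. iexp (t * x) * g x * ((iexp (h n * x) - 1) /\<^sub>R h n) \<partial>M) =
        (\<integral>x. (iexp ((t + h n) * x) * g x - iexp (t * x) * g x) /\<^sub>R h n \<partial>M)"
        by (intro Bochner_Integration.integral_cong refl) (simp add: algebra_simps exp_add)
      also have "\<dots> = ((\<integral>x. iexp ((t + h n) * x) * g x \<partial>M) - (\<integral>x. iexp (t * x) * g x \<partial>M)) /\<^sub>R h n"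
        by (simp del: of_real_mult of_real_add)
      finally show "(\<integral>x. iexp (t * x) * g x * ((iexp (h n * x) - 1) /\<^sub>R h n) \<partial>M) = \<dots>" .
    qed
    finally show ?thesis by (simp add: mult_ac)
  qed
  show ?thesis
    unfolding has_vector_derivative_iff_tendsto LIMSEQ_SEQ_conv[symmetric] using lim by blast
qed


text \<open>This is the Fourier transform of the r-th Hermite polynomial times the normal density,
  hence the building block of the transformed Edgeworth terms.\<close>

definition gauss_moment :: "nat \<Rightarrow> real \<Rightarrow> complex" where
  "gauss_moment r t = (\<i> * of_real t) ^ r * of_real (exp (- t\<^sup>2 / 2))"

lemma integrable_gauss_moment [simp]: "integrable lborel (gauss_moment r)"
proof -
  have "integrable lborel (\<lambda>t. (\<i> ^ r * of_real (sqrt (2 * pi))) * complex_of_real (std_normal_density t * t ^ r))"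
    by (intro integrable_mult_right integrable_of_real integrable_std_normal_moment)
  also have "(\<lambda>t. (\<i> ^ r * of_real (sqrt (2 * pi))) * complex_of_real (std_normal_density t * t ^ r)) = gauss_moment r"
    by (auto simp: fun_eq_iff gauss_moment_def std_normal_density_def power_mult_distrib)
  finally show ?thesis .
qed

lemma fourier_gauss_moment_0:
  "(\<integral>t. iexp (- (t * x)) * gauss_moment 0 t \<partial>lborel) = of_real (sqrt (2 * pi) * exp (- x\<^sup>2 / 2))"
proof -
  have "(\<integral>t. iexp (- (t * x)) * gauss_moment 0 t \<partial>lborel)
    = (\<integral>t. of_real (sqrt (2 * pi)) * (std_normal_density t *\<^sub>R iexp ((- x) * t)) \<partial>lborel)"
    by (intro Bochner_Integration.integral_cong refl)
      (simp add: gauss_moment_def std_normal_density_def scaleR_conv_of_real mult_ac)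
  also have "\<dots> = of_real (sqrt (2 * pi)) * char std_normal_distribution (- x)"
    unfolding char_def by (subst integral_mult_right_zero, subst integral_density) (auto simp: normal_density_nonneg)
  finally show ?thesis by (simp add: char_std_normal_distribution)
qed

lemma fourier_gauss_moment_deriv:
  "((\<lambda>x. \<integral>t. iexp (- (t * x)) * gauss_moment r t \<partial>lborel) has_vector_derivative
    - (\<integral>t. iexp (- (t * x)) * gauss_moment (Suc r) t \<partial>lborel)) (at x)"
proof -
  let ?F = "\<lambda>x. \<integral>t. iexp (x * t) * gauss_moment r t \<partial>lborel"
  have eq: "\<i> * of_real t * gauss_moment r t = gauss_moment (Suc r) t" for t
    by (simp add: gauss_moment_def)
  have "integrable lborel (\<lambda>t. -\<i> * gauss_moment (Suc r) t)"
    by (intro integrable_mult_right integrable_gauss_moment)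
  also have "(\<lambda>t. -\<i> * gauss_moment (Suc r) t) = (\<lambda>t. of_real t * gauss_moment r t)"
    by (simp add: gauss_moment_def fun_eq_iff flip: mult.assoc)
  finally have "(?F has_vector_derivative (\<integral>t. iexp (y * t) * gauss_moment (Suc r) t \<partial>lborel)) (at y)" for y
    using has_vector_derivative_integral_iexp[of lborel "gauss_moment r" y] by (simp add: eq)
  then have "((?F \<circ> uminus) has_vector_derivative
    (-1) *\<^sub>R (\<integral>t. iexp ((- x) * t) * gauss_moment (Suc r) t \<partial>lborel)) (at x)"
    by (intro vector_diff_chain_at) (assumption | rule derivative_eq_intros refl)+
  then show ?thesis by (simp add: o_def mult.commute)
qed

text \<open>Each derivative in x multiplies the integrand by -it. The integral is therefore, up to
  sign, the r-th derivative of the transform of the Gaussian, which is Rodrigues' formula for the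
  Hermite polynomial.\<close>

lemma fourier_gauss_moment:
  "(\<integral>t. iexp (- (t * x)) * gauss_moment r t \<partial>lborel) = of_real (2 * pi * (hermite r x * std_normal_density x))"
proof -
  \<comment> \<open>The sign makes \<open>D (Suc r)\<close> the derivative of
    \<open>D r\<close>.\<close>
  define D where "D r x = (-1) ^ r * (\<integral>t. iexp (- (t * x)) * gauss_moment r t \<partial>lborel)" for r and x :: real
  have D: "(D r has_vector_derivative D (Suc r) x) (at x)" for r x
    using has_vector_derivative_mult_right[OF fourier_gauss_moment_deriv[of r x], of "(-1) ^ r"]
    by (simp add: D_def[abs_def])
  have "D r x = of_real (sqrt (2 * pi) * (deriv ^^ r) (\<lambda>y. exp (- y\<^sup>2 / 2)) x)" for x
  proof (induction r arbitrary: x)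
    case 0
    show ?case unfolding D_def fourier_gauss_moment_0 by simp
  next
    case (Suc r)
    let ?e = "(deriv ^^ r) (\<lambda>y::real. exp (- y\<^sup>2 / 2))"
    have Dr: "D r = (\<lambda>x. of_real (sqrt (2 * pi) * ?e x))" using Suc by (simp add: fun_eq_iff)
    \<comment> \<open>\<open>hermite\<close> is defined by iterated real derivatives, so the complex
      vector derivative is split; its imaginary part is the derivative of the zero function.\<close>
    have re: "((\<lambda>x. sqrt (2 * pi) * ?e x) has_field_derivative Re (D (Suc r) x)) (at x)"
      and im: "((\<lambda>x. 0) has_field_derivative Im (D (Suc r) x)) (at x)"
      using D[of r x] unfolding has_vector_derivative_complex_iff Dr by simp_all
    have "Im (D (Suc r) x) = 0" using DERIV_unique[OF im DERIV_const] .
    moreover have "((\<lambda>x. (sqrt (2 * pi) * ?e x) / sqrt (2 * pi)) has_field_derivative Re (D (Suc r) x) / sqrt (2 * pi)) (at x)"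
      by (rule DERIV_cdivide[OF re])
    then have "(?e has_field_derivative Re (D (Suc r) x) / sqrt (2 * pi)) (at x)" by simp
    then have "deriv ?e x = Re (D (Suc r) x) / sqrt (2 * pi)" by (rule DERIV_imp_deriv)
    ultimately show ?case by (simp add: complex_eq_iff)
  qed
  from this[of x] have "(-1) ^ r * D r x = of_real (sqrt (2 * pi) * ((-1) ^ r * (deriv ^^ r) (\<lambda>y. exp (- y\<^sup>2 / 2)) x))"
    by simp
  also have "(-1) ^ r * D r x = (\<integral>t. iexp (- (t * x)) * gauss_moment r t \<partial>lborel)"
    by (simp add: D_def flip: power_mult_distrib mult.assoc)
  also have "sqrt (2 * pi) * ((-1) ^ r * (deriv ^^ r) (\<lambda>y. exp (- y\<^sup>2 / 2)) x) =
    2 * pi * (hermite r x * std_normal_density x)"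
  proof -
    have "exp (x\<^sup>2 / 2) * exp (- x\<^sup>2 / 2) = 1" by (simp flip: exp_add)
    then have "hermite r x * std_normal_density x = (-1) ^ r * (deriv ^^ r) (\<lambda>y. exp (- y\<^sup>2 / 2)) x / sqrt (2 * pi)"
      by (simp add: hermite_def std_normal_density_def mult_ac)
    then have "2 * pi * (hermite r x * std_normal_density x) =
      (sqrt (2 * pi) * sqrt (2 * pi)) * ((-1) ^ r * (deriv ^^ r) (\<lambda>y. exp (- y\<^sup>2 / 2)) x / sqrt (2 * pi))"
      by simp
    then show ?thesis
      by (metis (no_types, lifting) nonzero_mult_div_cancel_left mult.assoc real_sqrt_gt_0_iff less_irrefl
          mult.left_commute pi_gt_zero times_divide_eq_right zero_less_mult_iff zero_less_numeral)
  qed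
  finally show ?thesis .
qed

section \<open>The inverse Fourier integral\<close>

lemma integral_Icc_iexp:
  assumes "a \<le> b" "t \<noteq> 0"
  shows "(\<integral>x. indicator {a..b} x *\<^sub>R iexp (- (t * x)) \<partial>lborel) = (iexp (- (t * a)) - iexp (- (t * b))) / (\<i> * t)"
proof -
  have "(\<integral>x. indicator {a..b} x *\<^sub>R iexp (- (t * x)) \<partial>lborel) = \<i> / of_real t * iexp (- (t * b)) - \<i> / of_real t * iexp (- (t * a))"
  proof (rule integral_FTC_Icc[OF assms(1)])
    fix x
    show "((\<lambda>x. \<i> / of_real t * iexp (- (t * x))) has_vector_derivative iexp (- (t * x))) (at x within {a..b})"
      using assms(2) by (auto intro!: derivative_eq_intros simp: has_vector_derivative_complex_iff Re_exp Im_exp)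
  qed (auto intro!: continuous_intros)
  also have "\<dots> = (iexp (- (t * a)) - iexp (- (t * b))) / (\<i> * t)"
    using assms(2) by (simp add: field_simps)
  finally show ?thesis .
qed

definition inverse_fourier :: "(real \<Rightarrow> complex) \<Rightarrow> real \<Rightarrow> complex" where
  "inverse_fourier h x = (\<integral>t. iexp (- (t * x)) * h t \<partial>lborel) / (2 * pi)"

lemma integrable_iexp_mult:
  assumes "integrable lborel h"
  shows "integrable lborel (\<lambda>t. iexp (- (t * x)) * h t)"
proof -
  have [measurable]: "h \<in> borel_measurable borel" using borel_measurable_integrable[OF assms] by simp
  show ?thesis
    by (rule Bochner_Integration.integrable_bound[OF assms]) (auto simp: norm_mult)
qed

lemma norm_inverse_fourier_le:
  "cmod (inverse_fourier h x) \<le> (\<integral>t. cmod (h t) \<partial>lborel) / (2 * pi)"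
proof -
  have "cmod (\<integral>t. iexp (- (t * x)) * h t \<partial>lborel) \<le> (\<integral>t. cmod (iexp (- (t * x)) * h t) \<partial>lborel)"
    by (rule integral_norm_bound)
  then show ?thesis by (simp add: inverse_fourier_def norm_divide norm_mult divide_right_mono)
qed

lemma continuous_on_inverse_fourier:
  assumes "integrable lborel h"
  shows "continuous_on UNIV (inverse_fourier h)"
proof -
  have [measurable]: "h \<in> borel_measurable borel" using borel_measurable_integrable[OF assms] by simp
  have "isCont (\<lambda>x. \<integral>t. iexp (- (t * x)) * h t \<partial>lborel) x" for x
    unfolding continuous_at_sequentially
  proof safe
    fix X assume X: "X \<longlonglongrightarrow> x"
    show "((\<lambda>x. \<integral>t. iexp (- (t * x)) * h t \<partial>lborel) \<circ> X) \<longlonglongrightarrow> (\<integral>t. iexp (- (t * x)) * h t \<partial>lborel)"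
      unfolding comp_def
      by (rule integral_dominated_convergence[where w = "\<lambda>t. cmod (h t)"])
        (auto intro!: tendsto_intros X assms integrable_norm simp: norm_mult)
  qed
  then show ?thesis
    unfolding inverse_fourier_def[abs_def] by (intro continuous_at_imp_continuous_on continuous_intros ballI) auto
qed

section \<open>Fourier inversion\<close>

text \<open>Levy's formula is a limit of truncated integrals. Integrability of the characteristic
  function turns it into one absolutely convergent integral; its kernel is the Fourier integral of
  the indicator of [a, b], so Fubini's theorem exposes the density.\<close>

lemma (in real_distribution) Levy_inversion_integrable:
  assumes int: "integrable lborel (char M)"
    and ab: "a \<le> b" "measure M {a} = 0" "measure M {b} = 0"
  shows "measure M {a<..b} = (\<integral>x. indicator {a..b} x * Re (inverse_fourier (char M) x) \<partial>lborel)"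
proof -
  let ?F = "\<lambda>t. (iexp (-(t * a)) - iexp (-(t * b))) / (\<i> * t)"
  \<comment> \<open>At t = 0 division by zero gives the kernel the value 0 while the integral is b -
    a, so the equality is claimed almost everywhere only.\<close>
  have F: "AE t in lborel. ?F t = (\<integral>x. indicator {a..b} x *\<^sub>R iexp (- (t * x)) \<partial>lborel)"
    using AE_lborel_singleton[of 0] by eventually_elim (subst integral_Icc_iexp[OF ab(1)], auto)
  have cm[measurable]: "char M \<in> borel_measurable borel" by simp
  have Fb: "AE t in lborel. cmod (?F t) \<le> b - a"
    using F
  proof eventually_elim
    case (elim t)
    have "cmod (\<integral>x. indicator {a..b} x *\<^sub>R iexp (- (t * x)) \<partial>lborel) \<le> (\<integral>x. cmod (indicator {a..b} x *\<^sub>R iexp (- (t * x))) \<partial>lborel)"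
      by (rule integral_norm_bound)
    also have "\<dots> = (\<integral>x. indicator {a..b} x \<partial>lborel)" by simp
    also have "\<dots> = b - a" using ab by simp
    finally show ?case using elim by simp
  qed
  have [measurable]: "?F \<in> borel_measurable borel" by measurable
  have intF: "integrable lborel (\<lambda>t. ?F t * char M t)"
  proof (rule Bochner_Integration.integrable_bound)
    show "integrable lborel (\<lambda>t. (b - a) *\<^sub>R char M t)" by (intro integrable_scaleR_right int)
    show "AE t in lborel. cmod (?F t * char M t) \<le> cmod ((b - a) *\<^sub>R char M t)"
      using Fb by eventually_elim (unfold norm_mult norm_scaleR, rule mult_right_mono, use ab in auto)
  qed simp
  have lim: "(\<lambda>T::nat. CLBINT t=ereal (real_of_int (- int T))..ereal (real T). ?F t * char M t) \<longlonglongrightarrow> (\<integral>t. ?F t * char M t \<partial>lborel)"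
  proof -
    have "(\<lambda>T::nat. \<integral>t. indicator {-real T<..<real T} t *\<^sub>R (?F t * char M t) \<partial>lborel) \<longlonglongrightarrow> (\<integral>t. ?F t * char M t \<partial>lborel)"
    proof (rule integral_dominated_convergence[where w = "\<lambda>t. cmod (?F t * char M t)"])
      show "AE t in lborel. (\<lambda>T::nat. indicator {-real T<..<real T} t *\<^sub>R (?F t * char M t)) \<longlonglongrightarrow> ?F t * char M t"
      proof (rule AE_I2)
        fix t :: real
        have "\<forall>\<^sub>F T in sequentially. \<bar>t\<bar> < real T"
          using filterlim_at_top_dense filterlim_real_sequentially by blast
        then have "\<forall>\<^sub>F T in sequentially. indicator {-real T<..<real T} t *\<^sub>R (?F t * char M t) = ?F t * char M t"
          by eventually_elim (auto simp: indicator_def)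
        then show "(\<lambda>T::nat. indicator {-real T<..<real T} t *\<^sub>R (?F t * char M t)) \<longlonglongrightarrow> ?F t * char M t"
          by (rule tendsto_eventually)
      qed
    qed (use intF in \<open>auto intro!: integrable_norm AE_I2 mult_left_le_one_le simp: indicator_def\<close>)
    also have "(\<lambda>T::nat. \<integral>t. indicator {-real T<..<real T} t *\<^sub>R (?F t * char M t) \<partial>lborel) =
       (\<lambda>T::nat. (CLBINT t=ereal (real_of_int (- int T))..ereal (real T). ?F t * char M t))"
      by (simp add: fun_eq_iff interval_lebesgue_integral_def set_lebesgue_integral_def)
    finally show ?thesis .
  qed
  have "of_real (measure M {a<..b}) = 1 / (2 * pi) * (\<integral>t. ?F t * char M t \<partial>lborel)"
    using LIMSEQ_unique[OF Levy_Inversion[OF ab] tendsto_mult[OF tendsto_const lim]] by simp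
  also have "(\<integral>t. ?F t * char M t \<partial>lborel) = (\<integral>t. (\<integral>x. indicator {a..b} x *\<^sub>R iexp (- (t * x)) * char M t \<partial>lborel) \<partial>lborel)"
  proof (rule integral_cong_AE)
    show "AE t in lborel. ?F t * char M t = (\<integral>x. indicator {a..b} x *\<^sub>R iexp (- (t * x)) * char M t \<partial>lborel)"
      using F by eventually_elim (simp only: integral_mult_left_zero)
  qed measurable
  also have "\<dots> = (\<integral>x. (\<integral>t. indicator {a..b} x *\<^sub>R iexp (- (t * x)) * char M t \<partial>lborel) \<partial>lborel)"
  proof (rule lborel_pair.Fubini_integral[symmetric])
    show "integrable (lborel \<Otimes>\<^sub>M lborel) (\<lambda>(t, x). indicator {a..b} x *\<^sub>R iexp (- (t * x)) * char M t)"
    proof (rule lborel_pair.Fubini_integrable)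
      have "(\<integral>x. cmod (indicator {a..b} x *\<^sub>R iexp (- (t * x)) * char M t) \<partial>lborel) = cmod (char M t) * (b - a)" for t
      proof -
        have "(\<integral>x. cmod (indicator {a..b} x *\<^sub>R iexp (- (t * x)) * char M t) \<partial>lborel) =
          (\<integral>x. cmod (char M t) * indicator {a..b} x \<partial>lborel)"
          by (intro Bochner_Integration.integral_cong refl) (auto simp: norm_mult indicator_def)
        then show ?thesis using ab by simp
      qed
      then show "integrable lborel (\<lambda>t. \<integral>x. cmod (case (t, x) of (t, x) \<Rightarrow> indicator {a..b} x *\<^sub>R iexp (- (t * x)) * char M t) \<partial>lborel)"
        using integrable_norm[OF int] by simp
      show "AE t in lborel. integrable lborel (\<lambda>x. case (t, x) of (t, x) \<Rightarrow> indicator {a..b} x *\<^sub>R iexp (- (t * x)) * char M t)"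
        unfolding prod.case
        by (intro AE_I2 integrable_mult_left borel_integrable_compact) (auto intro!: continuous_intros)
    qed measurable
  qed
  also have "\<dots> = (\<integral>x. 2 * pi * (indicator {a..b} x *\<^sub>R inverse_fourier (char M) x) \<partial>lborel)"
    unfolding inverse_fourier_def
    by (intro Bochner_Integration.integral_cong refl) (auto simp: indicator_def)
  also have "1 / (2 * pi) * \<dots> = (\<integral>x. indicator {a..b} x *\<^sub>R inverse_fourier (char M) x \<partial>lborel)"
    by (subst integral_mult_right_zero) simp
  finally have *: "of_real (measure M {a<..b}) = (\<integral>x. indicator {a..b} x *\<^sub>R inverse_fourier (char M) x \<partial>lborel)" .
  have "integrable lborel (\<lambda>x. indicator {a..b} x *\<^sub>R inverse_fourier (char M) x)"
    by (rule borel_integrable_compact) (auto intro: continuous_on_subset[OF continuous_on_inverse_fourier[OF int]])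
  then have "Re (\<integral>x. indicator {a..b} x *\<^sub>R inverse_fourier (char M) x \<partial>lborel) =
     (\<integral>x. Re (indicator {a..b} x *\<^sub>R inverse_fourier (char M) x) \<partial>lborel)"
    by (rule integral_Re[symmetric])
  with * show ?thesis by (simp add: complex_eq_iff)
qed


text \<open>The inversion formula is available at endpoints without mass. As the candidate density
  is bounded by C, short intervals have small measure, which rules out atoms altogether; then
  continuity yields the sign and half-lines identify the measure.\<close>

theorem (in real_distribution) density_of_integrable_char:
  assumes int: "integrable lborel (char M)"
  defines "\<rho> \<equiv> \<lambda>x. Re (inverse_fourier (char M) x)"
  shows "M = density lborel (\<lambda>x. ennreal (\<rho> x))" "0 \<le> \<rho> x"
proof -
  define C where "C = (\<integral>t. cmod (char M t) \<partial>lborel) / (2 * pi)"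
  have C: "\<bar>\<rho> x\<bar> \<le> C" for x
    using norm_inverse_fourier_le[of "char M" x] abs_Re_le_cmod[of "inverse_fourier (char M) x"]
    unfolding \<rho>_def C_def by linarith
  have C0: "0 \<le> C" using C[of 0] by simp
  have cont: "continuous_on UNIV \<rho>"
    unfolding \<rho>_def by (intro continuous_intros continuous_on_inverse_fourier int)
  then have [measurable]: "\<rho> \<in> borel_measurable borel" by (rule borel_measurable_continuous_onI)
  have Icc: "integrable lborel (\<lambda>x. indicator {a..b} x * \<rho> x)" for a b
    using borel_integrable_compact[of "{a..b}" \<rho>] continuous_on_subset[OF cont] by simp
  have Levy: "measure M {a<..b} = (\<integral>x. indicator {a..b} x * \<rho> x \<partial>lborel)"
    if "a \<le> b" "measure M {a} = 0" "measure M {b} = 0" for a b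
    using Levy_inversion_integrable[OF int that] by (simp add: \<rho>_def)
  have nonatom: "measure M {a} = 0" for a
  proof (rule ccontr)
    assume "measure M {a} \<noteq> 0"
    then have pos: "measure M {a} > 0" using measure_nonneg[of M "{a}"] by linarith
    \<comment> \<open>Chosen so that an interval around a of length at most 2 e, with endpoints
      outside the countable set of atoms, has measure less than that of {a}.\<close>
    define e where "e = measure M {a} / (2 * (C + 1))"
    have e: "e > 0" using pos C0 by (simp add: e_def)
    obtain l where l: "l \<in> {a - e<..<a}" "measure M {l} = 0"
      using open_minus_countable[OF countable_support, of "{a - e<..<a}"] e by auto
    obtain r where r: "r \<in> {a<..<a + e}" "measure M {r} = 0"
      using open_minus_countable[OF countable_support, of "{a<..<a + e}"] e by auto
    have "measure M {a} \<le> measure M {l<..r}"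
      by (rule finite_measure_mono) (use l r in auto)
    also have "\<dots> = (\<integral>x. indicator {l..r} x * \<rho> x \<partial>lborel)" by (rule Levy) (use l r in auto)
    also have "\<dots> \<le> (\<integral>x. C * indicator {l..r} x \<partial>lborel)"
    proof (rule integral_mono[OF Icc])
      show "indicator {l..r} x * \<rho> x \<le> C * indicator {l..r} x" for x
        using C[of x] by (auto simp: indicator_def)
    qed (use l r in simp)
    also have "\<dots> = C * (r - l)" using l r by simp
    also have "\<dots> \<le> C * (2 * e)" using l r C0 by (intro mult_left_mono) auto
    also have "\<dots> < (C + 1) * (2 * e)" using e by simp
    also have "\<dots> = measure M {a}" using C0 by (simp add: e_def field_simps)
    finally show False by simp
  qed
  note Levy = Levy[OF _ nonatom nonatom]
  show nn: "0 \<le> \<rho> x" for x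
  proof (rule ccontr)
    assume neg: "\<not> 0 \<le> \<rho> x"
    \<comment> \<open>By continuity a negative value persists on an interval, whose measure would
      then be negative.\<close>
    have "open {y. \<rho> y < \<rho> x / 2}" by (intro open_Collect_less cont continuous_on_const)
    moreover have "x \<in> {y. \<rho> y < \<rho> x / 2}" using neg by simp
    ultimately obtain d where "d > 0" "\<forall>y. dist y x < d \<longrightarrow> y \<in> {y. \<rho> y < \<rho> x / 2}"
      unfolding open_dist by blast
    then have d: "d > 0" "\<And>y. \<bar>y - x\<bar> < d \<Longrightarrow> \<rho> y < \<rho> x / 2"
      by (auto simp: dist_real_def)
    have "0 \<le> measure M {x - d/2<..x + d/2}" by simp
    also have "\<dots> = (\<integral>y. indicator {x - d/2..x + d/2} y * \<rho> y \<partial>lborel)" by (rule Levy) (use d in auto)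
    also have "\<dots> \<le> (\<integral>y. \<rho> x / 2 * indicator {x - d/2..x + d/2} y \<partial>lborel)"
    proof (rule integral_mono[OF Icc])
      show "indicator {x - d/2..x + d/2} y * \<rho> y \<le> \<rho> x / 2 * indicator {x - d/2..x + d/2} y" for y
      proof (cases "y \<in> {x - d/2..x + d/2}")
        case True
        then have "\<bar>y - x\<bar> < d" using d(1) unfolding atLeastAtMost_iff by arith
        from d(2)[OF this] True show ?thesis by (simp add: indicator_def)
      qed auto
    qed (intro integrable_mult_right integrable_real_indicator; simp add: emeasure_lborel_Icc_eq)
    also have "\<dots> = \<rho> x / 2 * d" using d by simp
    also have "\<dots> < 0" using neg d by (simp add: mult_neg_pos)
    finally show False by simp
  qed
  show "M = density lborel (\<lambda>x. ennreal (\<rho> x))"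
  proof (rule measure_eqI_lessThan)
    fix x
    let ?N = "density lborel (\<lambda>x. ennreal (\<rho> x))"
    have eq: "emeasure M {x<..x + real n} = emeasure ?N {x<..x + real n}" for n
    proof -
      have "emeasure ?N {x<..x + real n} = (\<integral>\<^sup>+y. ennreal (\<rho> y) * indicator {x<..x + real n} y \<partial>lborel)"
        by (rule emeasure_density) auto
      also have "\<dots> = (\<integral>\<^sup>+y. ennreal (indicator {x..x + real n} y * \<rho> y) \<partial>lborel)"
      proof (rule nn_integral_cong_AE)
        show "AE y in lborel. ennreal (\<rho> y) * indicator {x<..x + real n} y = ennreal (indicator {x..x + real n} y * \<rho> y)"
          using AE_lborel_singleton[of x] by eventually_elim (auto simp: indicator_def)
      qed
      also have "\<dots> = ennreal (\<integral>y. indicator {x..x + real n} y * \<rho> y \<partial>lborel)"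
        by (rule nn_integral_eq_integral[OF Icc]) (auto simp: nn)
      also have "\<dots> = ennreal (measure M {x<..x + real n})" by (subst Levy) auto
      finally show ?thesis by (simp add: emeasure_eq_measure)
    qed
    \<comment> \<open>The formula covers bounded intervals, so half-lines are exhausted by
      them.\<close>
    have U: "{x<..} = (\<Union>n. {x<..x + real n})"
    proof safe
      fix y assume "x < y"
      obtain n where "y - x \<le> real n" using real_arch_simple by blast
      then show "y \<in> (\<Union>n. {x<..x + real n})" using \<open>x < y\<close> by (intro UN_I[of n]) auto
    qed auto
    have inc: "incseq (\<lambda>n. {x<..x + real n})" by (auto simp: incseq_def)
    have "(SUP n. emeasure M {x<..x + real n}) = emeasure M {x<..}"
      unfolding U by (rule SUP_emeasure_incseq[OF _ inc]) auto
    moreover have "(SUP n. emeasure ?N {x<..x + real n}) = emeasure ?N {x<..}"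
      unfolding U by (rule SUP_emeasure_incseq[OF _ inc]) auto
    ultimately show "emeasure M {x<..} = emeasure ?N {x<..}" by (simp add: eq)
  qed (auto simp: less_top[symmetric])
qed

section \<open>Characteristic functions of bounded densities\<close>

lemma fourier_gauss_scaled:
  assumes "0 < k"
  shows "(\<integral>t. iexp (t * u) * of_real (exp (- (t / k)\<^sup>2 / 2)) \<partial>lborel) = of_real (2 * pi * normal_density 0 (1 / k) u)"
proof -
  have "(\<integral>t. iexp (t * u) * of_real (exp (- (t / k)\<^sup>2 / 2)) \<partial>lborel) =
    \<bar>k\<bar> *\<^sub>R (\<integral>t. iexp ((0 + k * t) * u) * of_real (exp (- ((0 + k * t) / k)\<^sup>2 / 2)) \<partial>lborel)"
    by (rule lborel_integral_real_affine) (use assms in auto)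
  also have "(\<integral>t. iexp ((0 + k * t) * u) * of_real (exp (- ((0 + k * t) / k)\<^sup>2 / 2)) \<partial>lborel) =
    (\<integral>t. iexp (- (t * (- k * u))) * gauss_moment 0 t \<partial>lborel)"
    using assms by (intro Bochner_Integration.integral_cong refl) (simp add: gauss_moment_def mult_ac)
  also have "\<dots> = of_real (sqrt (2 * pi) * exp (- (k * u)\<^sup>2 / 2))"
    unfolding fourier_gauss_moment_0 by simp
  also have "\<bar>k\<bar> *\<^sub>R \<dots> = of_real (2 * pi * normal_density 0 (1 / k) u)"
  proof -
    have "normal_density 0 (1 / k) u = k / sqrt (2 * pi) * exp (- (k * u)\<^sup>2 / 2)"
      using assms by (simp add: normal_density_def real_sqrt_mult real_sqrt_divide power_mult_distrib field_simps)
    moreover have "k * sqrt (2 * pi) = 2 * pi * (k / sqrt (2 * pi))"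
      using real_sqrt_mult_self[of "2 * pi"] by (simp add: field_simps)
    ultimately have "k * (sqrt (2 * pi) * exp (- (k * u)\<^sup>2 / 2)) = 2 * pi * normal_density 0 (1 / k) u"
      by (simp only: mult.assoc[symmetric])
    then show ?thesis using assms by (simp only: scaleR_conv_of_real abs_of_pos flip: of_real_mult)
  qed
  finally show ?thesis .
qed

text \<open>The squared modulus is the characteristic function of X - Y for independent copies X and
  Y. Integrated against a Gaussian weight of width K it gives 2 pi times the mean of a normal
  density of width 1/K at X - Y, which is at most 2 pi C for every K. Fatou's lemma removes the
  weight.\<close>

lemma (in real_distribution) integrable_char_square:
  assumes M: "M = density lborel (\<lambda>x. ennreal (\<rho> x))" and [measurable]: "\<rho> \<in> borel_measurable borel"
    and b: "\<And>x. 0 \<le> \<rho> x" "\<And>x. \<rho> x \<le> C"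
  shows "integrable lborel (\<lambda>t. (cmod (char M t))\<^sup>2)"
proof -
  interpret P: pair_prob_space M M ..
  have C0: "0 \<le> C" using b[of 0] by linarith
  let ?w = "\<lambda>k t. exp (- (t / real (Suc k))\<^sup>2 / 2)"
  have w_int: "integrable lborel (?w k)" for k
  proof -
    have "integrable lborel (\<lambda>t. sqrt (2 * pi) * real (Suc k) * normal_density 0 (real (Suc k)) t)"
      by (intro integrable_mult_right integrable_normal_density) simp
    also have "(\<lambda>t. sqrt (2 * pi) * real (Suc k) * normal_density 0 (real (Suc k)) t) = ?w k"
      by (auto simp: fun_eq_iff normal_density_def real_sqrt_mult power_divide simp del: of_nat_Suc)
    finally show ?thesis .
  qed
  have main: "(\<integral>t. (cmod (char M t))\<^sup>2 * ?w k t \<partial>lborel) \<le> 2 * pi * C" for k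
  proof -
    define K where "K = real (Suc k)"
    have K: "K > 0" by (simp add: K_def)
    let ?h = "\<lambda>t (x, y). iexp (t * (x - y)) * of_real (exp (- (t / K)\<^sup>2 / 2))"
    interpret Q: pair_sigma_finite lborel "M \<Otimes>\<^sub>M M" ..
    have sq: "of_real ((cmod (char M t))\<^sup>2) = (\<integral>z. iexp (t * (fst z - snd z)) \<partial>(M \<Otimes>\<^sub>M M))" for t
    proof -
      have i[simp]: "integrable M (\<lambda>x. iexp (t * x))" for t by (rule integrable_const_bound[of _ 1]) auto
      have "of_real ((cmod (char M t))\<^sup>2) = char M t * cnj (char M t)" by (rule complex_norm_square)
      also have "cnj (char M t) = (\<integral>y. iexp (- (t * y)) \<partial>M)"
        unfolding char_def by (subst Bochner_Integration.integral_cnj[symmetric]) (simp add: exp_cnj)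
      also have "char M t * \<dots> = (\<integral>x. \<integral>y. iexp (t * x) * iexp (- (t * y)) \<partial>M \<partial>M)"
        unfolding char_def by simp
      also have "\<dots> = (\<integral>x. \<integral>y. iexp (t * (x - y)) \<partial>M \<partial>M)"
        by (intro Bochner_Integration.integral_cong refl) (simp add: algebra_simps flip: exp_add)
      also have "\<dots> = (\<integral>z. (case z of (x, y) \<Rightarrow> iexp (t * (x - y))) \<partial>(M \<Otimes>\<^sub>M M))"
        by (rule P.integral_fst) (auto intro!: P.P.integrable_const_bound[of _ 1] simp: split_beta)
      finally show ?thesis by (simp add: split_beta)
    qed
    have "complex_of_real (\<integral>t. (cmod (char M t))\<^sup>2 * ?w k t \<partial>lborel) =
      (\<integral>t. of_real ((cmod (char M t))\<^sup>2) * of_real (exp (- (t / K)\<^sup>2 / 2)) \<partial>lborel)"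
      by (simp only: integral_complex_of_real[symmetric] of_real_mult K_def)
    also have "\<dots> = (\<integral>t. (\<integral>z. ?h t z \<partial>(M \<Otimes>\<^sub>M M)) \<partial>lborel)"
      unfolding sq by (simp add: split_beta)
    also have "\<dots> = (\<integral>z. (\<integral>t. ?h t z \<partial>lborel) \<partial>(M \<Otimes>\<^sub>M M))"
    proof (rule Q.Fubini_integral[symmetric], rule Q.Fubini_integrable)
      have "(\<integral>z. cmod (?h t z) \<partial>(M \<Otimes>\<^sub>M M)) = ?w k t" for t
        by (simp add: norm_mult split_beta P.P.prob_space K_def)
      then show "integrable lborel (\<lambda>t. \<integral>z. norm (case (t, z) of (t, z) \<Rightarrow> ?h t z) \<partial>(M \<Otimes>\<^sub>M M))"
        using w_int[of k] by simp
      show "AE t in lborel. integrable (M \<Otimes>\<^sub>M M) (\<lambda>z. case (t, z) of (t, z) \<Rightarrow> ?h t z)"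
        by (intro AE_I2 P.P.integrable_const_bound[of _ 1]) (auto simp: norm_mult split_beta)
    qed (simp add: split_beta)
    also have "\<dots> = (\<integral>z. of_real (2 * pi * normal_density 0 (1 / K) (fst z - snd z)) \<partial>(M \<Otimes>\<^sub>M M))"
      by (simp only: split_beta fourier_gauss_scaled[OF K])
    also have "\<dots> = of_real (\<integral>z. 2 * pi * normal_density 0 (1 / K) (fst z - snd z) \<partial>(M \<Otimes>\<^sub>M M))"
      by (rule integral_complex_of_real)
    finally have eq: "(\<integral>t. (cmod (char M t))\<^sup>2 * ?w k t \<partial>lborel) = (\<integral>z. 2 * pi * normal_density 0 (1 / K) (fst z - snd z) \<partial>(M \<Otimes>\<^sub>M M))"
      by (simp only: of_real_eq_iff)
    have "ennreal (\<integral>z. 2 * pi * normal_density 0 (1 / K) (fst z - snd z) \<partial>(M \<Otimes>\<^sub>M M))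
       \<le> (\<integral>\<^sup>+z. ennreal (2 * pi * normal_density 0 (1 / K) (fst z - snd z)) \<partial>(M \<Otimes>\<^sub>M M))"
    proof (subst nn_integral_eq_integral)
      have "normal_density 0 (1 / K) u \<le> K / sqrt (2 * pi)" for u
        using K by (simp add: normal_density_def real_sqrt_mult real_sqrt_divide field_simps mult_le_cancel_left1)
      then show "integrable (M \<Otimes>\<^sub>M M) (\<lambda>z. 2 * pi * normal_density 0 (1 / K) (fst z - snd z))"
        by (intro integrable_mult_right P.P.integrable_const_bound[of _ "K / sqrt (2 * pi)"]) auto
    qed auto
    also have "\<dots> = (\<integral>\<^sup>+y. (\<integral>\<^sup>+x. ennreal (2 * pi * normal_density 0 (1 / K) (x - y)) \<partial>M) \<partial>M)"
      by (subst P.nn_integral_snd[symmetric]) (auto simp: split_beta)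
    \<comment> \<open>For fixed y the density of the first variable is replaced by its bound C; what
      remains is a normal density centred at y, of integral 1.\<close>
    also have "\<dots> \<le> (\<integral>\<^sup>+y. ennreal (2 * pi * C) \<partial>M)"
    proof (rule nn_integral_mono)
      fix y
      have "(\<integral>\<^sup>+x. ennreal (2 * pi * normal_density 0 (1 / K) (x - y)) \<partial>M) =
        (\<integral>\<^sup>+x. ennreal (\<rho> x) * ennreal (2 * pi * normal_density 0 (1 / K) (x - y)) \<partial>lborel)"
        unfolding M by (rule nn_integral_density) auto
      also have "\<dots> \<le> (\<integral>\<^sup>+x. ennreal (2 * pi * C) * ennreal (normal_density y (1 / K) x) \<partial>lborel)"
      proof (rule nn_integral_mono)
        fix x
        have "\<rho> x * (2 * pi * normal_density 0 (1 / K) (x - y)) \<le> C * (2 * pi * normal_density 0 (1 / K) (x - y))"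
          by (intro mult_right_mono b) auto
        moreover have "normal_density 0 (1 / K) (x - y) = normal_density y (1 / K) x"
          by (simp add: normal_density_def)
        ultimately show "ennreal (\<rho> x) * ennreal (2 * pi * normal_density 0 (1 / K) (x - y)) \<le>
          ennreal (2 * pi * C) * ennreal (normal_density y (1 / K) x)"
          using b C0 by (simp flip: ennreal_mult' add: ennreal_mult'[symmetric] mult_ac ennreal_leI)
      qed
      also have "\<dots> = ennreal (2 * pi * C) * (\<integral>\<^sup>+x. ennreal (normal_density y (1 / K) x) \<partial>lborel)"
        by (rule nn_integral_cmult) auto
      also have "(\<integral>\<^sup>+x. ennreal (normal_density y (1 / K) x) \<partial>lborel) = 1"
        using K by (subst nn_integral_eq_integral) auto
      finally show "(\<integral>\<^sup>+x. ennreal (2 * pi * normal_density 0 (1 / K) (x - y)) \<partial>M) \<le> ennreal (2 * pi * C)" by simp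
    qed
    also have "\<dots> = ennreal (2 * pi * C)" by (simp add: emeasure_space_1[simplified])
    finally show ?thesis using C0 unfolding eq by (subst (asm) ennreal_le_iff) auto
  qed
  have "(\<integral>\<^sup>+t. ennreal ((cmod (char M t))\<^sup>2) \<partial>lborel) = (\<integral>\<^sup>+t. liminf (\<lambda>k. ennreal ((cmod (char M t))\<^sup>2 * ?w k t)) \<partial>lborel)"
  proof (rule nn_integral_cong)
    fix t
    have "(\<lambda>k. ?w k t) \<longlonglongrightarrow> exp (- 0\<^sup>2 / 2)"
      using LIMSEQ_Suc[OF lim_const_over_n[of t]] by (intro tendsto_intros) (auto simp del: of_nat_Suc)
    then have "(\<lambda>k. ennreal ((cmod (char M t))\<^sup>2 * ?w k t)) \<longlonglongrightarrow> ennreal ((cmod (char M t))\<^sup>2 * exp (- 0\<^sup>2 / 2))"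
      by (intro tendsto_ennrealI tendsto_mult tendsto_const)
    then show "ennreal ((cmod (char M t))\<^sup>2) = liminf (\<lambda>k. ennreal ((cmod (char M t))\<^sup>2 * ?w k t))"
      using lim_imp_Liminf[OF sequentially_bot] by fastforce
  qed
  also have "\<dots> \<le> liminf (\<lambda>k. \<integral>\<^sup>+t. ennreal ((cmod (char M t))\<^sup>2 * ?w k t) \<partial>lborel)"
    by (rule nn_integral_liminf) simp
  also have "\<dots> \<le> liminf (\<lambda>k. ennreal (2 * pi * C))"
  proof (rule Liminf_mono, rule always_eventually, rule allI)
    fix k
    have "integrable lborel (\<lambda>t. (cmod (char M t))\<^sup>2 * ?w k t)"
      by (rule Bochner_Integration.integrable_bound[OF w_int[of k]])
        (auto intro!: AE_I2 mult_left_le_one_le power_le_one cmod_char_le_1 simp: abs_mult)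
    then have "(\<integral>\<^sup>+t. ennreal ((cmod (char M t))\<^sup>2 * ?w k t) \<partial>lborel) = ennreal (\<integral>t. (cmod (char M t))\<^sup>2 * ?w k t \<partial>lborel)"
      by (rule nn_integral_eq_integral) auto
    also have "\<dots> \<le> ennreal (2 * pi * C)" by (intro ennreal_leI main)
    finally show "(\<integral>\<^sup>+t. ennreal ((cmod (char M t))\<^sup>2 * ?w k t) \<partial>lborel) \<le> ennreal (2 * pi * C)" .
  qed
  also have "\<dots> < \<infinity>" by (simp add: Liminf_const)
  finally show ?thesis by (intro integrableI_bounded) auto
qed

lemma (in real_distribution) char_lipschitz:
  assumes "integrable M (\<lambda>x. x)"
  shows "cmod (char M t - char M u) \<le> (\<integral>x. \<bar>x\<bar> \<partial>M) * \<bar>t - u\<bar>"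
proof -
  have i[simp]: "integrable M (\<lambda>x. iexp (t * x))" for t by (rule integrable_const_bound[of _ 1]) auto
  have "cmod (char M t - char M u) = cmod (\<integral>x. iexp (t * x) - iexp (u * x) \<partial>M)"
    unfolding char_def by (simp del: of_real_mult)
  also have "\<dots> \<le> (\<integral>x. cmod (iexp (t * x) - iexp (u * x)) \<partial>M)" by (rule integral_norm_bound)
  also have "\<dots> \<le> (\<integral>x. \<bar>t - u\<bar> * \<bar>x\<bar> \<partial>M)"
  proof (rule integral_mono)
    fix x
    have "iexp (t * x) - iexp (u * x) = iexp (u * x) * (iexp ((t - u) * x) - 1)"
      by (simp add: algebra_simps flip: exp_add)
    then have "cmod (iexp (t * x) - iexp (u * x)) = cmod (iexp ((t - u) * x) - 1)" by (simp add: norm_mult)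
    also have "\<dots> \<le> \<bar>(t - u) * x\<bar>" using iexp_approx1[of "(t - u) * x" 0] by simp
    finally show "cmod (iexp (t * x) - iexp (u * x)) \<le> \<bar>t - u\<bar> * \<bar>x\<bar>" by (simp add: abs_mult)
  qed (auto intro!: integrable_abs assms integrable_norm Bochner_Integration.integrable_diff simp del: of_real_mult)
  finally show ?thesis by (simp add: mult.commute)
qed

text \<open>A value above e forces g >= e/2 on an interval of length 2 r and so an integral of at
  least e r, whereas the integral of g over a sufficiently distant tail is smaller than
  that.\<close>

lemma integrable_lipschitz_small_at_infinity:
  fixes g :: "real \<Rightarrow> real"
  assumes g: "integrable lborel g" "\<And>t. 0 \<le> g t" and L: "\<And>t u. \<bar>g t - g u\<bar> \<le> L * \<bar>t - u\<bar>" and e: "0 < e"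
  shows "\<exists>T. \<forall>t. T \<le> \<bar>t\<bar> \<longrightarrow> g t \<le> e"
proof -
  \<comment> \<open>A Lipschitz constant that is certainly positive, so that r can be defined by
    division.\<close>
  define L' where "L' = max L 1"
  have L': "L' > 0" "\<And>t u. \<bar>g t - g u\<bar> \<le> L' * \<bar>t - u\<bar>"
    by (simp add: L'_def) (rule order_trans[OF L], auto simp: L'_def intro!: mult_right_mono)
  define r where "r = e / (2 * L')"
  have r: "r > 0" "L' * r = e / 2" using e L' by (auto simp: r_def)
  have [measurable]: "g \<in> borel_measurable borel" using borel_measurable_integrable[OF g(1)] by simp
  have "(\<lambda>n. \<integral>t. indicator {t. real n \<le> \<bar>t\<bar>} t * g t \<partial>lborel) \<longlonglongrightarrow> (\<integral>t. 0 \<partial>(lborel :: real measure))"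
  proof (rule integral_dominated_convergence[where w = g])
    show "AE t in lborel. (\<lambda>n. indicator {t. real n \<le> \<bar>t\<bar>} t * g t) \<longlonglongrightarrow> 0"
    proof (rule AE_I2)
      fix t :: real
      have "\<forall>\<^sub>F n in sequentially. \<bar>t\<bar> < real n"
        using filterlim_at_top_dense filterlim_real_sequentially by blast
      then have "\<forall>\<^sub>F n in sequentially. indicator {t. real n \<le> \<bar>t\<bar>} t * g t = 0"
        by eventually_elim auto
      then show "(\<lambda>n. indicator {t. real n \<le> \<bar>t\<bar>} t * g t) \<longlonglongrightarrow> 0" by (rule tendsto_eventually)
    qed
  qed (use g in \<open>auto simp: indicator_def\<close>)
  then have "\<forall>\<^sub>F n in sequentially. (\<integral>t. indicator {t. real n \<le> \<bar>t\<bar>} t * g t \<partial>lborel) < e * r"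
    using e r by (intro order_tendstoD(2)) auto
  then obtain n where n: "(\<integral>t. indicator {t. real n \<le> \<bar>t\<bar>} t * g t \<partial>lborel) < e * r"
    by (auto dest: eventually_happens)
  show ?thesis
  proof (intro exI allI impI, rule ccontr)
    fix t assume t: "real n + r \<le> \<bar>t\<bar>" and "\<not> g t \<le> e"
    then have gt: "g t > e" by simp
    have "e * r = (\<integral>u. e / 2 * indicator {t - r..t + r} u \<partial>lborel)" using r by simp
    also have "\<dots> \<le> (\<integral>u. indicator {t. real n \<le> \<bar>t\<bar>} u * g u \<partial>lborel)"
    proof (rule integral_mono)
      show "integrable lborel (\<lambda>u. indicator {t. real n \<le> \<bar>t\<bar>} u * g u)"
        by (rule Bochner_Integration.integrable_bound[OF g(1)]) (auto simp: indicator_def)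
      fix u
      show "e / 2 * indicator {t - r..t + r} u \<le> indicator {t. real n \<le> \<bar>t\<bar>} u * g u"
      proof (cases "u \<in> {t - r..t + r}")
        case True
        then have "\<bar>t - u\<bar> \<le> r" by auto
        then have "L' * \<bar>t - u\<bar> \<le> e / 2" using mult_left_mono[of "\<bar>t - u\<bar>" r L'] L' r by simp
        then have "g u \<ge> e / 2" using L'(2)[of t u] gt by linarith
        moreover have "real n \<le> \<bar>u\<bar>" using t \<open>\<bar>t - u\<bar> \<le> r\<close> by linarith
        ultimately show ?thesis using True by simp
      qed (use g(2) in auto)
    qed (use r in auto)
    finally show False using n by simp
  qed
qed

text \<open>After rotation by its argument a, the modulus of the characteristic function at t is the
  mean of cos(t x - a). The claim is then the mean of 1 - cos 2u <= 4 (1 - cos u), because the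
  modulus at 2 t dominates the mean of cos(2 t x - 2 a).\<close>

lemma (in real_distribution) char_double: "1 - cmod (char M (2 * t)) \<le> 4 * (1 - cmod (char M t))"
proof -
  define a where "a = Arg (char M t)"
  have i[simp]: "integrable M (\<lambda>x. iexp (t * x - c))" for t c
    by (rule integrable_const_bound[of _ 1]) (auto simp del: of_real_mult of_real_diff)
  have rot: "iexp (- c) * char M t = (\<integral>x. iexp (t * x - c) \<partial>M)" for c t
    unfolding char_def integral_mult_right_zero[symmetric]
    by (intro Bochner_Integration.integral_cong refl) (simp add: algebra_simps flip: exp_add)
  have Re_rot: "Re (iexp (- c) * char M t) = (\<integral>x. cos (t * x - c) \<partial>M)" for c t
    unfolding rot integral_Re[OF i, symmetric] by (simp add: Re_exp)
  have ci[simp]: "integrable M (\<lambda>x. cos (t * x - c))" for t c by (rule integrable_const_bound[of _ 1]) auto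
  have "char M t = of_real (cmod (char M t)) * iexp a"
    unfolding a_def using rcis_cmod_Arg[of "char M t"] by (simp add: rcis_def cis_conv_exp)
  then have "iexp (- a) * char M t = of_real (cmod (char M t)) * (iexp a * iexp (- a))" by (simp add: mult_ac)
  also have "iexp a * iexp (- a) = 1" by (simp flip: exp_add)
  finally have 1: "cmod (char M t) = (\<integral>x. cos (t * x - a) \<partial>M)" using Re_rot[of a t] by simp
  have "1 - 4 * (1 - cmod (char M t)) = (\<integral>x. 1 - 4 * (1 - cos (t * x - a)) \<partial>M)"
    unfolding 1 by (simp add: prob_space[simplified])
  also have "\<dots> \<le> (\<integral>x. cos (2 * t * x - 2 * a) \<partial>M)"
  proof (rule integral_mono)
    fix x
    have "cos (2 * t * x - 2 * a) = 2 * (cos (t * x - a))\<^sup>2 - 1"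
      using cos_double_cos[of "t * x - a"] by (simp add: algebra_simps)
    moreover have "(1 - cos (t * x - a))\<^sup>2 \<ge> 0" by simp
    ultimately show "1 - 4 * (1 - cos (t * x - a)) \<le> cos (2 * t * x - 2 * a)"
      by (simp add: power2_eq_square algebra_simps)
  qed auto
  also have "\<dots> = Re (iexp (- (2 * a)) * char M (2 * t))" by (simp only: Re_rot)
  also have "\<dots> \<le> cmod (iexp (- (2 * a)) * char M (2 * t))" by (rule complex_Re_le_cmod)
  also have "\<dots> = cmod (char M (2 * t))" by (simp add: norm_mult)
  finally show ?thesis by simp
qed

text \<open>The p-th power of the modulus is integrable and Lipschitz, so the modulus is at most 1/2
  beyond some T. Any t with |t| >= c passes T after K doublings, and \<open>char_double\<close>,
  applied K times, carries the distance 1/2 from 1 back to t at the cost of 4^K.\<close>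

lemma (in real_distribution) char_bounded_away:
  assumes M1: "integrable M (\<lambda>x. x)" and int: "integrable lborel (\<lambda>t. cmod (char M t) ^ p)" and "0 < p" and c: "0 < c"
  shows "\<exists>\<theta><1. 0 < \<theta> \<and> (\<forall>t. c \<le> \<bar>t\<bar> \<longrightarrow> cmod (char M t) \<le> \<theta>)"
proof -
  let ?L = "\<integral>x. \<bar>x\<bar> \<partial>M"
  have "\<bar>cmod (char M t) ^ p - cmod (char M u) ^ p\<bar> \<le> (real p * ?L) * \<bar>t - u\<bar>" for t u
  proof -
    have "\<bar>cmod (char M t) ^ p - cmod (char M u) ^ p\<bar> \<le> real p * \<bar>cmod (char M t) - cmod (char M u)\<bar>"
      using norm_power_diff[of "cmod (char M t)" "cmod (char M u)" p] cmod_char_le_1 by simp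
    also have "\<dots> \<le> real p * (?L * \<bar>t - u\<bar>)"
      by (intro mult_left_mono order_trans[OF norm_triangle_ineq3] char_lipschitz M1) simp
    finally show ?thesis by (simp add: mult.assoc)
  qed
  from integrable_lipschitz_small_at_infinity[OF int _ this, of "(1/2) ^ p"]
  obtain T where T: "\<And>t. T \<le> \<bar>t\<bar> \<Longrightarrow> cmod (char M t) ^ p \<le> (1/2) ^ p" by auto
  have T: "cmod (char M t) \<le> 1/2" if "T \<le> \<bar>t\<bar>" for t
    using T[OF that] \<open>0 < p\<close> by (simp add: power_mono_iff)
  obtain K where "T / c < 2 ^ K" using real_arch_pow[of 2 "T / c"] by auto
  then have K: "T < 2 ^ K * c" using c by (simp add: field_simps)
  have dbl: "1 - cmod (char M (2 ^ k * t)) \<le> 4 ^ k * (1 - cmod (char M t))" for k t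
  proof (induction k)
    case (Suc k)
    have "1 - cmod (char M (2 ^ Suc k * t)) \<le> 4 * (1 - cmod (char M (2 ^ k * t)))"
      using char_double[of "2 ^ k * t"] by (simp add: mult.assoc)
    with Suc show ?case by simp
  qed simp
  have "cmod (char M t) \<le> 1 - (1/2) / 4 ^ K" if "c \<le> \<bar>t\<bar>" for t
  proof -
    have "2 ^ K * c \<le> 2 ^ K * \<bar>t\<bar>" using that by simp
    then have "T \<le> 2 ^ K * \<bar>t\<bar>" using K by linarith
    then have "T \<le> \<bar>2 ^ K * t\<bar>" by (simp add: abs_mult)
    from T[OF this] dbl[of K t] have "1/2 \<le> 4 ^ K * (1 - cmod (char M t))" by simp
    then have "(1/2) / 4 ^ K \<le> 1 - cmod (char M t)" by (simp add: field_simps)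
    then show ?thesis by simp
  qed
  moreover have "1 - (1/2) / 4 ^ K < (1::real)" by simp
  moreover have "0 < 1 - (1/2) / (4::real) ^ K"
  proof -
    have "(1/2) / (4::real) ^ K \<le> (1/2) / 1" by (intro divide_left_mono) auto
    then show ?thesis by linarith
  qed
  ultimately show ?thesis by blast
qed

section \<open>Taylor expansion on the real line\<close>

abbreviation vderiv :: "(real \<Rightarrow> complex) \<Rightarrow> real \<Rightarrow> complex" where
  "vderiv \<equiv> \<lambda>g t. vector_derivative g (at t)"

text \<open>The successive derivatives are merely asserted to exist, at points of S, so the closure
  rules are plain inductions that never compute a value of \<open>vector_derivative\<close>. The top
  derivative need not be continuous.\<close>

primrec times_diff_on :: "nat \<Rightarrow> real set \<Rightarrow> (real \<Rightarrow> complex) \<Rightarrow> bool" where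
  "times_diff_on 0 S f \<longleftrightarrow> True"
| "times_diff_on (Suc k) S f \<longleftrightarrow> (\<exists>g. (\<forall>x\<in>S. (f has_vector_derivative g x) (at x)) \<and> times_diff_on k S g)"

lemma times_diff_on_SucD: "times_diff_on (Suc k) S f \<Longrightarrow> times_diff_on k S f"
proof (induction k arbitrary: f)
  case (Suc k)
  then obtain g where "\<forall>x\<in>S. (f has_vector_derivative g x) (at x)" "times_diff_on (Suc k) S g"
    by auto
  with Suc.IH[of g] show ?case by auto
qed simp

lemma times_diff_on_add: "times_diff_on k S f \<Longrightarrow> times_diff_on k S g \<Longrightarrow> times_diff_on k S (\<lambda>x. f x + g x)"
proof (induction k arbitrary: f g)
  case (Suc k)
  then obtain f' g' where "\<forall>x\<in>S. (f has_vector_derivative f' x) (at x)" "times_diff_on k S f'"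
    "\<forall>x\<in>S. (g has_vector_derivative g' x) (at x)" "times_diff_on k S g'"
    unfolding times_diff_on.simps by blast
  with Suc.IH[of f' g'] show ?case
    by (auto intro!: exI[of _ "\<lambda>x. f' x + g' x"] has_vector_derivative_add)
qed simp

lemma times_diff_on_mult: "times_diff_on k S f \<Longrightarrow> times_diff_on k S g \<Longrightarrow> times_diff_on k S (\<lambda>x. f x * g x)"
proof (induction k arbitrary: f g)
  case (Suc k)
  then obtain f' g' where fg: "\<forall>x\<in>S. (f has_vector_derivative f' x) (at x)" "times_diff_on k S f'"
    "\<forall>x\<in>S. (g has_vector_derivative g' x) (at x)" "times_diff_on k S g'"
    unfolding times_diff_on.simps by blast
  have "times_diff_on k S (\<lambda>x. f x * g' x + f' x * g x)"
    by (intro times_diff_on_add Suc.IH fg Suc.prems[THEN times_diff_on_SucD])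
  moreover have "((\<lambda>x. f x * g x) has_vector_derivative f x * g' x + f' x * g x) (at x)" if "x \<in> S" for x
    using has_vector_derivative_mult[OF bspec[OF fg(1) that] bspec[OF fg(3) that]] .
  ultimately show ?case
    unfolding times_diff_on.simps by (intro exI[of _ "\<lambda>x. f x * g' x + f' x * g x"] conjI ballI)
qed simp

lemma times_diff_on_const: "times_diff_on k S (\<lambda>x. c)"
  by (induction k arbitrary: c) (auto intro!: exI[of _ "\<lambda>_. 0"])

lemma times_diff_on_inverse: "times_diff_on k S f \<Longrightarrow> (\<And>x. x \<in> S \<Longrightarrow> f x \<noteq> 0) \<Longrightarrow> times_diff_on k S (\<lambda>x. inverse (f x))"
proof (induction k)
  case (Suc k)
  then obtain f' where f: "\<forall>x\<in>S. (f has_vector_derivative f' x) (at x)" "times_diff_on k S f'"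
    by auto
  have inv: "times_diff_on k S (\<lambda>x. inverse (f x))" by (rule Suc.IH[OF times_diff_on_SucD[OF Suc.prems(1)] Suc.prems(2)])
  have "times_diff_on k S (\<lambda>x. (-1) * (f' x * (inverse (f x) * inverse (f x))))"
    by (intro times_diff_on_mult times_diff_on_const f inv)
  moreover have "((\<lambda>x. inverse (f x)) has_vector_derivative (-1) * (f' x * (inverse (f x) * inverse (f x)))) (at x)"
    if "x \<in> S" for x
  proof -
    have "(inverse has_field_derivative - (inverse (f x) * inverse (f x))) (at (f x))"
      using DERIV_inverse'[of "\<lambda>x. x" 1 "f x" UNIV] Suc.prems(2)[OF that] by simp
    from field_vector_diff_chain_at[OF bspec[OF f(1) that] this]
    show ?thesis by (simp add: o_def)
  qed
  ultimately show ?case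
    unfolding times_diff_on.simps
    by (intro exI[of _ "\<lambda>x. (-1) * (f' x * (inverse (f x) * inverse (f x)))"] conjI ballI)
qed simp

lemma vderiv_cong:
  assumes "open S" "\<And>x. x \<in> S \<Longrightarrow> f x = g x" "x \<in> S"
  shows "(vderiv ^^ k) f x = (vderiv ^^ k) g x"
  using assms(3)
proof (induction k arbitrary: x)
  case (Suc k)
  \<comment> \<open>\<open>vector_derivative\<close> is a choice from this predicate, so equivalent
    predicates give equal values even where no derivative exists.\<close>
  have "((vderiv ^^ k) f has_vector_derivative D) (at x) \<longleftrightarrow> ((vderiv ^^ k) g has_vector_derivative D) (at x)" for D
    using has_vector_derivative_transform_within_open[OF _ assms(1) Suc.prems, of "(vderiv ^^ k) f" D "(vderiv ^^ k) g"]
      has_vector_derivative_transform_within_open[OF _ assms(1) Suc.prems, of "(vderiv ^^ k) g" D "(vderiv ^^ k) f"]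
      Suc.IH by auto
  then show ?case by (simp add: vector_derivative_def)
qed (use assms in auto)

lemma times_diff_on_vderiv:
  assumes "open S" "times_diff_on m S f" "k < m" "x \<in> S"
  shows "((vderiv ^^ k) f has_vector_derivative (vderiv ^^ Suc k) f x) (at x)"
  using assms(2-)
proof (induction k arbitrary: m f x)
  case 0
  then obtain m' where "m = Suc m'" by (cases m) auto
  with 0 obtain g where "(f has_vector_derivative g x) (at x)" by auto
  then show ?case by (simp add: vector_derivative_at)
next
  case (Suc k)
  then obtain m' where m': "m = Suc m'" by (cases m) auto
  with Suc.prems(1) obtain g where g: "\<And>x. x \<in> S \<Longrightarrow> (f has_vector_derivative g x) (at x)" "times_diff_on m' S g"
    unfolding m' times_diff_on.simps by blast
  have eq: "vderiv f x = g x" if "x \<in> S" for x using g(1)[OF that] by (rule vector_derivative_at)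
  have "((vderiv ^^ k) g has_vector_derivative (vderiv ^^ Suc k) g x) (at x)"
    using Suc m' g by (intro Suc.IH[of m']) auto
  then have "((vderiv ^^ k) (vderiv f) has_vector_derivative (vderiv ^^ Suc k) g x) (at x)"
    by (rule has_vector_derivative_transform_within_open[OF _ assms(1) \<open>x \<in> S\<close>])
      (rule vderiv_cong[OF assms(1)], auto simp: eq)
  also have "(vderiv ^^ Suc k) g x = (vderiv ^^ Suc k) (vderiv f) x"
    by (rule vderiv_cong[OF assms(1) _ \<open>x \<in> S\<close>, symmetric]) (rule eq)
  finally show ?case by (simp only: funpow_Suc_right o_apply)
qed

text \<open>The derivative of a remainder is the remainder of the derivative, of one order less, and
  the mean value inequality integrates the little-o bound. The order is \<open>Suc m\<close> because
  \<open>times_diff_on 0\<close> asserts nothing, not even continuity; the base case is the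
  definition of the derivative.\<close>

lemma Peano_taylor:
  assumes "open S" "0 \<in> S" "times_diff_on (Suc m) S f"
  shows "(\<lambda>u. f u - (\<Sum>k\<le>Suc m. (vderiv ^^ k) f 0 / fact k * of_real u ^ k)) \<in> o[at 0](\<lambda>u. of_real u ^ Suc m)"
  using assms(3)
proof (induction m arbitrary: f)
  case 0
  have "(f has_vector_derivative vderiv f 0) (at 0)"
    using times_diff_on_vderiv[OF assms(1) 0, of 0 0] assms(2) by simp
  then have "((\<lambda>h. (f (0 + h) - f 0) /\<^sub>R h) \<longlongrightarrow> vderiv f 0) (at 0)"
    by (simp only: has_vector_derivative_iff_tendsto)
  then have "((\<lambda>h. (f h - f 0) /\<^sub>R h - vderiv f 0) \<longlongrightarrow> 0) (at 0)"
    unfolding add_0_left by (rule LIM_zero)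
  then have "((\<lambda>u. (f u - (\<Sum>k\<le>Suc 0. (vderiv ^^ k) f 0 / fact k * of_real u ^ k)) / of_real u ^ Suc 0) \<longlongrightarrow> 0) (at 0)"
  proof (rule Lim_transform_eventually)
    show "\<forall>\<^sub>F h in at 0. (f h - f 0) /\<^sub>R h - vderiv f 0 =
      (f h - (\<Sum>k\<le>Suc 0. (vderiv ^^ k) f 0 / fact k * of_real h ^ k)) / of_real h ^ Suc 0"
      unfolding eventually_at_filter
      by (intro always_eventually allI impI) (simp add: scaleR_conv_of_real diff_divide_distrib add_divide_distrib divide_inverse mult.commute algebra_simps)
  qed
  then show ?case
    by (intro smalloI_tendsto) (auto simp: eventually_at_filter)
next
  case (Suc m)
  let ?P = "\<lambda>u::real. \<Sum>k\<le>Suc (Suc m). (vderiv ^^ k) f 0 / fact k * of_real u ^ k"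
  let ?Q = "\<lambda>u::real. \<Sum>k\<le>Suc m. (vderiv ^^ k) (vderiv f) 0 / fact k * of_real u ^ k"
  from Suc.prems obtain g where g: "\<And>x. x \<in> S \<Longrightarrow> (f has_vector_derivative g x) (at x)" "times_diff_on (Suc m) S g"
    by (subst (asm) times_diff_on.simps(2)) auto
  have eq: "vderiv f x = g x" if "x \<in> S" for x using g(1)[OF that] by (rule vector_derivative_at)
  have "(vderiv ^^ k) g 0 = (vderiv ^^ k) (vderiv f) 0" for k
    by (rule vderiv_cong[OF assms(1) _ assms(2), symmetric]) (rule eq)
  with Suc.IH[OF g(2)] have IH: "(\<lambda>u. g u - ?Q u) \<in> o[at 0](\<lambda>u. of_real u ^ Suc m)" by simp
  have deriv: "((\<lambda>u. f u - ?P u) has_vector_derivative g u - ?Q u) (at u)" if "u \<in> S" for u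
  proof (rule has_vector_derivative_diff[OF g(1)[OF that]])
    have "(?P has_vector_derivative (\<Sum>k\<le>Suc (Suc m). (vderiv ^^ k) f 0 / fact k * (of_nat k * of_real u ^ (k - 1)))) (at u)"
    proof (intro has_vector_derivative_sum has_vector_derivative_mult_right)
      fix k
      have "((\<lambda>z. z ^ k) has_field_derivative of_nat k * of_real u ^ (k - 1)) (at (complex_of_real u))"
        by (auto intro!: derivative_eq_intros)
      then show "((\<lambda>u. complex_of_real u ^ k) has_vector_derivative of_nat k * of_real u ^ (k - 1)) (at u)"
        by (rule has_vector_derivative_real_field)
    qed
    also have "(\<Sum>k\<le>Suc (Suc m). (vderiv ^^ k) f 0 / fact k * (of_nat k * complex_of_real u ^ (k - 1))) = ?Q u"
      by (subst sum.atMost_Suc_shift) (simp add: funpow_Suc_right field_simps del: funpow.simps of_nat_Suc)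
    finally show "(?P has_vector_derivative ?Q u) (at u)" .
  qed
  have 0: "f 0 - ?P 0 = 0" by (subst sum.atMost_Suc_shift) simp
  show ?case
  proof (rule landau_o.smallI)
    fix c :: real assume c: "c > 0"
    obtain e where e: "e > 0" "ball 0 e \<subseteq> S" using assms(1,2) openE by blast
    from landau_o.smallD[OF IH c] obtain d where d: "d > 0"
      and d': "\<And>u. u \<noteq> 0 \<Longrightarrow> \<bar>u\<bar> < d \<Longrightarrow> cmod (g u - ?Q u) \<le> c * \<bar>u\<bar> ^ Suc m"
      by (auto simp: eventually_at dist_real_def norm_power norm_mult)
    \<comment> \<open>The little-o bound for the derivative excludes the point 0, which the mean
      value inequality on [0, u] needs as well.\<close>
    have g0: "g 0 - ?Q 0 = 0"
      by (subst sum.atMost_Suc_shift) (simp add: eq assms(2))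
    have bound: "cmod (f u - ?P u) \<le> c * \<bar>u\<bar> ^ Suc (Suc m)" if u: "\<bar>u\<bar> < min d e" for u
    proof -
      have "cmod ((f u - ?P u) - (f 0 - ?P 0)) \<le> c * \<bar>u\<bar> ^ Suc m * norm (u - 0)"
      proof (rule vector_derivative_norm_bound[where S = "closed_segment 0 u"])
        fix v assume "v \<in> closed_segment 0 u"
        then have v: "\<bar>v\<bar> \<le> \<bar>u\<bar>" by (auto simp: closed_segment_eq_real_ivl split: if_splits)
        with u e have "v \<in> S" by (auto simp: dist_real_def)
        then show "((\<lambda>u. f u - ?P u) has_vector_derivative g v - ?Q v) (at v within closed_segment 0 u)"
          by (rule has_vector_derivative_at_within[OF deriv])
        show "cmod (g v - ?Q v) \<le> c * \<bar>u\<bar> ^ Suc m"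
        proof (cases "v = 0")
          case True
          with g0 c show ?thesis by simp
        next
          case False
          then have "cmod (g v - ?Q v) \<le> c * \<bar>v\<bar> ^ Suc m" using v u by (intro d') auto
          also have "\<dots> \<le> c * \<bar>u\<bar> ^ Suc m" using c v by (intro mult_left_mono power_mono) auto
          finally show ?thesis .
        qed
      qed auto
      then show ?thesis unfolding 0 by (simp add: mult_ac)
    qed
    show "\<forall>\<^sub>F u in at 0. cmod (f u - ?P u) \<le> c * cmod (of_real u ^ Suc (Suc m))"
      unfolding eventually_at dist_real_def norm_power norm_of_real diff_0_right
      by (intro exI[of _ "min d e"] conjI ballI impI bound) (use d e in auto)
  qed
qed

section \<open>Zeros of entire functions\<close>

lemma holomorphic_factor_at_0:
  assumes "H holomorphic_on UNIV" "H 0 = 0"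
  obtains K where "K holomorphic_on UNIV" "\<And>z. H z = z * K z"
proof -
  define K where "K z = (if z = 0 then deriv H 0 else (H z - H 0) / (z - 0))" for z
  have "K holomorphic_on UNIV"
    unfolding K_def using assms(1) by (intro pole_lemma) auto
  moreover have "H z = z * K z" for z using assms(2) by (simp add: K_def)
  ultimately show thesis using that by blast
qed

text \<open>Smallness along the real axis suffices: o(u^m) forces the value 0 at the origin, a
  factor z can be removed there, and the quotient is o(u^(m-1)). The last removal, at exponent 0,
  gives the additional factor.\<close>

lemma holomorphic_factor_power:
  assumes "H holomorphic_on UNIV" "(\<lambda>u. H (of_real u)) \<in> o[at 0](\<lambda>u::real. of_real u ^ m)"
  shows "\<exists>K. K holomorphic_on UNIV \<and> (\<forall>z. H z = z ^ Suc m * K z)"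
  using assms
proof (induction m arbitrary: H)
  have zero: "H 0 = 0" if H: "H holomorphic_on UNIV" "(\<lambda>u. H (of_real u)) \<in> o[at 0](\<lambda>u::real. of_real u ^ m)" for H m
  proof -
    have "((\<lambda>u. H (of_real u)) \<longlongrightarrow> H (of_real 0)) (at 0)"
      by (intro isCont_tendsto_compose[where g = H] tendsto_intros)
        (use holomorphic_on_imp_continuous_on[OF H(1)] in \<open>auto simp: continuous_on_eq_continuous_at\<close>)
    moreover have "(\<lambda>u. H (of_real u)) \<in> o[at 0](\<lambda>u::real. 1)"
    proof (rule landau_o.small_big_trans[OF H(2)])
      have "((\<lambda>u::real. complex_of_real u ^ m) \<longlongrightarrow> of_real 0 ^ m) (at 0)" by (intro tendsto_intros)
      then show "(\<lambda>u::real. complex_of_real u ^ m) \<in> O[at 0](\<lambda>u. 1)"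
        by (intro bigoI_tendsto[where c = "0 ^ m"]) auto
    qed
    then have "((\<lambda>u. H (of_real u)) \<longlongrightarrow> 0) (at 0)" by (auto dest: smalloD_tendsto)
    ultimately have "H (of_real 0) = 0" by (intro tendsto_unique[of "at (0::real)"]) auto
    then show "H 0 = 0" by simp
  qed
  {
    case 0
    then show ?case using holomorphic_factor_at_0[OF 0(1) zero[OF 0]] by (metis power_one_right One_nat_def)
  next
    case (Suc m)
    obtain K where K: "K holomorphic_on UNIV" "\<And>z. H z = z * K z"
      using holomorphic_factor_at_0[OF Suc.prems(1) zero[OF Suc.prems]] by blast
    have "(\<lambda>u. K (of_real u)) \<in> o[at 0](\<lambda>u::real. of_real u ^ m)"
    proof (rule landau_o.smallI)
      fix c :: real assume "c > 0"
      from landau_o.smallD[OF Suc.prems(2) this]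
      show "\<forall>\<^sub>F u in at 0. cmod (K (of_real u)) \<le> c * cmod (of_real u ^ m)"
        unfolding eventually_at_filter
        by eventually_elim (auto simp: K(2) norm_mult mult.left_commute[of c])
    qed
    from Suc.IH[OF K(1) this] show ?case using K(2) by (metis mult.assoc power_Suc)
  }
qed

section \<open>Cumulants and moments\<close>

lemma norm_exp_minus_one_le:
  assumes "cmod w \<le> 1"
  shows "cmod (exp w - 1) \<le> 3 * cmod w"
proof -
  have "cmod (exp w - exp 0) \<le> 3 * cmod (w - 0)"
  proof (rule field_differentiable_bound[where S = "cball 0 1" and f' = exp])
    fix z :: complex assume "z \<in> cball 0 1"
    then have "cmod (exp z) \<le> exp 1" by (intro order_trans[OF norm_exp]) simp
    then show "cmod (exp z) \<le> 3" using exp_le by linarith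
  qed (use assms in \<open>auto intro!: derivative_eq_intros\<close>)
  then show ?thesis by simp
qed

definition cumulant_poly :: "real measure \<Rightarrow> nat \<Rightarrow> complex \<Rightarrow> complex" where
  "cumulant_poly M m z = (\<Sum>k\<le>m. of_real (cumulant M k) * (\<i> * z) ^ k / fact k)"

text \<open>The Taylor polynomial of the characteristic function at 0, extended to complex arguments
  so that it can be compared with the entire function
  \<open>exp (cumulant_poly M m z)\<close>.\<close>

definition moment_poly :: "real measure \<Rightarrow> nat \<Rightarrow> complex \<Rightarrow> complex" where
  "moment_poly M m z = (\<Sum>k\<le>m. of_real (\<integral>x. x ^ k \<partial>M) * (\<i> * z) ^ k / fact k)"

lemma (in real_distribution) cnj_char: "cnj (char M t) = char M (- t)"
  unfolding char_def Bochner_Integration.integral_cnj[symmetric] by (simp add: exp_cnj)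

lemma (in real_distribution) integrable_power_le:
  assumes "integrable M (\<lambda>x. \<bar>x\<bar> ^ m)" "k \<le> m"
  shows "integrable M (\<lambda>x. \<bar>x\<bar> ^ k)" "integrable M (\<lambda>x. x ^ k)"
proof -
  show *: "integrable M (\<lambda>x. \<bar>x\<bar> ^ k)"
  proof (rule Bochner_Integration.integrable_bound)
    show "integrable M (\<lambda>x. 1 + \<bar>x\<bar> ^ m)" using assms by (intro Bochner_Integration.integrable_add) auto
    have "\<bar>x\<bar> ^ k \<le> 1 + \<bar>x\<bar> ^ m" for x :: real
    proof (cases "\<bar>x\<bar> \<le> 1")
      case True
      then show ?thesis by (intro order_trans[OF power_le_one]) auto
    next
      case False
      then have "\<bar>x\<bar> ^ k \<le> \<bar>x\<bar> ^ m" by (intro power_increasing assms) auto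
      then show ?thesis by linarith
    qed
    then show "AE x in M. norm (\<bar>x\<bar> ^ k) \<le> norm (1 + \<bar>x\<bar> ^ m)" by (intro AE_I2) simp
  qed simp
  show "integrable M (\<lambda>x. x ^ k)"
    by (rule Bochner_Integration.integrable_bound[OF *]) (auto simp: power_abs)
qed

definition char_deriv :: "real measure \<Rightarrow> nat \<Rightarrow> real \<Rightarrow> complex" where
  "char_deriv M k t = (\<integral>x. iexp (t * x) * (\<i> * of_real x) ^ k \<partial>M)"

lemma char_deriv_0: "char_deriv M 0 = char M"
  by (simp add: char_deriv_def char_def fun_eq_iff)

lemma (in real_distribution) char_deriv_at_0:
  assumes "integrable M (\<lambda>x. x ^ k)"
  shows "char_deriv M k 0 = \<i> ^ k * of_real (\<integral>x. x ^ k \<partial>M)"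
proof -
  have "char_deriv M k 0 = (\<integral>x. \<i> ^ k * of_real (x ^ k) \<partial>M)"
    unfolding char_deriv_def by (intro Bochner_Integration.integral_cong refl) (simp add: power_mult_distrib)
  then show ?thesis by (simp only: integral_mult_right_zero integral_complex_of_real)
qed

lemma (in real_distribution) has_vector_derivative_char_deriv:
  assumes "integrable M (\<lambda>x. \<bar>x\<bar> ^ m)" "k < m"
  shows "(char_deriv M k has_vector_derivative char_deriv M (Suc k) t) (at t)"
proof -
  have int: "integrable M (\<lambda>x. (\<i> * of_real x) ^ j)" if "j \<le> m" for j
  proof -
    have "integrable M (\<lambda>x. \<i> ^ j * of_real (x ^ j))"
      by (intro integrable_mult_right integrable_of_real integrable_power_le(2)[OF assms(1) that])
    then show ?thesis by (simp add: power_mult_distrib)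
  qed
  have "integrable M (\<lambda>x. - \<i> * (\<i> * of_real x) ^ Suc k)"
    by (intro integrable_mult_right int) (use assms in simp)
  also have "(\<lambda>x. - \<i> * (\<i> * of_real x) ^ Suc k) = (\<lambda>x. of_real x * (\<i> * complex_of_real x) ^ k)"
    by (simp add: fun_eq_iff flip: mult.assoc)
  finally have "integrable M (\<lambda>x. of_real x * (\<i> * of_real x) ^ k)" .
  from has_vector_derivative_integral_iexp[OF int this, of t] assms
  show ?thesis unfolding char_deriv_def[abs_def] by (simp add: mult_ac)
qed

lemma (in real_distribution) times_diff_on_char_deriv:
  assumes "integrable M (\<lambda>x. \<bar>x\<bar> ^ m)" "r + k \<le> m"
  shows "times_diff_on r S (char_deriv M k)"
  using assms(2)
proof (induction r arbitrary: k)
  case (Suc r)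
  then have "times_diff_on r S (char_deriv M (Suc k))" by (intro Suc.IH) auto
  with has_vector_derivative_char_deriv[OF assms(1), of k] Suc.prems show ?case
    by auto
qed simp

lemma (in real_distribution) vderiv_char:
  assumes "integrable M (\<lambda>x. \<bar>x\<bar> ^ m)" "k \<le> m"
  shows "(vderiv ^^ k) (char M) = char_deriv M k"
  using assms(2)
proof (induction k)
  case (Suc k)
  then have "vderiv (char_deriv M k) t = char_deriv M (Suc k) t" for t
    by (intro vector_derivative_at has_vector_derivative_char_deriv[OF assms(1)]) auto
  moreover have "(vderiv ^^ k) (char M) = char_deriv M k" using Suc by simp
  ultimately show ?case by (simp only: funpow.simps o_apply)
qed (simp add: char_deriv_0)

lemma (in real_distribution) char_taylor:
  assumes "integrable M (\<lambda>x. \<bar>x\<bar> ^ m)" "0 < m"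
  shows "(\<lambda>u. char M u - moment_poly M m (of_real u)) \<in> o[at 0](\<lambda>u. of_real u ^ m)"
proof -
  obtain m' where m': "m = Suc m'" using assms(2) by (cases m) auto
  have "times_diff_on m UNIV (char M)"
    using times_diff_on_char_deriv[OF assms(1), of m 0] by (simp add: char_deriv_0)
  then have *: "(\<lambda>u. char M u - (\<Sum>k\<le>m. (vderiv ^^ k) (char M) 0 / fact k * of_real u ^ k)) \<in> o[at 0](\<lambda>u. of_real u ^ m)"
    unfolding m' by (intro Peano_taylor[of UNIV]) auto
  have "(\<Sum>k\<le>m. (vderiv ^^ k) (char M) 0 / fact k * complex_of_real u ^ k) = moment_poly M m (of_real u)" for u
    unfolding moment_poly_def
  proof (intro sum.cong refl)
    fix k assume "k \<in> {..m}"
    then have k: "k \<le> m" by simp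
    have "(vderiv ^^ k) (char M) 0 = \<i> ^ k * of_real (\<integral>x. x ^ k \<partial>M)"
      unfolding vderiv_char[OF assms(1) k] by (rule char_deriv_at_0[OF integrable_power_le(2)[OF assms(1) k]])
    then show "(vderiv ^^ k) (char M) 0 / fact k * complex_of_real u ^ k = of_real (\<integral>x. x ^ k \<partial>M) * (\<i> * of_real u) ^ k / fact k"
      by (simp add: power_mult_distrib)
  qed
  with * show ?thesis by simp
qed

text \<open>At t = 0 this makes the k-th derivative equal to (-1)^k times its own conjugate, that
  is, i^k times a real number. It is what makes the real part in \<open>cumulant\<close>
  lossless.\<close>

lemma vderiv_reflect:
  assumes "open S" "\<And>t. t \<in> S \<Longrightarrow> - t \<in> S" "times_diff_on m S f" "\<And>t. t \<in> S \<Longrightarrow> f (- t) = cnj (f t)"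
    and "k \<le> m" "t \<in> S"
  shows "(vderiv ^^ k) f (- t) = (-1) ^ k * cnj ((vderiv ^^ k) f t)"
  using assms(5,6)
proof (induction k arbitrary: t)
  case (Suc k)
  have "((vderiv ^^ k) f has_vector_derivative (vderiv ^^ Suc k) f t) (at t)"
    by (rule times_diff_on_vderiv[OF assms(1,3)]) (use Suc in auto)
  then have "((\<lambda>t. (-1) ^ k * cnj ((vderiv ^^ k) f t)) has_vector_derivative (-1) ^ k * cnj ((vderiv ^^ Suc k) f t)) (at t)"
    by (intro has_vector_derivative_mult_right has_vector_derivative_cnj)
  then have 1: "((\<lambda>t. (vderiv ^^ k) f (- t)) has_vector_derivative (-1) ^ k * cnj ((vderiv ^^ Suc k) f t)) (at t)"
    by (rule has_vector_derivative_transform_within_open[OF _ assms(1) Suc.prems(2)])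
      (use Suc in auto)
  have "((vderiv ^^ k) f has_vector_derivative (vderiv ^^ Suc k) f (- t)) (at (- t))"
    by (rule times_diff_on_vderiv[OF assms(1,3)]) (use Suc assms(2) in auto)
  then have "((vderiv ^^ k) f \<circ> uminus has_vector_derivative (-1) *\<^sub>R (vderiv ^^ Suc k) f (- t)) (at t)"
    by (intro vector_diff_chain_at) (auto intro!: derivative_eq_intros)
  then have "((\<lambda>t. (vderiv ^^ k) f (- t)) has_vector_derivative - (vderiv ^^ Suc k) f (- t)) (at t)"
    by (simp add: o_def)
  from vector_derivative_unique_at[OF this 1]
  have "(vderiv ^^ Suc k) f (- t) = - ((-1) ^ k * cnj ((vderiv ^^ Suc k) f t))"
    by (metis minus_minus)
  then show ?case by (simp only: power_Suc mult_minus1 mult.assoc) (simp only: mult_minus_left mult_1)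
qed (use assms in auto)

text \<open>The exponentiated Taylor polynomial of the logarithm and \<open>moment_poly\<close> both
  agree with the characteristic function up to o(u^m) on the real line. Their difference is entire,
  so it has a zero of order at least m + 1.\<close>

lemma (in real_distribution) exp_cumulant_poly:
  assumes m: "2 \<le> m" and int: "integrable M (\<lambda>x. \<bar>x\<bar> ^ m)"
    and mean: "(\<integral>x. x \<partial>M) = 0" and var: "(\<integral>x. x\<^sup>2 \<partial>M) = 1"
  shows "cumulant M 0 = 0" "cumulant M 1 = 0" "cumulant M 2 = 1"
    "\<exists>K. K holomorphic_on UNIV \<and> (\<forall>z. exp (cumulant_poly M m z) - moment_poly M m z = z ^ Suc m * K z)"
proof -
  let ?f = "char M"
  \<comment> \<open>An open symmetric neighbourhood of 0 on which the values avoid the cut of the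
    principal logarithm.\<close>
  define S where "S = {t. 0 < Re (?f t)}"
  have cont: "continuous_on UNIV ?f" by (intro continuous_at_imp_continuous_on ballI isCont_char)
  have S: "open S"
    unfolding S_def by (intro open_Collect_less continuous_intros cont)
  have S0: "0 \<in> S" by (simp add: S_def char_zero)
  have Sneg: "- t \<in> S" if "t \<in> S" for t using that by (simp add: S_def flip: cnj_char)
  define L where "L t = Ln (?f t)" for t
  have f0: "?f t \<noteq> 0" if "t \<in> S" for t using that by (auto simp: S_def)
  have Lderiv: "(L has_vector_derivative char_deriv M 1 t * inverse (?f t)) (at t)" if t: "t \<in> S" for t
  proof -
    have "?f t \<notin> \<real>\<^sub>\<le>\<^sub>0" using t by (auto simp: S_def complex_nonpos_Reals_iff)
    then have "(Ln has_field_derivative inverse (?f t)) (at (?f t))" by (rule has_field_derivative_Ln)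
    moreover have "(?f has_vector_derivative char_deriv M 1 t) (at t)"
      using has_vector_derivative_char_deriv[OF int, of 0 t] m by (simp add: char_deriv_0)
    ultimately have "(Ln \<circ> ?f has_vector_derivative char_deriv M 1 t * inverse (?f t)) (at t)"
      by (intro field_vector_diff_chain_at)
    then show ?thesis by (simp add: o_def L_def[abs_def])
  qed
  obtain m' where m': "m = Suc m'" using m by (cases m) auto
  have L_diff': "times_diff_on m' S (\<lambda>t. char_deriv M 1 t * inverse (?f t))"
  proof (rule times_diff_on_mult[OF _ times_diff_on_inverse])
    show "times_diff_on m' S (char_deriv M 1)" by (rule times_diff_on_char_deriv[OF int]) (simp add: m')
    show "times_diff_on m' S ?f" using times_diff_on_char_deriv[OF int, of m' 0] by (simp add: m' char_deriv_0)
  qed (rule f0)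
  have L_diff: "times_diff_on m S L"
    unfolding m' times_diff_on.simps
    by (rule exI[of _ "\<lambda>t. char_deriv M 1 t * inverse (?f t)"]) (intro conjI ballI Lderiv L_diff')
  have Lsym: "L (- t) = cnj (L t)" if "t \<in> S" for t
    unfolding L_def cnj_char[symmetric] using that
    by (intro cnj_Ln[symmetric]) (auto simp: S_def complex_nonpos_Reals_iff)
  have Lk: "(vderiv ^^ k) L 0 = \<i> ^ k * of_real (cumulant M k)" if "k \<le> m" for k
  proof -
    \<comment> \<open>The number whose real part is the cumulant; the symmetry shows that it is
      real.\<close>
    define w where "w = inverse (\<i> ^ k) * (vderiv ^^ k) L 0"
    have "(vderiv ^^ k) L 0 = (-1) ^ k * cnj ((vderiv ^^ k) L 0)"
      using vderiv_reflect[OF S Sneg L_diff Lsym that S0] by simp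
    then have "inverse (\<i> ^ k) * (vderiv ^^ k) L 0 = inverse (\<i> ^ k) * ((-1) ^ k * cnj ((vderiv ^^ k) L 0))" by simp
    also have "\<dots> = cnj w"
    proof -
      have "inverse (\<i> ^ k) * (-1) ^ k = cnj (inverse (\<i> ^ k))"
        by (simp flip: power_inverse power_mult_distrib)
      then show ?thesis by (simp add: w_def mult.assoc[symmetric])
    qed
    finally have "w \<in> \<real>" by (simp add: w_def Reals_cnj_iff)
    then have "of_real (cumulant M k) = w"
      by (simp add: cumulant_def w_def L_def[abs_def] complex_is_Real_iff complex_eq_iff)
    then show ?thesis by (simp add: w_def)
  qed
  show "cumulant M 0 = 0" using Lk[of 0] by (simp add: L_def char_zero)
  have mom1: "char_deriv M 1 0 = 0" and mom2: "char_deriv M 2 0 = -1"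
    using char_deriv_at_0[of 1] char_deriv_at_0[of 2] integrable_power_le(2)[OF int, of 1] integrable_power_le(2)[OF int, of 2] m
    by (auto simp: mean var)
  have L1: "vderiv L t = char_deriv M 1 t * inverse (?f t)" if "t \<in> S" for t
    using Lderiv[OF that] by (rule vector_derivative_at)
  show "cumulant M 1 = 0" using Lk[of 1] m L1[OF S0] mom1 by simp
  have "(vderiv ^^ 2) L 0 = -1"
  proof -
    have "vderiv (vderiv L) 0 = vderiv (\<lambda>t. char_deriv M 1 t * inverse (?f t)) 0"
      using vderiv_cong[OF S L1 S0, where k = 1] by simp
    also have "\<dots> = char_deriv M 1 0 * (vderiv (\<lambda>t. inverse (?f t)) 0) + char_deriv M 2 0 * inverse (?f 0)"
    proof (rule vector_derivative_at, rule has_vector_derivative_mult)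
      show "(char_deriv M 1 has_vector_derivative char_deriv M 2 0) (at 0)"
        using has_vector_derivative_char_deriv[OF int, of 1 0] m by (simp add: numeral_2_eq_2)
      have "times_diff_on 1 S (\<lambda>t. inverse (?f t))"
        using times_diff_on_inverse[OF _ f0, of 1] times_diff_on_char_deriv[OF int, of 1 0 S] m by (simp add: char_deriv_0)
      from times_diff_on_vderiv[OF S this, of 0 0] S0
      show "((\<lambda>t. inverse (?f t)) has_vector_derivative vderiv (\<lambda>t. inverse (?f t)) 0) (at 0)" by simp
    qed
    finally show ?thesis using mom1 mom2 by (simp add: char_zero numeral_2_eq_2)
  qed
  then show "cumulant M 2 = 1" using Lk[of 2] m by (simp add: complex_eq_iff)
  let ?P = "cumulant_poly M m"
  have LP: "(\<lambda>u. L u - ?P (of_real u)) \<in> o[at 0](\<lambda>u. of_real u ^ m)"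
  proof -
    have "(\<lambda>u. L u - (\<Sum>k\<le>m. (vderiv ^^ k) L 0 / fact k * of_real u ^ k)) \<in> o[at 0](\<lambda>u. of_real u ^ m)"
      unfolding m' by (rule Peano_taylor[OF S S0]) (use L_diff m' in simp)
    moreover have "(\<Sum>k\<le>m. (vderiv ^^ k) L 0 / fact k * complex_of_real u ^ k) = ?P (of_real u)" for u
      unfolding cumulant_poly_def
      by (intro sum.cong refl) (auto simp: Lk power_mult_distrib)
    ultimately show ?thesis by simp
  qed
  have fE: "(\<lambda>u. exp (?P (of_real u)) - ?f u) \<in> o[at 0](\<lambda>u. of_real u ^ m)"
  proof (rule landau_o.smallI)
    fix c :: real assume c: "c > 0"
    \<comment> \<open>The 3 is the constant of \<open>norm_exp_minus_one_le\<close>, and c' <= 1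
      ensures its hypothesis |w| <= 1.\<close>
    define c' where "c' = min (c / 3) 1"
    have c': "c' > 0" "3 * c' \<le> c" "c' \<le> 1" using c by (auto simp: c'_def)
    have "\<forall>\<^sub>F u in at 0. u \<in> S" using S S0 by (auto simp: eventually_at_topological)
    moreover have "\<forall>\<^sub>F u::real in at 0. \<bar>u\<bar> \<le> 1"
      unfolding eventually_at by (intro exI[of _ 1]) (auto simp: dist_real_def)
    moreover note landau_o.smallD[OF LP c'(1)]
    ultimately show "\<forall>\<^sub>F u in at 0. cmod (exp (?P (of_real u)) - ?f u) \<le> c * cmod (of_real u ^ m)"
    proof eventually_elim
      case (elim u)
      define w where "w = ?P (of_real u) - L u"
      have w: "cmod w \<le> c' * \<bar>u\<bar> ^ m" using elim(3) by (simp add: w_def norm_minus_commute norm_power)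
      also have "\<dots> \<le> 1 * 1" using elim(2) c' by (intro mult_mono power_le_one) auto
      finally have w1: "cmod w \<le> 1" by simp
      have "exp (L u) = ?f u" unfolding L_def using f0[OF elim(1)] by simp
      then have "exp (?P (of_real u)) - ?f u = ?f u * (exp w - 1)"
        by (simp add: w_def exp_diff f0[OF elim(1)] field_simps)
      then have "cmod (exp (?P (of_real u)) - ?f u) \<le> 1 * cmod (exp w - 1)"
        unfolding norm_mult by (metis cmod_char_le_1 mult_right_mono norm_ge_zero norm_mult)
      also have "cmod (exp w - 1) \<le> 3 * cmod w" by (rule norm_exp_minus_one_le[OF w1])
      also have "1 * (3 * cmod w) \<le> 3 * (c' * \<bar>u\<bar> ^ m)" using w by simp
      also have "\<dots> \<le> c * \<bar>u\<bar> ^ m" using c'(2) mult_right_mono[of "3 * c'" c "\<bar>u\<bar> ^ m"] by simp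
      finally show ?case by (simp add: norm_power)
    qed
  qed
  have "(\<lambda>u. (exp (?P (of_real u)) - ?f u) + (?f u - moment_poly M m (of_real u))) \<in> o[at 0](\<lambda>u. of_real u ^ m)"
    by (intro sum_in_smallo fE char_taylor int) (use m in auto)
  then have *: "(\<lambda>u. (\<lambda>z. exp (?P z) - moment_poly M m z) (of_real u)) \<in> o[at 0](\<lambda>u. of_real u ^ m)" by simp
  show "\<exists>K. K holomorphic_on UNIV \<and> (\<forall>z. exp (?P z) - moment_poly M m z = z ^ Suc m * K z)"
    by (rule holomorphic_factor_power[OF _ *]) (auto simp: cumulant_poly_def moment_poly_def intro!: holomorphic_intros)
qed

section \<open>The Edgeworth series\<close>

definition solutions :: "nat \<Rightarrow> nat \<Rightarrow> (nat \<Rightarrow> nat) set" where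
  "solutions K j = {p \<in> {1..K} \<rightarrow>\<^sub>E UNIV. (\<Sum>i=1..K. i * p i) = j}"

text \<open>The coefficient of e^j in the power series of exp(a_1 e + ... + a_K e^K). The number K
  of variables is kept apart from the degree j, since the proof of this fact is an induction on
  K.\<close>

definition exp_coeff :: "nat \<Rightarrow> (nat \<Rightarrow> 'a::real_normed_field) \<Rightarrow> nat \<Rightarrow> 'a" where
  "exp_coeff K a j = (\<Sum>p\<in>solutions K j. \<Prod>i=1..K. a i ^ p i / fact (p i))"

lemma finite_solutions: "finite (solutions K j)"
proof (rule finite_subset)
  show "solutions K j \<subseteq> {1..K} \<rightarrow>\<^sub>E {..j}"
  proof
    fix p assume p: "p \<in> solutions K j"
    have "p i \<le> j" if i: "i \<in> {1..K}" for i
    proof -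
      have "p i \<le> i * p i" using i by simp
      also have "\<dots> \<le> (\<Sum>i=1..K. i * p i)"
        using i by (intro member_le_sum) auto
      finally show ?thesis using p by (simp add: solutions_def)
    qed
    then show "p \<in> {1..K} \<rightarrow>\<^sub>E {..j}"
      using p by (auto simp: solutions_def PiE_iff)
  qed
qed (simp add: finite_PiE)

lemma exp_coeff_0: "exp_coeff 0 a j = (if j = 0 then 1 else 0)"
  by (auto simp: exp_coeff_def solutions_def)

text \<open>The sum is split by the multiplicity q of the largest part K + 1.\<close>

lemma exp_coeff_Suc:
  "exp_coeff (Suc K) a j =
     (\<Sum>q | q * Suc K \<le> j. a (Suc K) ^ q / fact q * exp_coeff K a (j - q * Suc K))"
proof -
  have fin: "finite {q. q * Suc K \<le> j}"
    by (rule finite_subset[of _ "{..j}"]) (auto intro: order_trans[rotated])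
  have "(\<Sum>q | q * Suc K \<le> j. a (Suc K) ^ q / fact q * exp_coeff K a (j - q * Suc K)) =
    (\<Sum>(q, p)\<in>(SIGMA q:{q. q * Suc K \<le> j}. solutions K (j - q * Suc K)).
        a (Suc K) ^ q / fact q * (\<Prod>i=1..K. a i ^ p i / fact (p i)))"
    unfolding exp_coeff_def sum_distrib_left
    by (rule sum.Sigma) (use fin finite_solutions in auto)
  also have "\<dots> = exp_coeff (Suc K) a j"
    unfolding exp_coeff_def
  \<comment> \<open>Resetting the entry at K + 1 to \<open>undefined\<close> makes the function
    extensional on {1..K} again.\<close>
  proof (rule sum.reindex_bij_witness[where
        i = "\<lambda>p. (p (Suc K), p(Suc K := undefined))" and j = "\<lambda>(q, p). p(Suc K := q)"])
    fix x assume x: "x \<in> (SIGMA q:{q. q * Suc K \<le> j}. solutions K (j - q * Suc K))"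
    obtain q p where qp: "x = (q, p)" by (cases x)
    have p: "p \<in> {1..K} \<rightarrow>\<^sub>E UNIV" and q: "q * Suc K \<le> j" and s: "(\<Sum>i=1..K. i * p i) = j - q * Suc K"
      using x by (auto simp: qp solutions_def)
    have pu: "p (Suc K) = undefined" using p by (auto simp: PiE_def extensional_def)
    show "((case x of (q, p) \<Rightarrow> p(Suc K := q)) (Suc K), (case x of (q, p) \<Rightarrow> p(Suc K := q))(Suc K := undefined)) = x"
      using pu by (auto simp: qp)
    have "(\<Sum>i=1..Suc K. i * (p(Suc K := q)) i) = j" using q s by simp
    moreover have "p(Suc K := q) \<in> {1..Suc K} \<rightarrow>\<^sub>E UNIV"
      using p by (auto simp: PiE_def extensional_def)
    ultimately show "(case x of (q, p) \<Rightarrow> p(Suc K := q)) \<in> solutions (Suc K) j"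
      by (simp add: qp solutions_def)
    have "(\<Prod>i=1..Suc K. a i ^ (p(Suc K := q)) i / fact ((p(Suc K := q)) i)) =
      (\<Prod>i=1..K. a i ^ (p(Suc K := q)) i / fact ((p(Suc K := q)) i)) * (a (Suc K) ^ q / fact q)"
      by simp
    also have "(\<Prod>i=1..K. a i ^ (p(Suc K := q)) i / fact ((p(Suc K := q)) i)) = (\<Prod>i=1..K. a i ^ p i / fact (p i))"
      by (intro prod.cong) auto
    finally show "(\<Prod>i=1..Suc K. a i ^ (case x of (q, p) \<Rightarrow> p(Suc K := q)) i / fact ((case x of (q, p) \<Rightarrow> p(Suc K := q)) i)) =
       (case x of (q, p) \<Rightarrow> a (Suc K) ^ q / fact q * (\<Prod>i=1..K. a i ^ p i / fact (p i)))"
      by (simp add: qp mult.commute)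
  next
    fix p assume p: "p \<in> solutions (Suc K) j"
    show "(case (p (Suc K), p(Suc K := undefined)) of (q, p) \<Rightarrow> p(Suc K := q)) = p" by simp
    have s: "(\<Sum>i=1..K. i * p i) + Suc K * p (Suc K) = j" using p by (simp add: solutions_def)
    have "(\<Sum>i=1..K. i * (p(Suc K := undefined)) i) = (\<Sum>i=1..K. i * p i)"
      by (intro sum.cong) auto
    then have "p(Suc K := undefined) \<in> solutions K (j - p (Suc K) * Suc K)"
      using p s by (auto simp: solutions_def PiE_def extensional_def mult.commute)
    moreover have "p (Suc K) * Suc K \<le> j" using s by (simp add: mult.commute)
    ultimately show "(p (Suc K), p(Suc K := undefined)) \<in> (SIGMA q:{q. q * Suc K \<le> j}. solutions K (j - q * Suc K))"
      by simp
  qed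
  finally show ?thesis ..
qed

text \<open>A part larger than k cannot occur in a partition of k. This links the fixed number m - 2
  of variables in \<open>edgeworth_char\<close> to the number k in
  \<open>edgeworth_term\<close>.\<close>

lemma exp_coeff_eq:
  assumes "k \<le> K"
  shows "exp_coeff K a k = exp_coeff k a k"
  using assms
proof (induction K rule: dec_induct)
  case (step K)
  have "{q. q * Suc K \<le> k} = {0}"
  proof -
    have "q = 0" if "q * Suc K \<le> k" for q
      using that step(1) by (cases q) auto
    then show ?thesis by auto
  qed
  then show ?case using step by (simp add: exp_coeff_Suc)
qed simp

lemma exp_coeff_scale:
  "exp_coeff K (\<lambda>i. a i * e ^ i) j = exp_coeff K a j * e ^ j"
  unfolding exp_coeff_def sum_distrib_right
proof (rule sum.cong[OF refl])
  fix p assume "p \<in> solutions K j"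
  then have j: "(\<Sum>i=1..K. i * p i) = j" by (simp add: solutions_def)
  have "e ^ j = (\<Prod>i=1..K. e ^ (i * p i))" unfolding j[symmetric] by (rule power_sum)
  then show "(\<Prod>i=1..K. (a i * e ^ i) ^ p i / fact (p i)) = (\<Prod>i=1..K. a i ^ p i / fact (p i)) * e ^ j"
    by (simp add: prod.distrib[symmetric] power_mult_distrib power_mult)
qed

lemma norm_exp_coeff_le: "norm (exp_coeff K a j) \<le> exp_coeff K (\<lambda>i. norm (a i)) j"
  unfolding exp_coeff_def
  by (rule order_trans[OF norm_sum]) (simp add: prod_norm[symmetric] norm_divide norm_power)

lemma exp_coeff_nonneg: "(\<And>i. 0 \<le> a i) \<Longrightarrow> 0 \<le> (exp_coeff K a j :: real)"
  unfolding exp_coeff_def by (intro sum_nonneg prod_nonneg ballI divide_nonneg_pos) auto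

text \<open>Induction on K: the new exponential factor contributes a series supported on the
  multiples of K + 1, and the two absolutely convergent series are multiplied by Cauchy's rule.
  Powers of e enter later by \<open>exp_coeff_scale\<close>.\<close>

lemma exp_coeff_sums:
  fixes a :: "nat \<Rightarrow> 'a::{real_normed_field,banach}"
  shows "exp_coeff K a sums exp (\<Sum>i=1..K. a i) \<and> summable (\<lambda>j. norm (exp_coeff K a j))"
proof (induction K)
  case 0
  have "(\<lambda>j::nat. if j = 0 then 1 else 0 :: 'a) sums 1" using sums_single[of 0 "\<lambda>_. 1::'a"] by simp
  moreover have "summable (\<lambda>j::nat. norm (if j = 0 then 1 else 0 :: 'a))"
    by (rule summable_finite[of "{0}"]) auto
  ultimately show ?case by (simp add: exp_coeff_0[abs_def])
next
  case (Suc K)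
  \<comment> \<open>The exponential series of a_(K+1), its q-th term moved to the index q (K + 1)
    and zeros put in between.\<close>
  define b where "b i = (if Suc K dvd i then a (Suc K) ^ (i div Suc K) / fact (i div Suc K) else 0)" for i
  have mono: "strict_mono (\<lambda>q. q * Suc K)" by (rule strict_monoI) (simp del: mult_Suc_right)
  have ran: "b i = 0" if "i \<notin> range (\<lambda>q. q * Suc K)" for i
    using that by (metis b_def dvd_def mult.commute rangeI)
  have b_q: "b (q * Suc K) = a (Suc K) ^ q / fact q" for q
    unfolding b_def by (simp del: mult_Suc_right)
  have exp_b: "(\<lambda>q. a (Suc K) ^ q / fact q) sums exp (a (Suc K))"
    using exp_converges[of "a (Suc K)"] by (simp add: scaleR_conv_of_real divide_inverse mult.commute)
  have b_sums: "b sums exp (a (Suc K))"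
    using exp_b unfolding b_q[symmetric] by (subst (asm) sums_mono_reindex[OF mono ran])
  have "summable (\<lambda>q. norm (b (q * Suc K)))"
    using summable_norm_exp[of "a (Suc K)"] unfolding b_q by (simp add: norm_divide norm_power scaleR_conv_of_real divide_inverse norm_mult mult.commute norm_inverse)
  then have b_norm: "summable (\<lambda>i. norm (b i))"
    using summable_mono_reindex[OF mono, of "\<lambda>i. norm (b i)"] ran by simp
  have conv: "exp_coeff (Suc K) a j = (\<Sum>i\<le>j. b i * exp_coeff K a (j - i))" for j
  proof -
    have "(\<Sum>i\<le>j. b i * exp_coeff K a (j - i)) = (\<Sum>i\<in>(\<lambda>q. q * Suc K) ` {q. q * Suc K \<le> j}. b i * exp_coeff K a (j - i))"
    proof (rule sum.mono_neutral_right)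
      show "\<forall>i\<in>{..j} - (\<lambda>q. q * Suc K) ` {q. q * Suc K \<le> j}. b i * exp_coeff K a (j - i) = 0"
        using ran by (force simp: image_iff)
    qed auto
    also have "\<dots> = (\<Sum>q | q * Suc K \<le> j. b (q * Suc K) * exp_coeff K a (j - q * Suc K))"
      by (rule sum.reindex_cong[of "\<lambda>q. q * Suc K"]) (auto simp: inj_on_def simp del: mult_Suc_right)
    finally show ?thesis by (simp only: b_q exp_coeff_Suc)
  qed
  have "(\<lambda>j. \<Sum>i\<le>j. b i * exp_coeff K a (j - i)) sums ((\<Sum>j. b j) * (\<Sum>j. exp_coeff K a j))"
    by (rule Cauchy_product_sums[OF b_norm]) (use Suc in simp)
  also have "(\<Sum>j. b j) * (\<Sum>j. exp_coeff K a j) = exp (\<Sum>i=1..Suc K. a i)"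
    using b_sums Suc by (simp add: sums_iff exp_add mult.commute)
  finally have 1: "exp_coeff (Suc K) a sums exp (\<Sum>i=1..Suc K. a i)" by (simp only: conv[abs_def, symmetric])
  have "summable (\<lambda>j. \<Sum>i\<le>j. norm (b i) * norm (exp_coeff K a (j - i)))"
    by (rule summable_Cauchy_product) (use b_norm Suc in auto)
  then have "summable (\<lambda>j. norm (exp_coeff (Suc K) a j))"
    by (rule summable_comparison_test'[of _ 0])
      (auto simp: conv intro!: sum_norm_le simp: norm_mult)
  with 1 show ?case by simp
qed

text \<open>The tail is compared with the majorant series, formed from the absolute values, at the
  larger point e0: from degree N on, every power of e is at most (e / e0)^N times the same power of
  e0.\<close>

lemma exp_coeff_remainder:
  fixes a :: "nat \<Rightarrow> complex"
  assumes e: "0 \<le> e" "e \<le> e0" "0 < e0"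
  shows "cmod (exp (\<Sum>i=1..K. a i * of_real e ^ i) - (\<Sum>j<N. exp_coeff K a j * of_real e ^ j))
     \<le> (e / e0) ^ N * exp (\<Sum>i=1..K. cmod (a i) * e0 ^ i)"
proof -
  let ?c = "\<lambda>j. exp_coeff K a j * of_real e ^ j"
  let ?r = "\<lambda>j. exp_coeff K (\<lambda>i. cmod (a i)) j"
  have r0: "0 \<le> ?r j" for j by (rule exp_coeff_nonneg) simp
  have s: "?c sums exp (\<Sum>i=1..K. a i * of_real e ^ i)" "summable (\<lambda>j. cmod (?c j))"
    using exp_coeff_sums[of K "\<lambda>i. a i * of_real e ^ i"] unfolding exp_coeff_scale[abs_def] by auto
  have t: "(\<lambda>j. ?r j * e0 ^ j) sums exp (\<Sum>i=1..K. cmod (a i) * e0 ^ i)"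
    using exp_coeff_sums[of K "\<lambda>i. cmod (a i) * e0 ^ i"] unfolding exp_coeff_scale[abs_def] by auto
  have "exp (\<Sum>i=1..K. a i * of_real e ^ i) - (\<Sum>j<N. ?c j) = (\<Sum>j. ?c (j + N))"
    using suminf_minus_initial_segment[OF sums_summable[OF s(1)], of N] s(1) by (simp add: sums_iff)
  also have "cmod \<dots> \<le> (\<Sum>j. cmod (?c (j + N)))"
    by (rule summable_norm) (use summable_ignore_initial_segment[OF s(2)] in simp)
  also have "\<dots> \<le> (\<Sum>j. (e / e0) ^ N * (?r (j + N) * e0 ^ (j + N)))"
  proof (rule suminf_le)
    fix j
    have "cmod (?c (j + N)) \<le> ?r (j + N) * e ^ (j + N)"
      using e norm_exp_coeff_le[of K a "j + N"] by (simp add: norm_mult norm_power mult_right_mono)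
    also have "\<dots> \<le> ?r (j + N) * ((e / e0) ^ N * e0 ^ (j + N))"
    proof (rule mult_left_mono[OF _ r0])
      have "e ^ (j + N) \<le> e0 ^ j * e ^ N"
        unfolding power_add using e by (intro mult_right_mono power_mono) auto
      also have "\<dots> = (e / e0) ^ N * e0 ^ (j + N)" using e by (simp add: power_divide power_add)
      finally show "e ^ (j + N) \<le> (e / e0) ^ N * e0 ^ (j + N)" .
    qed
    finally show "cmod (?c (j + N)) \<le> (e / e0) ^ N * (?r (j + N) * e0 ^ (j + N))"
      by (simp only: mult.left_commute)
  next
    show "summable (\<lambda>j. cmod (?c (j + N)))" by (rule summable_ignore_initial_segment[OF s(2)])
    show "summable (\<lambda>j. (e / e0) ^ N * (?r (j + N) * e0 ^ (j + N)))"
      by (intro summable_mult summable_ignore_initial_segment[OF sums_summable[OF t]])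
  qed
  also have "\<dots> = (e / e0) ^ N * (\<Sum>j. ?r (j + N) * e0 ^ (j + N))"
    by (intro suminf_mult summable_ignore_initial_segment[OF sums_summable[OF t]])
  also have "(\<Sum>j. ?r (j + N) * e0 ^ (j + N)) \<le> (\<Sum>j. ?r j * e0 ^ j)"
    using suminf_minus_initial_segment[OF sums_summable[OF t], of N] r0 e
    by (simp add: sum_nonneg)
  finally show ?thesis using t e by (simp add: sums_iff mult_left_mono)
qed

text \<open>The coefficient of n^(-i/2) in n times the cumulant polynomial at z / sqrt n; for unit
  variance the index 0 gives -z^2/2.\<close>

definition edgeworth_coeff :: "real measure \<Rightarrow> complex \<Rightarrow> nat \<Rightarrow> complex" where
  "edgeworth_coeff M z i = of_real (cumulant M (i + 2)) * (\<i> * z) ^ (i + 2) / fact (i + 2)"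

text \<open>The argument e stands for 1 / sqrt n, and z is complex so that Cauchy's inequality
  applies.\<close>

definition edgeworth_char :: "real measure \<Rightarrow> nat \<Rightarrow> real \<Rightarrow> complex \<Rightarrow> complex" where
  "edgeworth_char M K e z = exp (- z\<^sup>2 / 2) * (\<Sum>j\<le>K. exp_coeff K (edgeworth_coeff M z) j * of_real e ^ j)"

text \<open>A solution p contributes the power of it with exponent sum (i + 2) p_i = k + 2 sum p_i,
  which is the index of the Hermite polynomial in \<open>edgeworth_term\<close>.\<close>

lemma exp_coeff_edgeworth:
  "exp_coeff k (edgeworth_coeff M (of_real t)) k * of_real (exp (- t\<^sup>2 / 2)) =
     (\<Sum>p\<in>weighted_partitions k. of_real ((1 / (\<Prod>i=1..k. fact (p i)))
        * (\<Prod>i=1..k. (cumulant M (i + 2) / fact (i + 2)) ^ p i)) * gauss_moment (k + 2 * (\<Sum>i=1..k. p i)) t)"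
proof -
  have "solutions k k = weighted_partitions k" by (simp add: solutions_def weighted_partitions_def)
  then show ?thesis
    unfolding exp_coeff_def sum_distrib_right
  proof (rule sum.cong)
    fix p assume "p \<in> weighted_partitions k"
    then have p: "(\<Sum>i=1..k. i * p i) = k" by (simp add: weighted_partitions_def)
    have "(\<Sum>i=1..k. (i + 2) * p i) = (\<Sum>i=1..k. i * p i) + 2 * (\<Sum>i=1..k. p i)"
      by (simp only: sum_distrib_left sum.distrib[symmetric] add_mult_distrib)
    then have "(\<Prod>i=1..k. (\<i> * complex_of_real t) ^ ((i + 2) * p i)) = (\<i> * of_real t) ^ (k + 2 * (\<Sum>i=1..k. p i))"
      by (simp only: power_sum[symmetric] p)
    moreover have "(\<Prod>i=1..k. edgeworth_coeff M (of_real t) i ^ p i / fact (p i)) =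
       (\<Prod>i=1..k. (\<i> * complex_of_real t) ^ ((i + 2) * p i)) *
       of_real ((1 / (\<Prod>i=1..k. fact (p i))) * (\<Prod>i=1..k. (cumulant M (i + 2) / fact (i + 2)) ^ p i))"
    proof -
      have "edgeworth_coeff M (of_real t) i ^ p i / fact (p i) =
        (\<i> * complex_of_real t) ^ ((i + 2) * p i) * of_real (1 / fact (p i) * (cumulant M (i + 2) / fact (i + 2)) ^ p i)" for i
      proof -
        have "(c * W / F) ^ q / G = W ^ q * (1 / G * (c / F) ^ q)" for c W F G :: complex and q
          by (simp add: power_mult_distrib power_divide mult.commute)
        then show ?thesis
          unfolding edgeworth_coeff_def power_mult of_real_mult of_real_divide of_real_power of_real_fact of_real_1 .
      qed
      moreover have "(1 / (\<Prod>i=1..k. fact (p i))) = (\<Prod>i=1..k. 1 / fact (p i) :: real)"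
        by (simp add: prod_dividef)
      ultimately show ?thesis by (simp only: prod.distrib of_real_mult of_real_prod)
    qed
    ultimately show "(\<Prod>i=1..k. edgeworth_coeff M (of_real t) i ^ p i / fact (p i)) * of_real (exp (- t\<^sup>2 / 2)) =
      of_real ((1 / (\<Prod>i=1..k. fact (p i))) * (\<Prod>i=1..k. (cumulant M (i + 2) / fact (i + 2)) ^ p i)) *
        gauss_moment (k + 2 * (\<Sum>i=1..k. p i)) t"
      by (simp only: gauss_moment_def mult_ac)
  qed
qed

lemma
  shows integrable_edgeworth_char: "integrable lborel (\<lambda>t. edgeworth_char M (m - 2) (1 / sqrt (real n)) (of_real t))"
    and inverse_fourier_edgeworth_char: "0 < n \<Longrightarrow>
      inverse_fourier (\<lambda>t. edgeworth_char M (m - 2) (1 / sqrt (real n)) (of_real t)) x = of_real (edgeworth_density M m n x)"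
proof -
  define K where "K = m - 2"
  define e where "e = 1 / sqrt (real n)"
  define C where "C k p = (1 / (\<Prod>i=1..k. fact (p i))) * (\<Prod>i=1..k. (cumulant M (i + 2) / fact (i + 2)) ^ p i)" for k p
  define r where "r k p = k + 2 * (\<Sum>i=1..k. p i)" for k and p :: "nat \<Rightarrow> nat"
  have eq: "(\<lambda>t. edgeworth_char M K e (of_real t)) =
    (\<lambda>t. \<Sum>k\<le>K. \<Sum>p\<in>weighted_partitions k. of_real (C k p * e ^ k) * gauss_moment (r k p) t)"
  proof
    fix t
    have ex: "exp (- (complex_of_real t)\<^sup>2 / 2) = of_real (exp (- t\<^sup>2 / 2))"
      using exp_of_real[of "- t\<^sup>2 / 2", where 'a = complex] by simp
    have "edgeworth_char M K e (of_real t) =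
      (\<Sum>k\<le>K. exp_coeff K (edgeworth_coeff M (of_real t)) k * of_real (exp (- t\<^sup>2 / 2)) * of_real e ^ k)"
      by (simp only: edgeworth_char_def sum_distrib_left ex mult_ac)
    also have "\<dots> = (\<Sum>k\<le>K. exp_coeff k (edgeworth_coeff M (of_real t)) k * of_real (exp (- t\<^sup>2 / 2)) * of_real e ^ k)"
    proof (rule sum.cong[OF refl])
      fix k assume "k \<in> {..K}"
      then have "exp_coeff K a k = exp_coeff k a k" for a :: "nat \<Rightarrow> complex" by (intro exp_coeff_eq) simp
      then show "exp_coeff K (edgeworth_coeff M (of_real t)) k * of_real (exp (- t\<^sup>2 / 2)) * of_real e ^ k =
        exp_coeff k (edgeworth_coeff M (of_real t)) k * of_real (exp (- t\<^sup>2 / 2)) * of_real e ^ k" by (rule arg_cong)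
    qed
    also have "\<dots> = (\<Sum>k\<le>K. \<Sum>p\<in>weighted_partitions k. of_real (C k p * e ^ k) * gauss_moment (r k p) t)"
      unfolding exp_coeff_edgeworth sum_distrib_right C_def[symmetric] r_def[symmetric]
      by (intro sum.cong refl) (simp add: mult_ac)
    finally show "edgeworth_char M K e (of_real t) = \<dots>" .
  qed
  show "integrable lborel (\<lambda>t. edgeworth_char M K e (of_real t))"
    unfolding eq by (intro Bochner_Integration.integrable_sum integrable_mult_right integrable_gauss_moment)
  assume "0 < n"
  have gi: "integrable lborel (\<lambda>t. iexp (- (t * x)) * gauss_moment r t)" for r
    by (rule integrable_iexp_mult[OF integrable_gauss_moment])
  have "inverse_fourier (\<lambda>t. edgeworth_char M K e (of_real t)) x =
    (\<integral>t. (\<Sum>k\<le>K. \<Sum>p\<in>weighted_partitions k. of_real (C k p * e ^ k) * (iexp (- (t * x)) * gauss_moment (r k p) t)) \<partial>lborel) / (2 * pi)"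
    unfolding inverse_fourier_def eq sum_distrib_left by (simp only: mult.left_commute)
  also have "\<dots> = (\<Sum>k\<le>K. \<Sum>p\<in>weighted_partitions k. complex_of_real (C k p * e ^ k) * complex_of_real (2 * pi * (hermite (r k p) x * std_normal_density x))) / complex_of_real (2 * pi)"
    by (simp only: Bochner_Integration.integral_sum Bochner_Integration.integrable_sum integrable_mult_right gi
        integral_mult_right_zero fourier_gauss_moment)
  also have "\<dots> = of_real (\<Sum>k\<le>K. edgeworth_term M k x * e ^ k)"
  proof -
    have "C k p * e ^ k * (2 * pi * (hermite (r k p) x * std_normal_density x)) =
      2 * pi * (std_normal_density x * (hermite (r k p) x * (1 / (\<Prod>i=1..k. fact (p i))) *
         (\<Prod>i=1..k. (cumulant M (i + 2) / fact (i + 2)) ^ p i)) * e ^ k)" for k p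
      unfolding C_def by (simp only: mult_ac)
    then have "(\<Sum>k\<le>K. \<Sum>p\<in>weighted_partitions k. C k p * e ^ k * (2 * pi * (hermite (r k p) x * std_normal_density x))) =
      2 * pi * (\<Sum>k\<le>K. edgeworth_term M k x * e ^ k)"
      unfolding edgeworth_term_def r_def by (simp only: sum_distrib_left sum_distrib_right)
    then have "of_real (\<Sum>k\<le>K. \<Sum>p\<in>weighted_partitions k. C k p * e ^ k * (2 * pi * (hermite (r k p) x * std_normal_density x))) =
      of_real (2 * pi) * complex_of_real (\<Sum>k\<le>K. edgeworth_term M k x * e ^ k)"
      by (simp only: of_real_mult)
    then show ?thesis by (simp only: of_real_mult[symmetric] of_real_sum[symmetric]) simp
  qed
  \<comment> \<open>The term k = 0 is the normal density, which \<open>edgeworth_density\<close>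
    writes separately.\<close>
  also have "(\<Sum>k\<le>K. edgeworth_term M k x * e ^ k) = edgeworth_term M 0 x + (\<Sum>k=1..K. edgeworth_term M k x * e ^ k)"
    by (simp add: atMost_atLeast0 sum.atLeast_Suc_atMost)
  also have "edgeworth_term M 0 x = std_normal_density x"
    by (simp add: edgeworth_term_def weighted_partitions_def hermite_def std_normal_density_def flip: exp_add)
  finally have "inverse_fourier (\<lambda>t. edgeworth_char M K e (of_real t)) x =
    of_real (std_normal_density x + (\<Sum>k=1..K. edgeworth_term M k x * e ^ k))" .
  moreover have "e ^ k = real n powr (- real k / 2)" for k
  proof -
    have "e = real n powr (- (1 / 2))" by (simp add: e_def powr_minus_divide powr_half_sqrt)
    then show ?thesis using \<open>0 < n\<close> by (simp add: powr_power)
  qed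
  ultimately show "inverse_fourier (\<lambda>t. edgeworth_char M K e (of_real t)) x = of_real (edgeworth_density M m n x)"
    by (simp add: edgeworth_density_def K_def)
qed

section \<open>Differences of the characteristic function\<close>

text \<open>Only order 0 enters undiscounted; since y^j <= y for j >= 1, each of the J higher orders
  contributes at most B y.\<close>

lemma gnorm_std_weight_le:
  assumes d: "0 < d" "d \<le> 1" and y: "0 < y" "y \<le> 1" and s: "0 \<le> s" and AB: "0 \<le> A" "0 \<le> B"
    and 0: "\<And>i. i \<le> J \<Longrightarrow> cmod (f (t + real i * d)) \<le> A"
    and 1: "\<And>i j. 1 \<le> j \<Longrightarrow> i + j \<le> J \<Longrightarrow>
      cmod ((fdiff d ^^ j) f (t + real i * d)) \<le> fact j * d powr min (real j) s * B"
  shows "gnorm (std_weight d s y) J d t f \<le> A + real J * (B * y)"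
proof -
  interpret diff_weight "std_weight d s y" J by (rule diff_weight_std_weight) fact+
  have "gnorm (std_weight d s y) J d t f \<le> (\<Sum>j\<le>J. if j = 0 then A else B * y)"
  proof (rule gnorm_le)
    fix i j assume ij: "i + j \<le> J"
    show "cmod ((fdiff d ^^ j) f (t + real i * d)) \<le> std_weight d s y j * (if j = 0 then A else B * y)"
    proof (cases "j = 0")
      case True
      then show ?thesis using 0[of i] ij d s by (simp add: std_weight_def)
    next
      case False
      have "y ^ j \<le> y ^ 1" using False y by (intro power_decreasing) auto
      then have "1 \<le> y / y ^ j" using y by simp
      then have "B * 1 \<le> B * (y / y ^ j)" using AB by (intro mult_left_mono) auto
      then have "fact j * d powr min (real j) s * B \<le> fact j * d powr min (real j) s * (B * (y / y ^ j))"
        by (intro mult_left_mono) auto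
      with 1[of j i] False ij show ?thesis by (simp add: std_weight_def mult_ac)
    qed
  qed
  also have "\<dots> = A + real J * (B * y)"
    by (subst sum.atMost_shift) (simp add: lessThan_Suc_eq_insert_0 sum.neutral)
  finally show ?thesis .
qed

text \<open>Cauchy's inequality on unit circles around points of [t, t + J], which contains the grid
  because d <= 1. The power d^j is weakened to the truncated exponent of the weight.\<close>

lemma gnorm_entire_le:
  assumes d: "0 < d" "d \<le> 1" and s: "0 \<le> s" and h: "h holomorphic_on UNIV"
    and B: "\<And>u z. t \<le> u \<Longrightarrow> u \<le> t + real J \<Longrightarrow> cmod (complex_of_real u - z) \<le> 1 \<Longrightarrow> cmod (h z) \<le> B"
  shows "gnorm (std_weight d s 1) J d t (\<lambda>t. h (of_real t)) \<le> (1 + real J) * B"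
proof -
  have "cmod (h (of_real t)) \<le> B" by (rule B[of t]) auto
  then have B0: "0 \<le> B" by (rule order_trans[OF norm_ge_zero])
  have dj: "real i * d \<le> real i" for i using d by (simp add: mult_left_le)
  have "gnorm (std_weight d s 1) J d t (\<lambda>t. h (of_real t)) \<le> B + real J * (B * 1)"
  proof (rule gnorm_std_weight_le)
    fix i assume "i \<le> J"
    then show "cmod (h (of_real (t + real i * d))) \<le> B"
      using d dj[of i] by (intro B[of "t + real i * d"]) auto
  next
    fix i j assume ij: "1 \<le> j" "i + j \<le> J"
    have "cmod ((fdiff d ^^ j) (\<lambda>t. h (of_real t)) (t + real i * d)) \<le> d ^ j * (fact j * B)"
    proof (rule fdiff_pow_holomorphic_bound[where c = "\<lambda>_. 0"])
      fix u z assume u: "t + real i * d \<le> u" "u \<le> t + real i * d + real j * d" and z: "cmod (complex_of_real u - z) = 1"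
      have "real i * d + real j * d \<le> real J" using dj[of "i + j"] ij by (simp add: algebra_simps)
      moreover have "0 \<le> real i * d" using d by simp
      ultimately show "cmod (h z - 0) \<le> B" using u z by (simp add: B[of u])
    qed (use h d ij in auto)
    also have "d ^ j * (fact j * B) \<le> fact j * d powr min (real j) s * B"
    proof -
      have "d ^ j = d powr real j" using d by (simp add: powr_realpow)
      also have "\<dots> \<le> d powr min (real j) s" using d by (intro powr_mono') auto
      finally show ?thesis using B0 by (simp add: mult_ac mult_left_mono)
    qed
    finally show "cmod ((fdiff d ^^ j) (\<lambda>t. h (of_real t)) (t + real i * d)) \<le> fact j * d powr min (real j) s * B" .
  qed (use d s B0 in auto)
  then show ?thesis by (simp add: algebra_simps)
qed

section \<open>Taylor remainders of the exponential\<close>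

definition iexp_rem :: "nat \<Rightarrow> real \<Rightarrow> complex" where
  "iexp_rem l y = iexp y - (\<Sum>k\<le>l. (\<i> * y) ^ k / fact k)"

lemma iexp_rem_0 [simp]: "iexp_rem l 0 = 0"
  unfolding iexp_rem_def by (subst sum.atMost_shift) simp

lemma iexp_rem_deriv:
  "((\<lambda>v. iexp_rem (Suc l) (v * x)) has_vector_derivative \<i> * x * iexp_rem l (v * x)) (at v)"
proof -
  have "((\<lambda>z. exp (\<i> * z * x) - (\<Sum>k\<le>Suc l. (\<i> * z * x) ^ k / fact k)) has_field_derivative
     \<i> * x * exp (\<i> * of_real v * x) - (\<Sum>k\<le>Suc l. of_nat k * (\<i> * of_real v * x) ^ (k - 1) * (\<i> * x) / fact k)) (at (of_real v))"
  proof (intro DERIV_diff DERIV_sum)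
    show "((\<lambda>z. exp (\<i> * z * x)) has_field_derivative \<i> * x * exp (\<i> * of_real v * x)) (at (of_real v))"
      by (auto intro!: derivative_eq_intros)
    fix k
    show "((\<lambda>z. (\<i> * z * x) ^ k / fact k) has_field_derivative of_nat k * (\<i> * of_real v * x) ^ (k - 1) * (\<i> * x) / fact k) (at (of_real v))"
      by (auto intro!: derivative_eq_intros)
  qed
  also have "(\<Sum>k\<le>Suc l. of_nat k * (\<i> * of_real v * x) ^ (k - 1) * (\<i> * x) / fact k) =
    (\<Sum>k\<le>l. \<i> * x * ((\<i> * of_real v * x) ^ k / fact k))"
    by (subst sum.atMost_Suc_shift) (simp add: field_simps del: of_nat_Suc)
  finally have "((\<lambda>v. exp (\<i> * complex_of_real v * x) - (\<Sum>k\<le>Suc l. (\<i> * complex_of_real v * x) ^ k / fact k)) has_vector_derivative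
     \<i> * x * exp (\<i> * of_real v * x) - (\<Sum>k\<le>l. \<i> * x * ((\<i> * of_real v * x) ^ k / fact k))) (at v)"
    by (rule has_vector_derivative_real_field)
  then show ?thesis
    by (simp add: iexp_rem_def mult.assoc right_diff_distrib sum_distrib_left)
qed

text \<open>Interpolation between the bounds of order l + 1 for small Y and order l for large Y. For
  r = s - m the factor with the minimum is the surplus decay that later makes \<open>eta\<close>
  small.\<close>

lemma iexp_rem_bound:
  assumes s: "0 \<le> r" "r \<le> 1" and y: "\<bar>y\<bar> \<le> Y" "0 < Y"
  shows "cmod (iexp_rem l y) \<le> 2 * Y powr (real l + r) * min 1 Y powr (1 - r)"
proof (cases "Y \<le> 1")
  case True
  have "cmod (iexp_rem l y) \<le> \<bar>y\<bar> ^ Suc l / fact (Suc l)"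
    unfolding iexp_rem_def by (rule iexp_approx1)
  also have "\<dots> \<le> \<bar>y\<bar> ^ Suc l / 1"
    by (intro divide_left_mono) (auto simp del: fact_Suc)
  also have "\<dots> \<le> Y ^ Suc l" using y by (simp add: power_mono del: power_Suc)
  also have "\<dots> = Y powr (real l + r) * min 1 Y powr (1 - r)"
    using y True by (simp add: min_def powr_add[symmetric] powr_realpow[symmetric] add.commute del: power_Suc)
  also have "\<dots> \<le> 2 * Y powr (real l + r) * min 1 Y powr (1 - r)" by simp
  finally show ?thesis .
next
  case False
  have "cmod (iexp_rem l y) \<le> 2 * \<bar>y\<bar> ^ l / fact l"
    unfolding iexp_rem_def by (rule iexp_approx2)
  also have "\<dots> \<le> 2 * \<bar>y\<bar> ^ l / 1" by (intro divide_left_mono) auto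
  also have "\<dots> \<le> 2 * Y ^ l" using y by (simp add: power_mono)
  also have "Y ^ l = Y powr real l" using y by (simp add: powr_realpow)
  also have "\<dots> \<le> Y powr (real l + r)" using False s by (intro powr_mono) auto
  finally show ?thesis using False by (simp add: min_def)
qed

text \<open>The j factors are bounded by 2 min(1, |y|); an exponent q is charged to |y|, and the
  rest keeps the minimum.\<close>

lemma norm_iexp_minus_one_power_le:
  assumes "0 \<le> q" "q \<le> real j" "1 \<le> j"
  shows "cmod (iexp y - 1) ^ j \<le> 2 ^ j * (\<bar>y\<bar> powr q * min 1 \<bar>y\<bar> powr (real j - q))"
proof (cases "y = 0")
  case True
  with assms show ?thesis by (simp add: power_0_left)
next
  case False
  then have y: "\<bar>y\<bar> > 0" by simp
  have "cmod (iexp y - 1) \<le> \<bar>y\<bar>" using iexp_approx1[of y 0] by simp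
  moreover have "cmod (iexp y - 1) \<le> 2" using iexp_approx2[of y 0] by simp
  ultimately have "cmod (iexp y - 1) \<le> 2 * min 1 \<bar>y\<bar>" by (auto simp: min_def)
  then have "cmod (iexp y - 1) ^ j \<le> (2 * min 1 \<bar>y\<bar>) ^ j" by (intro power_mono) auto
  also have "\<dots> = 2 ^ j * (min 1 \<bar>y\<bar> powr q * min 1 \<bar>y\<bar> powr (real j - q))"
    using y by (simp add: power_mult_distrib powr_add[symmetric] powr_realpow)
  also have "\<dots> \<le> 2 ^ j * (\<bar>y\<bar> powr q * min 1 \<bar>y\<bar> powr (real j - q))"
    using assms y by (intro mult_left_mono mult_right_mono powr_mono2) auto
  finally show ?thesis .
qed

lemma fdiff_pow_monomial: "k < j \<Longrightarrow> (fdiff d ^^ j) (\<lambda>u. of_real u ^ k) u = 0"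
proof (induction j arbitrary: k u)
  case (Suc j)
  have "fdiff d (\<lambda>u. of_real u ^ k) = (\<lambda>u. \<Sum>i<k. of_nat (k choose i) * of_real d ^ (k - i) * complex_of_real u ^ i)"
  proof
    fix u
    have "(complex_of_real u + of_real d) ^ k = (\<Sum>i\<le>k. of_nat (k choose i) * of_real u ^ i * of_real d ^ (k - i))"
      by (rule binomial_ring)
    also have "\<dots> = (\<Sum>i<k. of_nat (k choose i) * of_real u ^ i * of_real d ^ (k - i)) + of_real u ^ k"
      by (simp flip: lessThan_Suc_atMost)
    finally show "fdiff d (\<lambda>u. of_real u ^ k) u = (\<Sum>i<k. of_nat (k choose i) * of_real d ^ (k - i) * complex_of_real u ^ i)"
      by (simp add: fdiff_def mult_ac)
  qed
  then have "(fdiff d ^^ Suc j) (\<lambda>u. of_real u ^ k) u =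
    (\<Sum>i<k. of_nat (k choose i) * of_real d ^ (k - i) * (fdiff d ^^ j) (\<lambda>u. of_real u ^ i) u)"
    by (simp only: fdiff_pow_Suc2 fdiff_pow_sum fdiff_pow_cmult)
  also have "\<dots> = 0" using Suc by (intro sum.neutral) auto
  finally show ?case .
qed simp

section \<open>Standardized distributions with a finite moment of order s\<close>

locale std_moment_dist = real_distribution M for M +
  fixes s :: real and m :: nat
  assumes s2: "2 \<le> s" and m_def: "m = nat \<lfloor>s\<rfloor>"
    and int_s: "integrable M (\<lambda>x. \<bar>x\<bar> powr s)"
    and mean: "(\<integral>x. x \<partial>M) = 0" and var: "(\<integral>x. x\<^sup>2 \<partial>M) = 1"
begin

lemma m_bounds: "real m \<le> s" "s < real m + 1" "2 \<le> m"
proof -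
  have f2: "2 \<le> \<lfloor>s\<rfloor>" using s2 by (simp add: le_floor_iff)
  then have "real m = of_int \<lfloor>s\<rfloor>" by (simp add: m_def)
  then show "real m \<le> s" "s < real m + 1" by linarith+
  show "2 \<le> m" using f2 by (simp add: m_def nat_le_iff le_nat_iff)
qed

lemma powr_le_moment: "1 \<le> q \<Longrightarrow> q \<le> s \<Longrightarrow> \<bar>x\<bar> powr q \<le> 1 + \<bar>x\<bar> powr s" for x :: real
proof (cases "\<bar>x\<bar> \<le> 1")
  case True
  assume "1 \<le> q"
  with True have "\<bar>x\<bar> powr q \<le> 1 powr q" by (intro powr_mono2) auto
  then show ?thesis by (simp add: add_increasing2)
next
  case False
  assume "q \<le> s"
  with False have "\<bar>x\<bar> powr q \<le> \<bar>x\<bar> powr s" by (intro powr_mono) auto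
  then show ?thesis by simp
qed

text \<open>The summand 1 makes this a bound for the absolute moments of all orders between 1 and
  s.\<close>

definition mom :: real where "mom = 1 + (\<integral>x. \<bar>x\<bar> powr s \<partial>M)"

lemma mom_ge_1: "1 \<le> mom"
  unfolding mom_def by (simp add: integral_nonneg_AE)

lemma moment_powr:
  assumes "1 \<le> q" "q \<le> s"
  shows "integrable M (\<lambda>x. \<bar>x\<bar> powr q)" "(\<integral>x. \<bar>x\<bar> powr q \<partial>M) \<le> mom"
proof -
  have i: "integrable M (\<lambda>x. 1 + \<bar>x\<bar> powr s)"
    by (intro Bochner_Integration.integrable_add int_s) simp
  show *: "integrable M (\<lambda>x. \<bar>x\<bar> powr q)"
    by (rule Bochner_Integration.integrable_bound[OF i]) (auto simp: powr_le_moment assms)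
  have "(\<integral>x. \<bar>x\<bar> powr q \<partial>M) \<le> (\<integral>x. 1 + \<bar>x\<bar> powr s \<partial>M)"
    by (rule integral_mono[OF * i]) (simp add: powr_le_moment assms)
  also have "\<dots> = mom"
    unfolding mom_def using int_s by (simp add: prob_space[simplified])
  finally show "(\<integral>x. \<bar>x\<bar> powr q \<partial>M) \<le> mom" .
qed

lemma int_m: "integrable M (\<lambda>x. \<bar>x\<bar> ^ m)"
proof -
  have "integrable M (\<lambda>x. \<bar>x\<bar> powr real m)" using m_bounds by (intro moment_powr) auto
  moreover have "\<bar>x\<bar> powr real m = \<bar>x\<bar> ^ m" for x :: real
    using m_bounds by (cases "x = 0") (auto simp: powr_realpow)
  ultimately show ?thesis by simp
qed

lemma int_1: "integrable M (\<lambda>x. x)" and int_2: "integrable M (\<lambda>x. x\<^sup>2)"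
  using integrable_power_le(2)[OF int_m, of 1] integrable_power_le(2)[OF int_m, of 2] m_bounds by auto

text \<open>The source of all error terms \<open>o(n\<^bsup>-(s-2)/2\<^esup>)\<close>: \<open>eta U\<close> tends to \<open>0\<close> as \<open>U\<close> does.\<close>
definition eta :: "real \<Rightarrow> real" where
  "eta U = (\<integral>x. \<bar>x\<bar> powr s * min 1 (U * \<bar>x\<bar>) powr (real (Suc m) - s) \<partial>M)"

lemma eta_integrable: "0 \<le> U \<Longrightarrow> integrable M (\<lambda>x. \<bar>x\<bar> powr s * min 1 (U * \<bar>x\<bar>) powr (real (Suc m) - s))"
proof (rule Bochner_Integration.integrable_bound[OF int_s])
  assume "0 \<le> U"
  then have "min 1 (U * \<bar>x\<bar>) powr (real (Suc m) - s) \<le> 1 powr (real (Suc m) - s)" for x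
    using m_bounds by (intro powr_mono2) auto
  then show "AE x in M. norm (\<bar>x\<bar> powr s * min 1 (U * \<bar>x\<bar>) powr (real (Suc m) - s)) \<le> norm (\<bar>x\<bar> powr s)"
    by (intro AE_I2) (simp add: mult_left_le)
qed simp

lemma eta_nonneg: "0 \<le> eta U"
  unfolding eta_def by (rule integral_nonneg_AE) simp

lemma eta_le_mom: "0 \<le> U \<Longrightarrow> eta U \<le> mom"
proof -
  assume U: "0 \<le> U"
  have "min 1 (U * \<bar>x\<bar>) powr (real (Suc m) - s) \<le> 1 powr (real (Suc m) - s)" for x
    using m_bounds U by (intro powr_mono2) auto
  then have "eta U \<le> (\<integral>x. \<bar>x\<bar> powr s \<partial>M)"
    unfolding eta_def by (intro integral_mono eta_integrable int_s U) (simp add: mult_left_le)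
  also have "\<dots> \<le> mom" by (rule moment_powr) (use s2 in auto)
  finally show ?thesis .
qed

text \<open>Dominated convergence with majorant |x|^s; the exponent m + 1 - s of the minimum is
  positive because m is the integer part of s.\<close>

lemma eta_tendsto_0:
  assumes U: "U \<longlonglongrightarrow> 0" "\<And>n. 0 \<le> U n"
  shows "(\<lambda>n. eta (U n)) \<longlonglongrightarrow> 0"
proof -
  have "(\<lambda>n. eta (U n)) \<longlonglongrightarrow> (\<integral>x. 0 \<partial>M)"
    unfolding eta_def
  proof (rule integral_dominated_convergence[where w = "\<lambda>x. \<bar>x\<bar> powr s"])
    show "AE x in M. (\<lambda>n. \<bar>x\<bar> powr s * min 1 (U n * \<bar>x\<bar>) powr (real (Suc m) - s)) \<longlonglongrightarrow> 0"
    proof (rule AE_I2)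
      fix x :: real
      have "(\<lambda>n. min 1 (U n * \<bar>x\<bar>)) \<longlonglongrightarrow> min 1 (0 * \<bar>x\<bar>)"
        by (intro tendsto_intros U)
      then have "(\<lambda>n. min 1 (U n * \<bar>x\<bar>) powr (real (Suc m) - s)) \<longlonglongrightarrow> 0 powr (real (Suc m) - s)"
        using m_bounds U(2) by (intro tendsto_powr' tendsto_const) (auto intro!: always_eventually)
      from tendsto_mult[OF tendsto_const[of "\<bar>x\<bar> powr s"] this]
      show "(\<lambda>n. \<bar>x\<bar> powr s * min 1 (U n * \<bar>x\<bar>) powr (real (Suc m) - s)) \<longlonglongrightarrow> 0" by simp
    qed
    show "AE x in M. norm (\<bar>x\<bar> powr s * min 1 (U n * \<bar>x\<bar>) powr (real (Suc m) - s)) \<le> \<bar>x\<bar> powr s" for n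
    proof (rule AE_I2)
      fix x
      have "min 1 (U n * \<bar>x\<bar>) powr (real (Suc m) - s) \<le> 1 powr (real (Suc m) - s)"
        using m_bounds U(2) by (intro powr_mono2) auto
      then show "norm (\<bar>x\<bar> powr s * min 1 (U n * \<bar>x\<bar>) powr (real (Suc m) - s)) \<le> \<bar>x\<bar> powr s"
        by (simp add: mult_left_le)
    qed
  qed (use int_s in auto)
  then show ?thesis by simp
qed

lemma char_minus_moment_poly: "char M u - moment_poly M m (of_real u) = (\<integral>x. iexp_rem m (u * x) \<partial>M)"
  and iexp_rem_integrable: "integrable M (\<lambda>x. iexp_rem m (u * x))"
proof -
  have i1: "integrable M (\<lambda>x. iexp (u * x))" by (rule integrable_const_bound[of _ 1]) auto
  have i2: "integrable M (\<lambda>x. (\<i> * of_real u) ^ k / fact k * of_real (x ^ k))" if "k \<le> m" for k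
    by (intro integrable_mult_right integrable_of_real integrable_power_le(2)[OF int_m that])
  have eq: "iexp_rem m (u * x) = iexp (u * x) - (\<Sum>k\<le>m. (\<i> * of_real u) ^ k / fact k * of_real (x ^ k))" for x
    by (simp add: iexp_rem_def power_mult_distrib mult_ac)
  show "integrable M (\<lambda>x. iexp_rem m (u * x))"
    unfolding eq by (intro Bochner_Integration.integrable_diff i1 Bochner_Integration.integrable_sum i2) auto
  have "(\<integral>x. iexp_rem m (u * x) \<partial>M) = (\<integral>x. iexp (u * x) \<partial>M) - (\<integral>x. (\<Sum>k\<le>m. (\<i> * of_real u) ^ k / fact k * of_real (x ^ k)) \<partial>M)"
    unfolding eq by (intro Bochner_Integration.integral_diff i1 Bochner_Integration.integrable_sum i2) auto
  also have "(\<integral>x. (\<Sum>k\<le>m. (\<i> * of_real u) ^ k / fact k * of_real (x ^ k)) \<partial>M) =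
    (\<Sum>k\<le>m. \<integral>x. (\<i> * of_real u) ^ k / fact k * of_real (x ^ k) \<partial>M)"
    by (intro Bochner_Integration.integral_sum i2) auto
  also have "\<dots> = moment_poly M m (of_real u)"
    unfolding moment_poly_def integral_mult_right_zero integral_complex_of_real by (simp add: mult_ac)
  finally show "char M u - moment_poly M m (of_real u) = (\<integral>x. iexp_rem m (u * x) \<partial>M)"
    by (simp add: char_def)
qed

text \<open>Up to order m the differences are controlled by derivatives, taken inside the integral
  on the exponential itself. The j-th derivative of the remainder of order m is (ix)^j times the
  remainder of order m - j, so the powers of |x| always add up to s.\<close>

lemma fdiff_char_minus_moment_poly_le:
  assumes j: "j \<le> m" and d: "0 \<le> d" and U: "0 < U" "\<bar>u\<bar> \<le> U" "\<bar>u + real j * d\<bar> \<le> U"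
  shows "cmod ((fdiff d ^^ j) (\<lambda>u. char M u - moment_poly M m (of_real u)) u) \<le> 2 * d ^ j * U powr (s - real j) * eta U"
proof -
  let ?I = "\<lambda>x. (fdiff d ^^ j) (\<lambda>u. iexp_rem m (u * x)) u"
  have "(fdiff d ^^ j) (\<lambda>u. char M u - moment_poly M m (of_real u)) u = (\<integral>x. ?I x \<partial>M)"
    unfolding char_minus_moment_poly by (rule fdiff_pow_integral[OF iexp_rem_integrable])
  also have "cmod \<dots> \<le> (\<integral>x. cmod (?I x) \<partial>M)" by (rule integral_norm_bound)
  also have "\<dots> \<le> (\<integral>x. 2 * d ^ j * U powr (s - real j) * (\<bar>x\<bar> powr s * min 1 (U * \<bar>x\<bar>) powr (real (Suc m) - s)) \<partial>M)"
  proof (rule integral_mono)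
    show "integrable M (\<lambda>x. cmod (?I x))"
      by (intro integrable_norm fdiff_pow_integrable iexp_rem_integrable)
    show "integrable M (\<lambda>x. 2 * d ^ j * U powr (s - real j) * (\<bar>x\<bar> powr s * min 1 (U * \<bar>x\<bar>) powr (real (Suc m) - s)))"
      using U by (intro integrable_mult_right eta_integrable) auto
    fix x :: real
    \<comment> \<open>The k-th derivative in v of \<open>iexp_rem m (v * x)\<close>.\<close>
    define G where "G k v = (\<i> * of_real x) ^ k * iexp_rem (m - k) (v * x)" for k v
    define B where "B = \<bar>x\<bar> ^ j * (2 * (U * \<bar>x\<bar>) powr (real (m - j) + (s - real m)) * min 1 (U * \<bar>x\<bar>) powr (1 - (s - real m)))"
    have "cmod ((fdiff d ^^ j) (G 0) u) \<le> d ^ j * B"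
    proof (rule fdiff_pow_bound)
      fix k v assume "k < j"
      then have mk: "m - k = Suc (m - Suc k)" using j by simp
      have "((\<lambda>v. (\<i> * of_real x) ^ k * iexp_rem (Suc (m - Suc k)) (v * x)) has_vector_derivative
        (\<i> * of_real x) ^ k * (\<i> * x * iexp_rem (m - Suc k) (v * x))) (at v)"
        by (intro has_vector_derivative_mult_right iexp_rem_deriv)
      then show "(G k has_vector_derivative G (Suc k) v) (at v)"
        unfolding G_def[abs_def] mk by (simp add: mult_ac)
    next
      fix v assume v: "u \<le> v" "v \<le> u + real j * d"
      have vU: "\<bar>v\<bar> \<le> U" using v U by linarith
      show "cmod (G j v) \<le> B"
      proof (cases "x = 0")
        case True
        then show ?thesis by (simp add: G_def B_def)
      next
        case False
        have "cmod (iexp_rem (m - j) (v * x)) \<le> 2 * (U * \<bar>x\<bar>) powr (real (m - j) + (s - real m)) * min 1 (U * \<bar>x\<bar>) powr (1 - (s - real m))"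
          by (rule iexp_rem_bound) (use m_bounds vU U False in \<open>auto simp: abs_mult mult_right_mono\<close>)
        then show ?thesis by (simp add: G_def B_def norm_mult norm_power mult_left_mono)
      qed
    qed (use d in auto)
    also have "G 0 = (\<lambda>v. iexp_rem m (v * x))" by (simp add: G_def fun_eq_iff)
    also have "d ^ j * B = 2 * d ^ j * U powr (s - real j) * (\<bar>x\<bar> powr s * min 1 (U * \<bar>x\<bar>) powr (real (Suc m) - s))"
    proof (cases "x = 0")
      case True
      then show ?thesis using U by (simp add: B_def)
    next
      case False
      have e: "real (m - j) + (s - real m) = s - real j" "1 - (s - real m) = real (Suc m) - s"
        using j by (auto simp: of_nat_diff)
      have "\<bar>x\<bar> ^ j * (U * \<bar>x\<bar>) powr (s - real j) = U powr (s - real j) * \<bar>x\<bar> powr s"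
        using False U by (simp add: powr_mult powr_realpow[symmetric] powr_add[symmetric])
      then show ?thesis unfolding B_def e by (simp add: mult_ac)
    qed
    finally show "cmod (?I x) \<le> 2 * d ^ j * U powr (s - real j) * (\<bar>x\<bar> powr s * min 1 (U * \<bar>x\<bar>) powr (real (Suc m) - s))" .
  qed
  also have "\<dots> = 2 * d ^ j * U powr (s - real j) * eta U"
    unfolding eta_def by simp
  finally show ?thesis .
qed

lemma fdiff_char_integral: "(fdiff d ^^ j) (char M) u = (\<integral>x. iexp (u * x) * (iexp (d * x) - 1) ^ j \<partial>M)"
  and fdiff_char_integrable: "integrable M (\<lambda>x. iexp (u * x) * (iexp (d * x) - 1) ^ j)"
proof -
  have i: "integrable M (\<lambda>x. iexp (u * x))" for u by (rule integrable_const_bound[of _ 1]) auto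
  show "(fdiff d ^^ j) (char M) u = (\<integral>x. iexp (u * x) * (iexp (d * x) - 1) ^ j \<partial>M)"
    unfolding char_def[abs_def] fdiff_pow_integral[OF i] by (simp only: fdiff_pow_iexp)
  show "integrable M (\<lambda>x. iexp (u * x) * (iexp (d * x) - 1) ^ j)"
  proof -
    have "integrable M (\<lambda>x. (fdiff d ^^ j) (\<lambda>t. iexp (t * x)) u)"
      by (rule fdiff_pow_integrable) (rule i)
    then show ?thesis by (simp only: fdiff_pow_iexp)
  qed
qed

lemma fdiff_moment_poly: "(fdiff d ^^ Suc m) (\<lambda>u. moment_poly M m (of_real u)) u = 0"
proof -
  have "moment_poly M m (of_real u) = (\<Sum>k\<le>m. (of_real (\<integral>x. x ^ k \<partial>M) * \<i> ^ k / fact k) * of_real u ^ k)" for u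
    by (simp add: moment_poly_def power_mult_distrib mult_ac)
  then show ?thesis
    by (simp only: fdiff_pow_sum fdiff_pow_cmult) (simp add: fdiff_pow_monomial del: funpow.simps)
qed

text \<open>Of the j factors e^(idx) - 1 only the power min j s of |x| is used, because moments
  above s may be infinite.\<close>

lemma fdiff_char_le:
  assumes j: "1 \<le> j" and d: "0 \<le> d"
  shows "cmod ((fdiff d ^^ j) (char M) u) \<le> 2 ^ j * d powr min (real j) s * mom"
proof -
  let ?q = "min (real j) s"
  have q: "1 \<le> ?q" "?q \<le> s" using j s2 by auto
  have "cmod ((fdiff d ^^ j) (char M) u) \<le> (\<integral>x. cmod (iexp (u * x) * (iexp (d * x) - 1) ^ j) \<partial>M)"
    unfolding fdiff_char_integral by (rule integral_norm_bound)
  also have "\<dots> \<le> (\<integral>x. 2 ^ j * d powr ?q * \<bar>x\<bar> powr ?q \<partial>M)"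
  proof (rule integral_mono)
    fix x
    have "cmod (iexp (d * x) - 1) ^ j \<le> 2 ^ j * (\<bar>d * x\<bar> powr ?q * min 1 \<bar>d * x\<bar> powr (real j - ?q))"
      by (rule norm_iexp_minus_one_power_le) (use j s2 in auto)
    also have "\<dots> \<le> 2 ^ j * (\<bar>d * x\<bar> powr ?q * 1 powr (real j - ?q))"
      by (intro mult_left_mono powr_mono2) auto
    finally show "cmod (iexp (u * x) * (iexp (d * x) - 1) ^ j) \<le> 2 ^ j * d powr ?q * \<bar>x\<bar> powr ?q"
      using d by (simp add: norm_mult norm_power abs_mult powr_mult)
  qed (use q in \<open>auto intro!: integrable_mult_right moment_powr integrable_norm fdiff_char_integrable simp del: of_real_mult\<close>)
  also have "\<dots> = 2 ^ j * d powr ?q * (\<integral>x. \<bar>x\<bar> powr ?q \<partial>M)" by simp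
  also have "\<dots> \<le> 2 ^ j * d powr ?q * mom"
    by (intro mult_left_mono moment_powr q) auto
  finally show ?thesis .
qed

text \<open>Order m + 1 exceeds s, so no derivative is available. But this difference annihilates
  the polynomial and multiplies e^(iux) by (e^(idx) - 1)^(m+1), which is bounded by d^s |x|^s times
  the minimum factor of \<open>eta\<close>.\<close>

lemma fdiff_char_top_le:
  assumes d: "0 \<le> d" "d \<le> U"
  shows "cmod ((fdiff d ^^ Suc m) (\<lambda>u. char M u - moment_poly M m (of_real u)) u) \<le> 2 ^ Suc m * d powr s * eta U"
proof -
  have "cmod ((fdiff d ^^ Suc m) (\<lambda>u. char M u - moment_poly M m (of_real u)) u) =
     cmod (\<integral>x. iexp (u * x) * (iexp (d * x) - 1) ^ Suc m \<partial>M)"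
    unfolding fdiff_pow_diff fdiff_moment_poly fdiff_char_integral by simp
  also have "\<dots> \<le> (\<integral>x. cmod (iexp (u * x) * (iexp (d * x) - 1) ^ Suc m) \<partial>M)"
    by (rule integral_norm_bound)
  also have "\<dots> \<le> (\<integral>x. 2 ^ Suc m * d powr s * (\<bar>x\<bar> powr s * min 1 (U * \<bar>x\<bar>) powr (real (Suc m) - s)) \<partial>M)"
  proof (rule integral_mono)
    fix x
    have "cmod (iexp (d * x) - 1) ^ Suc m \<le> 2 ^ Suc m * (\<bar>d * x\<bar> powr s * min 1 \<bar>d * x\<bar> powr (real (Suc m) - s))"
      by (rule norm_iexp_minus_one_power_le) (use m_bounds s2 in auto)
    also have "\<dots> \<le> 2 ^ Suc m * (\<bar>d * x\<bar> powr s * min 1 (U * \<bar>x\<bar>) powr (real (Suc m) - s))"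
      using d m_bounds by (intro mult_left_mono powr_mono2 min.mono) (auto simp: abs_mult mult_right_mono)
    finally show "cmod (iexp (u * x) * (iexp (d * x) - 1) ^ Suc m) \<le>
      2 ^ Suc m * d powr s * (\<bar>x\<bar> powr s * min 1 (U * \<bar>x\<bar>) powr (real (Suc m) - s))"
      using d by (simp add: norm_mult norm_power abs_mult powr_mult mult_ac)
  next
    show "integrable M (\<lambda>x. cmod (iexp (u * x) * (iexp (d * x) - 1) ^ Suc m))"
      by (intro integrable_norm fdiff_char_integrable)
    show "integrable M (\<lambda>x. 2 ^ Suc m * d powr s * (\<bar>x\<bar> powr s * min 1 (U * \<bar>x\<bar>) powr (real (Suc m) - s)))"
      using d by (intro integrable_mult_right eta_integrable) auto
  qed
  also have "\<dots> = 2 ^ Suc m * d powr s * eta U"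
    unfolding eta_def by (subst integral_mult_right_zero) simp
  finally show ?thesis .
qed

text \<open>As the mean is 0, i d x may be subtracted under the integral, which makes the first
  difference a quantity of second order. After scaling it is of order 1/n, as a factor in an n-th
  power requires.\<close>

lemma fdiff_char_1_le:
  assumes d: "0 \<le> d"
  shows "cmod (fdiff d (char M) u) \<le> d * (\<bar>u\<bar> + d)"
proof -
  have i1: "integrable M (\<lambda>x. iexp (d * x) - 1)"
    by (intro Bochner_Integration.integrable_diff) (auto intro!: integrable_const_bound[of _ 1] simp del: of_real_mult)
  have id: "integrable M (\<lambda>x. \<i> * of_real (d * x))"
    using int_1 by (intro integrable_mult_right integrable_of_real) auto
  have "(\<integral>x. \<i> * of_real (d * x) \<partial>M) = \<i> * of_real (d * (\<integral>x. x \<partial>M))"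
    by (simp only: integral_mult_right_zero integral_complex_of_real)
  then have 0: "(\<integral>x. \<i> * of_real (d * x) \<partial>M) = 0" by (simp add: mean)
  have "fdiff d (char M) u = (\<integral>x. iexp (u * x) * (iexp (d * x) - 1) \<partial>M)"
    using fdiff_char_integral[where d = d and j = 1 and u = u] by simp
  also have "\<dots> = (\<integral>x. iexp (u * x) * (iexp (d * x) - 1) \<partial>M) - (\<integral>x. \<i> * of_real (d * x) \<partial>M)"
    by (simp only: 0) simp
  also have "\<dots> = (\<integral>x. iexp (u * x) * (iexp (d * x) - 1) - \<i> * of_real (d * x) \<partial>M)"
    using fdiff_char_integrable[where d = d and j = 1 and u = u] id by (subst Bochner_Integration.integral_diff) auto
  also have "cmod \<dots> \<le> (\<integral>x. cmod (iexp (u * x) * (iexp (d * x) - 1) - \<i> * of_real (d * x)) \<partial>M)"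
    by (rule integral_norm_bound)
  also have "\<dots> \<le> (\<integral>x. d * (\<bar>u\<bar> + d) * x\<^sup>2 \<partial>M)"
  proof (rule integral_mono)
    fix x
    \<comment> \<open>A product of two increments of first order plus the second-order Taylor
      remainder of e^(idx).\<close>
    have "iexp (u * x) * (iexp (d * x) - 1) - \<i> * of_real (d * x) =
      (iexp (u * x) - 1) * (iexp (d * x) - 1) + (iexp (d * x) - (\<Sum>k\<le>1. (\<i> * of_real (d * x)) ^ k / fact k))"
      by (simp add: algebra_simps)
    also have "cmod \<dots> \<le> cmod (iexp (u * x) - 1) * cmod (iexp (d * x) - 1) +
        cmod (iexp (d * x) - (\<Sum>k\<le>1. (\<i> * of_real (d * x)) ^ k / fact k))"
      by (rule order_trans[OF norm_triangle_ineq]) (simp add: norm_mult)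
    also have "\<dots> \<le> \<bar>u * x\<bar> * \<bar>d * x\<bar> + \<bar>d * x\<bar> ^ Suc 1 / fact (Suc 1)"
      using iexp_approx1[of "u * x" 0] iexp_approx1[of "d * x" 0]
      by (intro add_mono mult_mono iexp_approx1) auto
    also have "\<dots> \<le> d * (\<bar>u\<bar> + d) * x\<^sup>2"
      using d by (simp add: abs_mult power2_eq_square algebra_simps)
    finally show "cmod (iexp (u * x) * (iexp (d * x) - 1) - \<i> * of_real (d * x)) \<le> d * (\<bar>u\<bar> + d) * x\<^sup>2" .
  next
    show "integrable M (\<lambda>x. cmod (iexp (u * x) * (iexp (d * x) - 1) - \<i> * of_real (d * x)))"
      using fdiff_char_integrable[where d = d and j = 1 and u = u] id
      by (intro integrable_norm Bochner_Integration.integrable_diff) auto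
  qed (intro integrable_mult_right int_2)
  also have "\<dots> = d * (\<bar>u\<bar> + d)" by (simp add: var)
  finally show ?thesis .
qed

end

lemma holomorphic_bounded_unit:
  assumes "h holomorphic_on UNIV"
  shows "\<exists>B\<ge>1. \<forall>z. cmod z \<le> 1 \<longrightarrow> cmod (h z) \<le> B"
proof -
  have "compact (h ` cball 0 1)"
    using assms by (intro compact_continuous_image holomorphic_on_imp_continuous_on) (auto intro: holomorphic_on_subset)
  then have "bounded (h ` cball 0 1)" by (rule compact_imp_bounded)
  then obtain B where "\<forall>w\<in>h ` cball 0 1. cmod w \<le> B" by (auto simp: bounded_iff)
  then show ?thesis by (intro exI[of _ "max 1 B"]) (auto simp: le_max_iff_disj)
qed

lemma powr_le_exp: "0 \<le> x \<Longrightarrow> 0 \<le> a \<Longrightarrow> x powr a \<le> exp (a * x)" for x a :: real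
proof -
  assume "0 \<le> x" "0 \<le> a"
  then have "x powr a \<le> exp x powr a"
    using exp_ge_add_one_self[of x] by (intro powr_mono2) linarith+
  then show ?thesis by (simp add: powr_def)
qed

lemma power_le_exp: "0 \<le> x \<Longrightarrow> x ^ k \<le> exp (real k * x)" for x :: real
  using power_mono[of x "exp x" k] exp_ge_add_one_self[of x] by (simp add: exp_of_nat_mult)

lemma powr_half_sqrt_real: "0 < n \<Longrightarrow> sqrt (real n) powr a = real n powr (a / 2)"
  by (simp add: powr_half_sqrt[symmetric] powr_powr)

text \<open>The bound is an exponential with exponent divided by n, so its n-th power is a Gaussian
  times exp(const (1 + |t|)). The unit discount y = 1 is enough here because the differences of
  positive order already carry 1/n.\<close>

lemma gnorm_factor_le:
  assumes d: "0 < d" "d \<le> 1" and s: "0 \<le> s" and n: "0 < n" and t: "\<bar>t\<bar> \<le> sqrt (real n)" and C: "0 \<le> C"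
    and 0: "\<And>i. i \<le> J \<Longrightarrow> cmod (f (t + real i * d)) \<le> exp (- (t + real i * d)\<^sup>2 / (4 * real n))"
    and 1: "\<And>i j. 1 \<le> j \<Longrightarrow> i + j \<le> J \<Longrightarrow>
      cmod ((fdiff d ^^ j) f (t + real i * d)) \<le> fact j * d powr min (real j) s * (C * (1 + \<bar>t\<bar>) / real n)"
  shows "gnorm (std_weight d s 1) J d t f \<le> exp ((- t\<^sup>2 / 4 + (real J + 3 * real J * C) * (1 + \<bar>t\<bar>)) / real n)"
proof -
  define A where "A = exp ((- t\<^sup>2 / 4 + real J * (1 + \<bar>t\<bar>)) / real n)"
  define B where "B = C * (1 + \<bar>t\<bar>) / real n"
  have B0: "0 \<le> B" using C n by (simp add: B_def)
  have "gnorm (std_weight d s 1) J d t f \<le> A + real J * (B * 1)"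
  proof (rule gnorm_std_weight_le)
    fix i assume i: "i \<le> J"
    have a: "0 \<le> real i * d" "real i * d \<le> real J"
      using d i mult_mono[of "real i" "real J" d 1] by auto
    have "t\<^sup>2 - 2 * \<bar>t\<bar> * real J \<le> (t + real i * d)\<^sup>2"
    proof -
      have "- (\<bar>t\<bar> * real J) \<le> t * (real i * d)"
        using mult_left_mono[OF a(2), of "\<bar>t\<bar>"] d abs_ge_minus_self[of "t * (real i * d)"] by (simp add: abs_mult)
      moreover have "0 \<le> (real i * d)\<^sup>2" by simp
      moreover have "(t + real i * d)\<^sup>2 = t\<^sup>2 + 2 * (t * (real i * d)) + (real i * d)\<^sup>2"
        by (simp add: power2_sum)
      moreover have "2 * \<bar>t\<bar> * real J = 2 * (\<bar>t\<bar> * real J)" by simp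
      ultimately show ?thesis by linarith
    qed
    moreover have "0 \<le> \<bar>t\<bar> * real J" "real J * (1 + \<bar>t\<bar>) = real J + \<bar>t\<bar> * real J"
      "2 * \<bar>t\<bar> * real J = 2 * (\<bar>t\<bar> * real J)" by (simp_all add: algebra_simps)
    ultimately have "- (t + real i * d)\<^sup>2 / 4 \<le> - t\<^sup>2 / 4 + real J * (1 + \<bar>t\<bar>)"
      by linarith
    then have "- (t + real i * d)\<^sup>2 / (4 * real n) \<le> (- t\<^sup>2 / 4 + real J * (1 + \<bar>t\<bar>)) / real n"
      using divide_right_mono[of "- (t + real i * d)\<^sup>2 / 4" "- t\<^sup>2 / 4 + real J * (1 + \<bar>t\<bar>)" "real n"] by simp
    then show "cmod (f (t + real i * d)) \<le> A"
      unfolding A_def by (intro order_trans[OF 0[OF i]]) simp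
  qed (use d s B0 1 in \<open>auto simp: A_def B_def\<close>)
  \<comment> \<open>For |t| <= sqrt n one has A >= exp(-1) >= 1/3; hence the additive term can be
    rewritten as a multiple of A, at the price of the factor 3.\<close>
  also have "\<dots> \<le> A * (1 + 3 * real J * B)"
  proof -
    have "t\<^sup>2 \<le> (sqrt (real n))\<^sup>2" using t by (intro power2_le_iff_abs_le[THEN iffD2]) auto
    then have "- 1 \<le> - t\<^sup>2 / 4 / real n" using n by (simp add: field_simps)
    also have "\<dots> \<le> (- t\<^sup>2 / 4 + real J * (1 + \<bar>t\<bar>)) / real n"
      by (intro divide_right_mono) auto
    finally have "exp (- 1) \<le> A" unfolding A_def by simp
    moreover have "1 / 3 \<le> exp (- 1 :: real)" using exp_le by (simp add: exp_minus field_simps)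
    ultimately have "1 \<le> 3 * A" by linarith
    then have "(real J * B) * 1 \<le> (real J * B) * (3 * A)" using B0 by (intro mult_left_mono) auto
    then show ?thesis by (simp add: algebra_simps)
  qed
  also have "\<dots> \<le> A * exp (3 * real J * B)"
    using exp_ge_add_one_self[of "3 * real J * B"] by (intro mult_left_mono) (auto simp: A_def)
  also have "\<dots> = exp ((- t\<^sup>2 / 4 + (real J + 3 * real J * C) * (1 + \<bar>t\<bar>)) / real n)"
    unfolding A_def B_def exp_add[symmetric] using n by (intro arg_cong[where f = exp]) (simp add: field_simps)
  finally show ?thesis .
qed

section \<open>The factors f and E near the origin\<close>

context std_moment_dist begin

abbreviation E :: "complex \<Rightarrow> complex" where "E z \<equiv> exp (cumulant_poly M m z)"

lemma cumulants: "cumulant M 0 = 0" "cumulant M 1 = 0" "cumulant M 2 = 1"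
  and E_factor: "\<exists>K. K holomorphic_on UNIV \<and> (\<forall>z. E z - moment_poly M m z = z ^ Suc m * K z)"
  using exp_cumulant_poly[OF m_bounds(3) int_m mean var] by auto

lemma cumulant_poly_holomorphic: "cumulant_poly M m holomorphic_on UNIV"
  unfolding cumulant_poly_def[abs_def] by (intro holomorphic_intros) auto

lemma moment_poly_holomorphic: "moment_poly M m holomorphic_on UNIV"
  unfolding moment_poly_def[abs_def] by (intro holomorphic_intros) auto

lemma sum_split_two: "(\<Sum>k\<le>m. g k) = g 0 + g 1 + (\<Sum>k\<le>m-2. g (k + 2))" for g :: "nat \<Rightarrow> complex"
proof -
  obtain k where "m = Suc (Suc k)" using m_bounds(3) by (metis add_2_eq_Suc le_Suc_ex)
  then show ?thesis by (simp add: sum.atMost_Suc_shift del: sum.atMost_Suc)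
qed

text \<open>The cumulants of orders 0 and 1 vanish, so the exponent is z^2 T2(z) with T2(0) = -1/2.
  This yields both the Gaussian decay on the real axis and a Lipschitz constant proportional to the
  radius r.\<close>

lemma E_bounds:
  obtains L c where "1 \<le> L" "0 < c" "c \<le> 1"
    "\<And>z w r. cmod z \<le> r \<Longrightarrow> cmod w \<le> r \<Longrightarrow> r \<le> 1 \<Longrightarrow> cmod (E z - E w) \<le> L * r * cmod (z - w)"
    "\<And>z. cmod z \<le> 1 \<Longrightarrow> cmod (E z - moment_poly M m z) \<le> L * cmod z ^ Suc m"
    "\<And>u. \<bar>u\<bar> \<le> c \<Longrightarrow> cmod (E (of_real u)) \<le> exp (- u\<^sup>2 / 4)"
proof -
  define T2 where "T2 z = (\<Sum>k\<le>m-2. of_real (cumulant M (k + 2)) * \<i> ^ (k + 2) / fact (k + 2) * z ^ k)" for z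
  have T2: "T2 holomorphic_on UNIV"
    unfolding T2_def[abs_def] by (intro holomorphic_intros)
  have T: "cumulant_poly M m z = z\<^sup>2 * T2 z" for z
    unfolding cumulant_poly_def sum_split_two T2_def using cumulants
    by (simp add: sum_distrib_left power_mult_distrib power_add mult_ac power2_eq_square)
  have "T2 0 = -1/2"
    unfolding T2_def using cumulants by (subst sum.atMost_shift) (simp add: power_0_left numeral_2_eq_2)
  then have "(\<lambda>z. T2 z + 1/2) holomorphic_on UNIV" "T2 0 + 1/2 = 0"
    by (auto intro!: holomorphic_intros T2)
  then obtain T3 where T3: "T3 holomorphic_on UNIV" "\<And>z. T2 z + 1/2 = z * T3 z"
    using holomorphic_factor_at_0[of "\<lambda>z. T2 z + 1/2"] by blast
  obtain B3 where B3: "1 \<le> B3" "\<And>z. cmod z \<le> 1 \<Longrightarrow> cmod (T3 z) \<le> B3"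
    using holomorphic_bounded_unit[OF T3(1)] by blast
  define D where "D z = (2 * T2 z + z * deriv T2 z) * E z" for z
  have D: "D holomorphic_on UNIV"
    unfolding D_def[abs_def] by (intro holomorphic_intros T2 cumulant_poly_holomorphic) auto
  obtain B1 where B1: "1 \<le> B1" "\<And>z. cmod z \<le> 1 \<Longrightarrow> cmod (D z) \<le> B1"
    using holomorphic_bounded_unit[OF D] by blast
  obtain K where K: "K holomorphic_on UNIV" "\<And>z. E z - moment_poly M m z = z ^ Suc m * K z"
    using E_factor by blast
  obtain B2 where B2: "1 \<le> B2" "\<And>z. cmod z \<le> 1 \<Longrightarrow> cmod (K z) \<le> B2"
    using holomorphic_bounded_unit[OF K(1)] by blast
  \<comment> \<open>The factor z, present because the exponent starts with z^2, becomes the r in the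
    Lipschitz bound.\<close>
  have deriv: "(E has_field_derivative z * D z) (at z)" for z
  proof -
    have "(T2 has_field_derivative deriv T2 z) (at z)" by (rule holomorphic_derivI[OF T2]) auto
    then have "((\<lambda>z. exp (z\<^sup>2 * T2 z)) has_field_derivative z * ((2 * T2 z + z * deriv T2 z) * exp (z\<^sup>2 * T2 z))) (at z)"
      by (auto intro!: derivative_eq_intros simp: algebra_simps power2_eq_square)
    then show ?thesis by (simp add: D_def T)
  qed
  show thesis
  \<comment> \<open>For |u| <= 1/(4 B3) the distance of T2 from -1/2 is at most 1/4, so its real
    part is at most -1/4.\<close>
  proof (rule that[of "max B1 B2" "1 / (4 * B3)"])
    fix z w :: complex and r assume z: "cmod z \<le> r" "cmod w \<le> r" and r: "r \<le> 1"
    have r0: "0 \<le> r" using order_trans[OF norm_ge_zero z(1)] .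
    have "cmod (E z - E w) \<le> (r * B1) * cmod (z - w)"
    proof (rule field_differentiable_bound[where S = "cball 0 r" and f' = "\<lambda>z. z * D z"])
      fix z :: complex assume z: "z \<in> cball 0 r"
      show "(E has_field_derivative z * D z) (at z within cball 0 r)"
        using deriv by (rule has_field_derivative_at_within)
      show "cmod (z * D z) \<le> r * B1"
        unfolding norm_mult using z r r0 B1 by (intro mult_mono) auto
    qed (use z in auto)
    also have "\<dots> \<le> (max B1 B2 * r) * cmod (z - w)"
      using z order_trans[OF norm_ge_zero z(1)] by (intro mult_right_mono) (auto simp: mult.commute[of r] mult_right_mono r0)
    finally show "cmod (E z - E w) \<le> max B1 B2 * r * cmod (z - w)" .
  next
    fix z :: complex assume z: "cmod z \<le> 1"
    have "cmod (E z - moment_poly M m z) = cmod z ^ Suc m * cmod (K z)"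
      unfolding K(2) by (simp only: norm_mult norm_power)
    also have "\<dots> \<le> cmod z ^ Suc m * max B1 B2" using B2(2)[OF z] by (intro mult_left_mono) auto
    finally show "cmod (E z - moment_poly M m z) \<le> max B1 B2 * cmod z ^ Suc m" by (simp only: mult.commute)
  next
    fix u :: real assume u: "\<bar>u\<bar> \<le> 1 / (4 * B3)"
    also have "\<dots> \<le> 1" using B3(1) by simp
    finally have u1: "\<bar>u\<bar> \<le> 1" .
    have "cmod (of_real u * T3 (of_real u)) \<le> \<bar>u\<bar> * B3"
      using B3(2)[of "of_real u"] u1 by (simp add: norm_mult mult_left_mono)
    also have "\<dots> \<le> 1 / 4" using u B3(1) by (simp add: field_simps)
    finally have "Re (T2 (of_real u) + 1 / 2) \<le> 1 / 4"
      using complex_Re_le_cmod[of "T2 (of_real u) + 1/2"] by (simp add: T3(2))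
    then have r: "Re (T2 (of_real u)) \<le> - 1 / 4" by simp
    have "Re (cumulant_poly M m (of_real u)) = u\<^sup>2 * Re (T2 (of_real u))"
      unfolding T by (simp flip: of_real_power)
    also have "\<dots> \<le> u\<^sup>2 * (- 1 / 4)" using r by (rule mult_left_mono) simp
    finally show "cmod (E (of_real u)) \<le> exp (- u\<^sup>2 / 4)" by simp
  qed (use B1 B2 B3 in auto)
qed

lemma char_near_0: obtains c where "0 < c" "c \<le> 1" "\<And>u. \<bar>u\<bar> \<le> c \<Longrightarrow> cmod (char M u) \<le> exp (- u\<^sup>2 / 4)"
proof -
  have int2: "integrable M (\<lambda>x. \<bar>x\<bar> ^ 2)" using integrable_power_le(1)[OF int_m m_bounds(3)] by simp
  have mp: "moment_poly M 2 (of_real u) = 1 - (of_real u)\<^sup>2 / 2" for u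
  proof -
    have "(\<Sum>k\<le>2. g k) = g 0 + g 1 + g 2" for g :: "nat \<Rightarrow> complex" by (simp add: numeral_2_eq_2)
    then show ?thesis
      unfolding moment_poly_def by (simp add: mean var prob_space[simplified] power_mult_distrib)
  qed
  have "(\<lambda>u. char M u - (1 - (of_real u)\<^sup>2 / 2)) \<in> o[at 0](\<lambda>u. of_real u ^ 2)"
    using char_taylor[OF int2] unfolding mp by simp
  from landau_o.smallD[OF this, of "1/4"] obtain c where c: "c > 0"
    "\<And>u. u \<noteq> 0 \<Longrightarrow> \<bar>u\<bar> < c \<Longrightarrow> cmod (char M u - (1 - (of_real u)\<^sup>2 / 2)) \<le> 1 / 4 * u\<^sup>2"
    by (auto simp: eventually_at dist_real_def norm_power)
  show thesis
  \<comment> \<open>The little-o bound holds for |u| < c only, whence c / 2; the 1 makes 1 - u^2/2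
    nonnegative, so it is its own modulus.\<close>
  proof (rule that[of "min (c / 2) 1"])
    fix u :: real assume u: "\<bar>u\<bar> \<le> min (c / 2) 1"
    show "cmod (char M u) \<le> exp (- u\<^sup>2 / 4)"
    proof (cases "u = 0")
      case False
      have "cmod (char M u) \<le> cmod (char M u - (1 - (of_real u)\<^sup>2 / 2)) + cmod (1 - (complex_of_real u)\<^sup>2 / 2)"
        using norm_triangle_ineq[of "char M u - (1 - (of_real u)\<^sup>2 / 2)" "1 - (complex_of_real u)\<^sup>2 / 2"] by simp
      also have "cmod (1 - (complex_of_real u)\<^sup>2 / 2) = \<bar>1 - u\<^sup>2 / 2\<bar>"
        using norm_of_real[of "1 - u\<^sup>2 / 2", where 'a = complex] by (simp del: norm_of_real)
      also have "\<dots> = 1 - u\<^sup>2 / 2"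
        using u abs_square_le_1[of u] by simp
      also have "cmod (char M u - (1 - (of_real u)\<^sup>2 / 2)) \<le> 1 / 4 * u\<^sup>2"
        using u c(1) False by (intro c(2)) auto
      finally have "cmod (char M u) \<le> 1 + (- u\<^sup>2 / 4)" by simp
      also have "\<dots> \<le> exp (- u\<^sup>2 / 4)" by (rule exp_ge_add_one_self)
      finally show ?thesis .
    qed (simp add: char_zero)
  qed (use c in auto)
qed

text \<open>The least integer order of difference exceeding s; at this order the weight has the full
  exponent s.\<close>

definition J :: nat where "J = Suc m"

text \<open>The factor 1/n has two sources: \<open>fdiff_char_1_le\<close> for j = 1, and for j >= 2
  the scaling, since min j s >= 2.\<close>

lemma fdiff_scaled_char_le:
  assumes d: "0 < d" "d \<le> 1" and n: "0 < n" and ij: "1 \<le> j" "i + j \<le> J"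
  shows "cmod ((fdiff d ^^ j) (\<lambda>t. char M (t / sqrt (real n))) (t + real i * d)) \<le>
    fact j * d powr min (real j) s * ((2 ^ J * mom * (1 + real J)) * (1 + \<bar>t\<bar>) / real n)"
proof -
  let ?r = "sqrt (real n)" and ?q = "min (real j) s"
  let ?C = "2 ^ J * mom * (1 + real J)"
  have r: "?r > 0" "?r * ?r = real n" "1 \<le> ?r" using n by auto
  have "(1::real) * 1 \<le> 2 ^ J * mom" using mom_ge_1 by (intro mult_mono) auto
  then have C1: "1 + real J \<le> ?C" using mult_right_mono[of 1 "2 ^ J * mom" "1 + real J"] by simp
  have "cmod ((fdiff d ^^ j) (\<lambda>t. char M (t / ?r)) (t + real i * d)) = cmod ((fdiff (d / ?r) ^^ j) (char M) ((t + real i * d) / ?r))"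
    by (simp only: fdiff_pow_scale)
  also have "\<dots> \<le> d powr ?q * (?C * (1 + \<bar>t\<bar>) / real n)"
  proof (cases "j = 1")
    case True
    have id: "real i * d + d \<le> real J" 
      using mult_mono[of "real (Suc i)" "real J" d 1] ij d True by (simp add: algebra_simps)
    have "cmod ((fdiff (d / ?r) ^^ j) (char M) ((t + real i * d) / ?r)) \<le> d / ?r * (\<bar>(t + real i * d) / ?r\<bar> + d / ?r)"
      using fdiff_char_1_le[of "d / ?r" "(t + real i * d) / ?r"] True d r by simp
    also have "\<dots> = d * (\<bar>t + real i * d\<bar> + d) / real n"
    proof -
      have "d / ?r * (a / ?r + d / ?r) = d * (a + d) / (?r * ?r)" for a by (simp add: add_divide_distrib algebra_simps)
      then show ?thesis unfolding abs_divide r(2) using r(1) by simp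
    qed
    also have "\<dots> \<le> d * ((1 + real J) * (1 + \<bar>t\<bar>)) / real n"
    proof (intro divide_right_mono mult_left_mono)
      have "\<bar>t + real i * d\<bar> + d \<le> \<bar>t\<bar> + real J" using id d abs_triangle_ineq[of t "real i * d"] by (simp add: abs_mult)
      also have "\<dots> \<le> (1 + real J) * (1 + \<bar>t\<bar>)" by (simp add: algebra_simps)
      finally show "\<bar>t + real i * d\<bar> + d \<le> (1 + real J) * (1 + \<bar>t\<bar>)" .
    qed (use d in auto)
    also have "\<dots> \<le> d * (?C * (1 + \<bar>t\<bar>)) / real n"
      using d C1 by (intro divide_right_mono mult_left_mono mult_right_mono) auto
    finally show ?thesis using True s2 d by (simp add: min_def)
  next
    case False
    with ij have q: "2 \<le> ?q" using s2 by auto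
    have "cmod ((fdiff (d / ?r) ^^ j) (char M) ((t + real i * d) / ?r)) \<le> 2 ^ j * (d / ?r) powr ?q * mom"
      by (rule fdiff_char_le) (use ij d r in auto)
    also have "\<dots> \<le> 2 ^ J * (d powr ?q / real n) * mom"
    proof (intro mult_right_mono mult_mono)
      have "?r powr 2 \<le> ?r powr ?q" using q r by (intro powr_mono) auto
      then have "real n \<le> ?r powr ?q" using n by (simp add: powr_numeral)
      then have "d powr ?q / ?r powr ?q \<le> d powr ?q / real n"
        using n r by (intro divide_left_mono mult_pos_pos) auto
      then show "(d / ?r) powr ?q \<le> d powr ?q / real n" using d r by (simp add: powr_divide)
    qed (use ij mom_ge_1 in auto)
    also have "\<dots> = d powr ?q * ((2 ^ J * mom) * 1 / real n)" by simp
    also have "\<dots> \<le> d powr ?q * ((2 ^ J * mom) * ((1 + real J) * (1 + \<bar>t\<bar>)) / real n)"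
      using mom_ge_1 mult_mono[of 1 "1 + real J" 1 "1 + \<bar>t\<bar>"]
      by (intro mult_left_mono divide_right_mono) auto
    finally show ?thesis by (simp add: mult.assoc)
  qed
  also have "\<dots> \<le> fact j * (d powr ?q * (?C * (1 + \<bar>t\<bar>) / real n))"
  proof -
    have "1 * (d powr ?q * (?C * (1 + \<bar>t\<bar>) / real n)) \<le> fact j * (d powr ?q * (?C * (1 + \<bar>t\<bar>) / real n))"
      using mom_ge_1 by (intro mult_right_mono mult_nonneg_nonneg divide_nonneg_nonneg) auto
    then show ?thesis by simp
  qed
  finally show ?thesis by (simp add: mult.assoc)
qed

end

lemma holomorphic_on_scaled: "h holomorphic_on UNIV \<Longrightarrow> (\<lambda>z. h (z / c)) holomorphic_on UNIV"
proof -
  assume h: "h holomorphic_on UNIV"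
  have "(\<lambda>z. z * inverse c) holomorphic_on UNIV" by (intro holomorphic_intros)
  from holomorphic_on_compose_gen[OF this h] show ?thesis by (simp add: o_def divide_inverse)
qed

context std_moment_dist begin

text \<open>Around each point the value of E there is subtracted. In scaled variables the circle has
  radius 1 / sqrt n and lies within O((1 + |t|) / sqrt n) of 0, so the oscillation of E on it is of
  order (1 + |t|)/n.\<close>

lemma fdiff_scaled_E_le:
  assumes L: "1 \<le> L" "\<And>z w r. cmod z \<le> r \<Longrightarrow> cmod w \<le> r \<Longrightarrow> r \<le> 1 \<Longrightarrow> cmod (E z - E w) \<le> L * r * cmod (z - w)"
    and d: "0 < d" "d \<le> 1" and n: "0 < n" and t: "\<bar>t\<bar> + real J + 1 \<le> sqrt (real n)" and ij: "1 \<le> j" "i + j \<le> J"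
  shows "cmod ((fdiff d ^^ j) (\<lambda>t. E (of_real (t / sqrt (real n)))) (t + real i * d)) \<le>
    fact j * d powr min (real j) s * (L * (1 + real J) * (1 + \<bar>t\<bar>) / real n)"
proof -
  let ?r = "sqrt (real n)"
  define B where "B = L * (1 + real J) * (1 + \<bar>t\<bar>) / real n"
  have r: "?r > 0" "?r * ?r = real n" using n by auto
  have B0: "0 \<le> B" using L by (simp add: B_def)
  define h where "h z = E (z / complex_of_real ?r)" for z
  have "cmod ((fdiff d ^^ j) (\<lambda>t. h (of_real t)) (t + real i * d)) \<le> d ^ j * (fact j * B)"
  proof (rule fdiff_pow_holomorphic_bound[where c = "\<lambda>u. h (of_real u)"])
    show "h holomorphic_on UNIV"
      unfolding h_def[abs_def]
      by (intro holomorphic_intros holomorphic_on_scaled cumulant_poly_holomorphic)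
    fix u :: real and z :: complex assume u: "t + real i * d \<le> u" "u \<le> t + real i * d + real j * d" and z: "cmod (complex_of_real u - z) = 1"
    have "real i * d + real j * d \<le> real J"
      using mult_mono[of "real i + real j" "real J" d 1] ij d by (simp add: algebra_simps)
    moreover have "0 \<le> real i * d" using d by simp
    ultimately have "\<bar>u\<bar> \<le> \<bar>t\<bar> + real J" using u by linarith
    then have u': "cmod (of_real u) \<le> \<bar>t\<bar> + real J + 1" by simp
    have "cmod z \<le> cmod (of_real u) + cmod (complex_of_real u - z)"
      using norm_triangle_ineq4[of "of_real u" "of_real u - z"] by simp
    then have z': "cmod z \<le> \<bar>t\<bar> + real J + 1" using z \<open>\<bar>u\<bar> \<le> _\<close> by simp
    let ?R = "(\<bar>t\<bar> + real J + 1) / ?r"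
    have "cmod (E (z / complex_of_real ?r) - E ((complex_of_real u / complex_of_real ?r))) \<le> L * ?R * cmod (z / complex_of_real ?r - (complex_of_real u / complex_of_real ?r))"
    proof (rule L(2))
      show "cmod (z / complex_of_real ?r) \<le> ?R" using divide_right_mono[OF z', of ?r] r by (simp add: norm_divide)
      show "cmod ((complex_of_real u / complex_of_real ?r)) \<le> ?R" using divide_right_mono[OF u', of ?r] r by (simp add: norm_divide)
      show "?R \<le> 1" using t r by (simp add: divide_le_eq)
    qed
    also have "cmod (z / complex_of_real ?r - (complex_of_real u / complex_of_real ?r)) = 1 / ?r"
      using z r by (simp add: diff_divide_distrib[symmetric] norm_divide norm_minus_commute)
    also have "L * ?R * (1 / ?r) = L * (\<bar>t\<bar> + real J + 1) / (?r * ?r)" by simp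
    also have "\<dots> = L * (\<bar>t\<bar> + real J + 1) / real n" unfolding r(2) ..
    also have "\<dots> \<le> L * ((1 + real J) * (1 + \<bar>t\<bar>)) / real n"
      using L by (intro divide_right_mono mult_left_mono) (auto simp: algebra_simps)
    finally show "cmod (h z - h (of_real u)) \<le> B" by (simp add: B_def h_def mult.assoc)
  qed (use d ij in auto)
  also have "d ^ j * (fact j * B) \<le> d powr min (real j) s * (fact j * B)"
  proof (rule mult_right_mono)
    have "d ^ j = d powr real j" using d by (simp add: powr_realpow)
    also have "\<dots> \<le> d powr min (real j) s" using d by (intro powr_mono') auto
    finally show "d ^ j \<le> d powr min (real j) s" .
  qed (use B0 in simp)
  finally show ?thesis by (simp add: B_def h_def mult_ac)
qed

text \<open>The difference is split at \<open>moment_poly\<close>: \<open>eta\<close> controls the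
  part next to the characteristic function, the zero of order m + 1 the entire part. Powers of 1 +
  |t| are put into an exponential, ready for absorption by the Gaussian.\<close>

lemma gnorm_remainder_le:
  assumes L: "1 \<le> L" "\<And>z. cmod z \<le> 1 \<Longrightarrow> cmod (E z - moment_poly M m z) \<le> L * cmod z ^ Suc m"
    and d: "0 < d" "d \<le> 1" and n: "0 < n" and t: "\<bar>t\<bar> + real J + 1 \<le> sqrt (real n)"
  shows "gnorm (std_weight d s 1) J d t (\<lambda>t. char M (t / sqrt (real n)) - E (of_real (t / sqrt (real n)))) \<le>
    (1 + real J) * (2 ^ J + L) * (real n powr (- s / 2) * eta (real J * (1 + \<bar>t\<bar>) / sqrt (real n)) + real n powr (- real (Suc m) / 2))
      * exp ((s * real J + real (Suc m) * (1 + real J)) * (1 + \<bar>t\<bar>))"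
proof -
  let ?r = "sqrt (real n)" and ?T = "real J * (1 + \<bar>t\<bar>)"
  define U where "U = ?T / ?r"
  have r: "?r > 0" "1 \<le> ?r" using n by auto
  have J1: "1 \<le> real J" by (simp add: J_def)
  have U0: "U > 0" using r J1 by (simp add: U_def)
  interpret diff_weight "std_weight d s 1" J
    by (rule diff_weight_std_weight) (use d s2 in auto)
  define f where "f u = char M u - moment_poly M m (of_real u)" for u
  define h where "h z = moment_poly M m (z / complex_of_real ?r) - E (z / complex_of_real ?r)" for z
  define Q where "Q = real n powr (- s / 2) * eta U * exp (s * ?T)"
  have Q0: "0 \<le> Q" by (simp add: Q_def eta_nonneg)
  have eT: "?T powr a \<le> exp (s * ?T)" if "0 \<le> a" "a \<le> s" for a
  proof -
    have "1 * 1 \<le> ?T" using J1 by (intro mult_mono) auto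
    then have "?T powr a \<le> ?T powr s" using that by (intro powr_mono) auto
    also have "\<dots> \<le> exp (s * ?T)" by (rule powr_le_exp) (use s2 in auto)
    finally show ?thesis .
  qed
  \<comment> \<open>Whatever the order a, the powers of sqrt n combine to n^(-s/2): a of them come
    from the step d / sqrt n and s - a from U.\<close>
  have dU: "(d / ?r) powr a * U powr (s - a) * eta U \<le> d powr a * Q" if "0 \<le> a" "a \<le> s" for a
  proof -
    have "(d / ?r) powr a * U powr (s - a) = d powr a * (?T powr (s - a)) / (?r powr a * ?r powr (s - a))"
      using d r J1 by (simp add: U_def powr_divide)
    also have "?r powr a * ?r powr (s - a) = real n powr (s / 2)"
      using n powr_half_sqrt_real[OF n, of s] by (simp flip: powr_add)
    also have "d powr a * (?T powr (s - a)) / real n powr (s / 2) = d powr a * (?T powr (s - a)) * real n powr (- s / 2)"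
      by (simp add: powr_minus_divide)
    also have "d powr a * (?T powr (s - a)) * real n powr (- s / 2) \<le> d powr a * exp (s * ?T) * real n powr (- s / 2)"
      using that by (intro mult_right_mono mult_left_mono eT) auto
    finally have "(d / ?r) powr a * U powr (s - a) * eta U \<le> d powr a * exp (s * ?T) * real n powr (- s / 2) * eta U"
      by (rule mult_right_mono[OF _ eta_nonneg])
    then show ?thesis by (simp add: Q_def mult_ac)
  qed
  have bnd: "cmod ((fdiff d ^^ j) (\<lambda>t. f (t / ?r)) (t + real i * d)) \<le> fact j * d powr min (real j) s * (2 ^ J * Q)"
    if ij: "i + j \<le> J" for i j
  proof -
    have id: "0 \<le> real i * d" "real i * d + real j * d \<le> real J" "0 \<le> real j * d"
      using mult_mono[of "real i + real j" "real J" d 1] ij d by (simp_all add: algebra_simps)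
    let ?u = "(t + real i * d) / ?r"
    have tJ: "\<bar>t\<bar> + real J \<le> ?T" using J1 mult_right_mono[of 1 "real J" "\<bar>t\<bar>"] by (simp add: algebra_simps)
    have u: "\<bar>?u\<bar> \<le> U" "\<bar>?u + real j * (d / ?r)\<bar> \<le> U"
    proof -
      have "\<bar>t + real i * d\<bar> \<le> ?T" "\<bar>t + real i * d + real j * d\<bar> \<le> ?T" using tJ id by linarith+
      then show "\<bar>?u\<bar> \<le> U" "\<bar>?u + real j * (d / ?r)\<bar> \<le> U"
        using r unfolding U_def by (auto simp: abs_divide divide_right_mono simp flip: add_divide_distrib)
    qed
    have "cmod ((fdiff d ^^ j) (\<lambda>t. f (t / ?r)) (t + real i * d)) = cmod ((fdiff (d / ?r) ^^ j) f ?u)"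
      by (simp only: fdiff_pow_scale)
    also have "\<dots> \<le> d powr min (real j) s * (2 ^ J * Q)"
    proof (cases "j \<le> m")
      case True
      have js: "real j \<le> s" using True m_bounds by linarith
      have "cmod ((fdiff (d / ?r) ^^ j) f ?u) \<le> 2 * (d / ?r) ^ j * U powr (s - real j) * eta U"
        unfolding f_def by (rule fdiff_char_minus_moment_poly_le) (use True d r U0 u in auto)
      also have "(d / ?r) ^ j = (d / ?r) powr real j" using d r by (simp add: powr_realpow)
      also have "2 * (d / ?r) powr real j * U powr (s - real j) * eta U = 2 * ((d / ?r) powr real j * U powr (s - real j) * eta U)"
        by simp
      also have "\<dots> \<le> 2 * (d powr real j * Q)" by (intro mult_left_mono dU) (use js in auto)
      also have "\<dots> = d powr min (real j) s * (2 ^ 1 * Q)" using js by (simp add: min_def)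
      also have "\<dots> \<le> d powr min (real j) s * (2 ^ J * Q)"
        using Q0 by (intro mult_left_mono mult_right_mono power_increasing) (auto simp: J_def)
      finally show ?thesis .
    next
      case False
      then have j: "j = Suc m" using ij by (simp add: J_def)
      have "d / ?r \<le> U" using d J1 r mult_mono[of d "real J" 1 "1 + \<bar>t\<bar>"] unfolding U_def by (intro divide_right_mono) auto
      then have "cmod ((fdiff (d / ?r) ^^ j) f ?u) \<le> 2 ^ Suc m * (d / ?r) powr s * eta U"
        unfolding f_def j using d r by (intro fdiff_char_top_le) auto
      also have "\<dots> = 2 ^ J * ((d / ?r) powr s * U powr (s - s) * eta U)" using U0 by (simp add: J_def)
      also have "\<dots> \<le> 2 ^ J * (d powr s * Q)" by (intro mult_left_mono dU) (use s2 in auto)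
      also have "\<dots> = d powr min (real j) s * (2 ^ J * Q)" using m_bounds j by (simp add: min_def)
      finally show ?thesis .
    qed
    also have "\<dots> \<le> fact j * (d powr min (real j) s * (2 ^ J * Q))"
      using Q0 mult_right_mono[of 1 "fact j" "d powr min (real j) s * (2 ^ J * Q)"] by simp
    finally show ?thesis by (simp add: mult.assoc)
  qed
  have "gnorm (std_weight d s 1) J d t (\<lambda>t. f (t / ?r)) \<le> 2 ^ J * Q + real J * (2 ^ J * Q * 1)"
  proof (rule gnorm_std_weight_le)
    fix i assume "i \<le> J"
    with bnd[of i 0] d s2 show "cmod (f ((t + real i * d) / ?r)) \<le> 2 ^ J * Q" by simp
  qed (use d s2 Q0 bnd in auto)
  then have f: "gnorm (std_weight d s 1) J d t (\<lambda>t. f (t / ?r)) \<le> (1 + real J) * 2 ^ J * Q" by (simp add: algebra_simps)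
  define P where "P = real n powr (- real (Suc m) / 2) * exp (real (Suc m) * (1 + real J) * (1 + \<bar>t\<bar>))"
  have "gnorm (std_weight d s 1) J d t (\<lambda>t. h (of_real t)) \<le> (1 + real J) * (L * P)"
  proof (rule gnorm_entire_le)
    show "h holomorphic_on UNIV"
      unfolding h_def[abs_def]
      by (intro holomorphic_intros holomorphic_on_scaled cumulant_poly_holomorphic moment_poly_holomorphic)
    fix u :: real and z :: complex assume u: "t \<le> u" "u \<le> t + real J" and z: "cmod (complex_of_real u - z) \<le> 1"
    have "\<bar>u\<bar> \<le> \<bar>t\<bar> + real J" using u by linarith
    moreover have "cmod z \<le> cmod (of_real u) + cmod (complex_of_real u - z)"
      using norm_triangle_ineq4[of "of_real u" "of_real u - z"] by simp
    ultimately have z': "cmod z \<le> \<bar>t\<bar> + real J + 1" using z by simp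
    have z1: "cmod (z / ?r) \<le> 1" using z' t r by (simp add: norm_divide divide_le_eq)
    have "cmod (h z) \<le> L * cmod (z / ?r) ^ Suc m"
      using L(2)[OF z1] by (simp add: h_def norm_minus_commute)
    also have "cmod (z / ?r) ^ Suc m \<le> ((1 + real J) * (1 + \<bar>t\<bar>) / ?r) ^ Suc m"
    proof (rule power_mono)
      have "\<bar>t\<bar> + real J + 1 \<le> (1 + real J) * (1 + \<bar>t\<bar>)" by (simp add: algebra_simps)
      then show "cmod (z / ?r) \<le> (1 + real J) * (1 + \<bar>t\<bar>) / ?r"
        using z' r by (simp add: norm_divide divide_right_mono)
    qed simp
    also have "\<dots> = ((1 + real J) * (1 + \<bar>t\<bar>)) ^ Suc m * real n powr (- real (Suc m) / 2)"
    proof -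
      have e: "?r ^ Suc m = real n powr (real (Suc m) / 2)"
        unfolding powr_half_sqrt_real[OF n, symmetric] by (rule powr_realpow[OF r(1), symmetric])
      have "real n powr (- real (Suc m) / 2) = inverse (real n powr (real (Suc m) / 2))"
        using powr_minus[of "real n" "real (Suc m) / 2"] by (simp only: minus_divide_left)
      then show ?thesis unfolding power_divide e by (simp only: divide_inverse)
    qed
    also have "((1 + real J) * (1 + \<bar>t\<bar>)) ^ Suc m \<le> exp (real (Suc m) * ((1 + real J) * (1 + \<bar>t\<bar>)))"
      by (rule power_le_exp) simp
    finally have "cmod (h z) \<le> L * (exp (real (Suc m) * ((1 + real J) * (1 + \<bar>t\<bar>))) * real n powr (- real (Suc m) / 2))"
      using L(1) by (simp add: mult_left_mono mult_right_mono del: power_Suc)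
    then show "cmod (h z) \<le> L * P" by (simp add: P_def mult.assoc mult.commute[of "exp _"])
  qed (use d s2 in auto)
  then have "gnorm (std_weight d s 1) J d t (\<lambda>t. f (t / ?r)) + gnorm (std_weight d s 1) J d t (\<lambda>t. h (of_real t))
    \<le> (1 + real J) * 2 ^ J * Q + (1 + real J) * (L * P)" using f by (intro add_mono)
  moreover have "gnorm (std_weight d s 1) J d t (\<lambda>t. f (t / ?r) + h (of_real t)) \<le>
    gnorm (std_weight d s 1) J d t (\<lambda>t. f (t / ?r)) + gnorm (std_weight d s 1) J d t (\<lambda>t. h (of_real t))"
    by (rule gnorm_add)
  moreover have "(\<lambda>t. f (t / ?r) + h (of_real t)) = (\<lambda>t. char M (t / ?r) - E (of_real (t / ?r)))"
    by (simp add: f_def h_def fun_eq_iff)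
  moreover have "(1 + real J) * 2 ^ J * Q + (1 + real J) * (L * P) \<le>
    (1 + real J) * (2 ^ J + L) * (real n powr (- s / 2) * eta U + real n powr (- real (Suc m) / 2))
      * exp ((s * real J + real (Suc m) * (1 + real J)) * (1 + \<bar>t\<bar>))"
  proof -
    let ?e = "exp ((s * real J + real (Suc m) * (1 + real J)) * (1 + \<bar>t\<bar>))"
    have "Q \<le> real n powr (- s / 2) * eta U * ?e"
      unfolding Q_def using s2 by (intro mult_left_mono) (auto simp: eta_nonneg algebra_simps)
    moreover have "P \<le> real n powr (- real (Suc m) / 2) * ?e"
      unfolding P_def using s2 by (intro mult_left_mono) (auto simp: algebra_simps)
    moreover have "0 \<le> real n powr (- s / 2) * eta U * ?e" "0 \<le> real n powr (- real (Suc m) / 2) * ?e"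
      by (auto simp: eta_nonneg)
    ultimately have "2 ^ J * Q + L * P \<le> (2 ^ J + L) * (real n powr (- s / 2) * eta U * ?e) + (2 ^ J + L) * (real n powr (- real (Suc m) / 2) * ?e)"
      using L(1) Q0 by (intro add_mono mult_mono) (auto simp: P_def)
    then have "(1 + real J) * (2 ^ J * Q + L * P) \<le> (1 + real J) * ((2 ^ J + L) * (real n powr (- s / 2) * eta U * ?e) + (2 ^ J + L) * (real n powr (- real (Suc m) / 2) * ?e))"
      by (rule mult_left_mono) simp
    then show ?thesis by (simp add: algebra_simps)
  qed
  ultimately show ?thesis by (simp only: U_def)
qed

end

section \<open>The Edgeworth remainder\<close>

text \<open>For |Im z| <= 1 the real part of -z^2/2 + |z|^2/16 is -7/16 (Re z)^2 plus a bounded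
  term. This leaves room for -t^2/4 after Re z is replaced by t, from which it differs by at most b
  + 1.\<close>

lemma norm_gauss_strip_le:
  assumes z: "t \<le> u" "u \<le> t + b" "cmod (complex_of_real u - z) \<le> 1"
  shows "cmod (exp (- z\<^sup>2 / 2)) * exp ((cmod z)\<^sup>2 / 16) \<le> exp (- t\<^sup>2 / 4 + (b + 2) * (1 + \<bar>t\<bar>))"
    and "1 + cmod z \<le> (b + 2) * (1 + \<bar>t\<bar>)"
proof -
  have b: "0 \<le> b" using z by simp
  have x: "\<bar>Re z - t\<bar> \<le> b + 1" and y: "\<bar>Im z\<bar> \<le> 1"
    using abs_Re_le_cmod[of "of_real u - z"] abs_Im_le_cmod[of "of_real u - z"] z by auto
  have y2: "(Im z)\<^sup>2 \<le> 1" using y by (simp add: abs_square_le_1)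
  have "t\<^sup>2 - 2 * ((b + 1) * \<bar>t\<bar>) \<le> (Re z)\<^sup>2"
  proof -
    have "- ((b + 1) * \<bar>t\<bar>) \<le> t * (Re z - t)"
      using mult_right_mono[OF x, of "\<bar>t\<bar>"] abs_ge_minus_self[of "t * (Re z - t)"]
      by (simp add: abs_mult mult.commute)
    moreover have "0 \<le> (Re z - t)\<^sup>2" by simp
    moreover have "(Re z)\<^sup>2 = t\<^sup>2 + 2 * (t * (Re z - t)) + (Re z - t)\<^sup>2" by (simp add: power2_eq_square algebra_simps)
    ultimately show ?thesis by linarith
  qed
  moreover have "Re (- z\<^sup>2 / 2) = ((Im z)\<^sup>2 - (Re z)\<^sup>2) / 2" by (simp add: power2_eq_square field_simps)
  moreover have "(cmod z)\<^sup>2 = (Re z)\<^sup>2 + (Im z)\<^sup>2" by (rule cmod_power2)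
  moreover have "(b + 2) * (1 + \<bar>t\<bar>) = b + 2 + (b + 1) * \<bar>t\<bar> + \<bar>t\<bar>" "0 \<le> (b + 1) * \<bar>t\<bar>" "0 \<le> t\<^sup>2"
    using b by (simp_all add: algebra_simps)
  ultimately have "Re (- z\<^sup>2 / 2) + (cmod z)\<^sup>2 / 16 \<le> - t\<^sup>2 / 4 + (b + 2) * (1 + \<bar>t\<bar>)"
    using y2 b by argo
  then show "cmod (exp (- z\<^sup>2 / 2)) * exp ((cmod z)\<^sup>2 / 16) \<le> exp (- t\<^sup>2 / 4 + (b + 2) * (1 + \<bar>t\<bar>))"
    by (simp only: norm_exp_eq_Re exp_add[symmetric] exp_le_cancel_iff)
  have "cmod z \<le> cmod (complex_of_real u) + cmod (complex_of_real u - z)"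
    using norm_triangle_ineq4[of "of_real u" "of_real u - z"] by simp
  then have "cmod z \<le> \<bar>t\<bar> + b + 1" using z by simp
  moreover have "(b + 2) * (1 + \<bar>t\<bar>) = b + 2 + b * \<bar>t\<bar> + 2 * \<bar>t\<bar>" "0 \<le> b * \<bar>t\<bar>"
    using b by (simp_all add: algebra_simps)
  ultimately show "1 + cmod z \<le> (b + 2) * (1 + \<bar>t\<bar>)" using abs_ge_zero[of t] by linarith
qed

context std_moment_dist begin

text \<open>
  For \<open>\<epsilon> = kappa / (1 + |z|)\<close> the exponent \<open>\<Sum> |a\<^sub>i(z)| \<epsilon>\<^sup>i\<close> is at most \<open>|z|\<^sup>2 / 16\<close>, which the Gaussian factor absorbs.
\<close>
definition kappa :: real where
  "kappa = 1 / (16 * ((\<Sum>i=1..m-2. \<bar>cumulant M (i + 2)\<bar> / fact (i + 2)) + 1))"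

lemma kappa: "0 < kappa" "kappa \<le> 1"
  "(\<Sum>i=1..m-2. \<bar>cumulant M (i + 2)\<bar> / fact (i + 2)) * kappa \<le> 1 / 16"
proof -
  let ?G = "\<Sum>i=1..m-2. \<bar>cumulant M (i + 2)\<bar> / fact (i + 2)"
  have G: "0 \<le> ?G" by (intro sum_nonneg) (simp del: fact_Suc)
  show "0 < kappa" "kappa \<le> 1" unfolding kappa_def using G by (auto simp: divide_le_eq del: fact_Suc)
  have "?G * kappa = ?G / (?G + 1) / 16" unfolding kappa_def by simp
  also have "\<dots> \<le> 1 / 16" using G by (intro divide_right_mono) (auto simp: divide_le_eq)
  finally show "?G * kappa \<le> 1 / 16" .
qed

text \<open>With e = kappa / (1 + |z|) one has |z| e <= kappa <= 1, so each summand is at most |z|^2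
  kappa times a cumulant constant.\<close>

lemma edgeworth_coeff_sum_le:
  "(\<Sum>i=1..m-2. cmod (edgeworth_coeff M z i) * (kappa / (1 + cmod z)) ^ i) \<le> (cmod z)\<^sup>2 / 16"
proof -
  let ?e = "kappa / (1 + cmod z)" and ?g = "\<lambda>i. \<bar>cumulant M (i + 2)\<bar> / fact (i + 2)"
  have z1: "0 < 1 + cmod z" by (simp add: add_pos_nonneg)
  have "(\<Sum>i=1..m-2. cmod (edgeworth_coeff M z i) * ?e ^ i) \<le> (\<Sum>i=1..m-2. ?g i * ((cmod z)\<^sup>2 * kappa))"
  proof (rule sum_mono)
    fix i assume i: "i \<in> {1..m-2}"
    have "cmod z * ?e \<le> kappa"
      using kappa(1) z1 by (simp add: divide_le_eq mult.commute)
    then have "(cmod z * ?e) ^ i \<le> kappa ^ i" using kappa(1) z1 by (intro power_mono) auto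
    also have "\<dots> \<le> kappa ^ 1" using kappa i by (intro power_decreasing) auto
    finally have *: "(cmod z * ?e) ^ i \<le> kappa" by simp
    have "cmod (edgeworth_coeff M z i) * ?e ^ i = ?g i * ((cmod z)\<^sup>2 * (cmod z * ?e) ^ i)"
      unfolding edgeworth_coeff_def
      by (simp only: norm_mult norm_divide norm_power norm_of_real norm_ii norm_fact norm_inverse power_mult_distrib power_add mult_1 power_one divide_inverse mult_ac)
    also have "\<dots> \<le> ?g i * ((cmod z)\<^sup>2 * kappa)" by (intro mult_left_mono *) auto
    finally show "cmod (edgeworth_coeff M z i) * ?e ^ i \<le> ?g i * ((cmod z)\<^sup>2 * kappa)" .
  qed
  also have "\<dots> = (cmod z)\<^sup>2 * ((\<Sum>i=1..m-2. ?g i) * kappa)"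
    by (simp add: sum_distrib_right sum_distrib_left mult_ac)
  also have "\<dots> \<le> (cmod z)\<^sup>2 * (1 / 16)" by (intro mult_left_mono kappa) simp
  finally show ?thesis by simp
qed

lemma E_power_eq:
  fixes z :: complex
  assumes n: "0 < n"
  shows "E (z / sqrt (real n)) ^ n =
    exp (- z\<^sup>2 / 2) * exp (\<Sum>i=1..m-2. edgeworth_coeff M z i * of_real (1 / sqrt (real n)) ^ i)"
proof -
  let ?r = "complex_of_real (sqrt (real n))"
  have r: "?r \<noteq> 0" "?r * ?r = of_nat n" using n by (auto simp flip: of_real_mult)
  have "of_nat n * cumulant_poly M m (z / ?r) = (\<Sum>k\<le>m-2. edgeworth_coeff M z k * of_real (1 / sqrt (real n)) ^ k)"
    unfolding cumulant_poly_def sum_split_two using cumulants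
  proof -
    have "of_nat n * (of_real (cumulant M (k + 2)) * (\<i> * (z / ?r)) ^ (k + 2) / fact (k + 2)) =
      edgeworth_coeff M z k * of_real (1 / sqrt (real n)) ^ k" for k
    proof -
      have "(\<i> * (z / ?r)) ^ (k + 2) = (\<i> * z) ^ (k + 2) / ?r ^ (k + 2)"
        by (simp only: times_divide_eq_right power_divide)
      then have "of_nat n * (of_real (cumulant M (k + 2)) * (\<i> * (z / ?r)) ^ (k + 2) / fact (k + 2)) =
        edgeworth_coeff M z k * (?r * ?r / ?r ^ (k + 2))"
        unfolding edgeworth_coeff_def r(2) by (simp only: divide_inverse mult_ac)
      also have "?r * ?r / ?r ^ (k + 2) = of_real (1 / sqrt (real n)) ^ k"
        using r(1) by (simp add: power_divide field_simps)
      finally show ?thesis .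
    qed
    then show "of_nat n * (of_real (cumulant M 0) * (\<i> * (z / ?r)) ^ 0 / fact 0 + of_real (cumulant M 1) * (\<i> * (z / ?r)) ^ 1 / fact 1 +
      (\<Sum>k\<le>m-2. of_real (cumulant M (k + 2)) * (\<i> * (z / ?r)) ^ (k + 2) / fact (k + 2))) =
      (\<Sum>k\<le>m-2. edgeworth_coeff M z k * of_real (1 / sqrt (real n)) ^ k)"
      unfolding cumulants(1,2) by (simp only: of_real_0 mult_zero_left div_0 add_0_left sum_distrib_left)
  qed
  also have "\<dots> = edgeworth_coeff M z 0 + (\<Sum>i=1..m-2. edgeworth_coeff M z i * of_real (1 / sqrt (real n)) ^ i)"
    by (simp add: atMost_atLeast0 sum.atLeast_Suc_atMost)
  also have "edgeworth_coeff M z 0 = - z\<^sup>2 / 2"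
    using cumulants(3) by (simp add: edgeworth_coeff_def power_mult_distrib del: add_2_eq_Suc')
  finally show ?thesis by (simp only: exp_of_nat_mult[symmetric] exp_add)
qed

text \<open>\<open>exp_coeff_remainder\<close> with e = 1 / sqrt n, e0 = kappa / (1 + |z|) and N = m
  - 1; the hypothesis is e <= e0.\<close>

lemma edgeworth_remainder_le:
  assumes n: "0 < n" and z: "(1 + cmod z) / sqrt (real n) \<le> kappa"
  shows "cmod (E (z / sqrt (real n)) ^ n - edgeworth_char M (m - 2) (1 / sqrt (real n)) z) \<le>
    cmod (exp (- z\<^sup>2 / 2)) * exp ((cmod z)\<^sup>2 / 16) * ((1 + cmod z) / (kappa * sqrt (real n))) ^ (m - 1)"
proof -
  let ?e = "1 / sqrt (real n)" and ?dd = "kappa / (1 + cmod z)" and ?a = "edgeworth_coeff M z"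
  have z1: "0 < 1 + cmod z" by (simp add: add_pos_nonneg)
  have mm: "m - 1 = Suc (m - 2)" using m_bounds(3) by simp
  have "cmod (exp (\<Sum>i=1..m-2. ?a i * of_real ?e ^ i) - (\<Sum>j<m-1. exp_coeff (m - 2) ?a j * of_real ?e ^ j)) \<le>
    (?e / ?dd) ^ (m - 1) * exp (\<Sum>i=1..m-2. cmod (?a i) * ?dd ^ i)"
  proof (rule exp_coeff_remainder)
    show "?e \<le> ?dd" using z z1 n by (simp add: field_simps)
  qed (use kappa z1 in auto)
  also have "\<dots> \<le> (?e / ?dd) ^ (m - 1) * exp ((cmod z)\<^sup>2 / 16)"
    using kappa z1 by (intro mult_left_mono exp_le_cancel_iff[THEN iffD2] edgeworth_coeff_sum_le) auto
  also have "?e / ?dd = (1 + cmod z) / (kappa * sqrt (real n))" by (simp add: mult.commute)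
  finally have *: "cmod (exp (\<Sum>i=1..m-2. ?a i * of_real ?e ^ i) - (\<Sum>j<m-1. exp_coeff (m - 2) ?a j * of_real ?e ^ j)) \<le>
    ((1 + cmod z) / (kappa * sqrt (real n))) ^ (m - 1) * exp ((cmod z)\<^sup>2 / 16)" .
  have "E (z / sqrt (real n)) ^ n - edgeworth_char M (m - 2) ?e z = exp (- z\<^sup>2 / 2) *
    (exp (\<Sum>i=1..m-2. ?a i * of_real ?e ^ i) - (\<Sum>j<m-1. exp_coeff (m - 2) ?a j * of_real ?e ^ j))"
    unfolding E_power_eq[OF n] edgeworth_char_def mm lessThan_Suc_atMost by (simp only: right_diff_distrib)
  then show ?thesis using mult_left_mono[OF *, of "cmod (exp (- z\<^sup>2 / 2))"] by (simp only: norm_mult norm_ge_zero mult_ac)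
qed

text \<open>Without any restriction on z: as the evaluation point kappa / (1 + |z|) of the majorant
  is at most 1, all powers up to m - 2 can be divided by the smallest one. This serves the region
  away from the origin.\<close>

lemma edgeworth_char_le:
  assumes n: "0 < n"
  shows "cmod (edgeworth_char M (m - 2) (1 / sqrt (real n)) z) \<le>
    cmod (exp (- z\<^sup>2 / 2)) * exp ((cmod z)\<^sup>2 / 16) * ((1 + cmod z) / kappa) ^ (m - 2)"
proof -
  let ?e = "1 / sqrt (real n)" and ?dd = "kappa / (1 + cmod z)" and ?a = "edgeworth_coeff M z" and ?K = "m - 2"
  let ?r = "\<lambda>j. exp_coeff ?K (\<lambda>i. cmod (?a i)) j"
  have z1: "1 \<le> 1 + cmod z" by simp
  have e0: "0 < ?dd" "?dd \<le> 1"
    using kappa(1) order_trans[OF kappa(2) z1] by (auto simp: add_pos_nonneg)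
  have r0: "0 \<le> ?r j" for j by (rule exp_coeff_nonneg) simp
  have e: "0 \<le> ?e" "?e \<le> 1" using n by auto
  have sums: "(\<lambda>j. ?r j * ?dd ^ j) sums exp (\<Sum>i=1..?K. cmod (?a i) * ?dd ^ i)"
    using exp_coeff_sums[of ?K "\<lambda>i. cmod (?a i) * ?dd ^ i"] unfolding exp_coeff_scale[abs_def] by auto
  have "cmod (\<Sum>j\<le>?K. exp_coeff ?K ?a j * of_real ?e ^ j) \<le> (\<Sum>j\<le>?K. ?r j * ?dd ^ j * (1 / ?dd ^ ?K))"
  proof (rule sum_norm_le)
    fix j assume j: "j \<in> {..?K}"
    have "cmod (exp_coeff ?K ?a j * of_real ?e ^ j) \<le> ?r j * 1"
      unfolding norm_mult norm_power norm_of_real abs_of_nonneg[OF e(1)] using e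
      by (intro mult_mono norm_exp_coeff_le r0) (auto intro!: power_le_one)
    also have "\<dots> \<le> ?r j * (?dd ^ j / ?dd ^ ?K)"
    proof (rule mult_left_mono[OF _ r0])
      have "?dd ^ ?K \<le> ?dd ^ j" using e0 j by (intro power_decreasing) auto
      then show "1 \<le> ?dd ^ j / ?dd ^ ?K" using e0 by (subst le_divide_eq_1_pos) auto
    qed
    finally show "cmod (exp_coeff ?K ?a j * of_real ?e ^ j) \<le> ?r j * ?dd ^ j * (1 / ?dd ^ ?K)" by simp
  qed
  also have "\<dots> = (\<Sum>j\<le>?K. ?r j * ?dd ^ j) * (1 / ?dd ^ ?K)" by (rule sum_distrib_right[symmetric])
  also have "\<dots> \<le> exp ((cmod z)\<^sup>2 / 16) * (1 / ?dd ^ ?K)"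
  proof (rule mult_right_mono)
    have "(\<Sum>j\<le>?K. ?r j * ?dd ^ j) \<le> (\<Sum>j. ?r j * ?dd ^ j)"
      using e0 r0 by (intro sum_le_suminf sums_summable[OF sums]) auto
    also have "\<dots> \<le> exp ((cmod z)\<^sup>2 / 16)"
      using sums edgeworth_coeff_sum_le[of z] by (simp add: sums_iff)
    finally show "(\<Sum>j\<le>?K. ?r j * ?dd ^ j) \<le> exp ((cmod z)\<^sup>2 / 16)" .
  qed (use e0 in auto)
  also have "1 / ?dd ^ ?K = ((1 + cmod z) / kappa) ^ ?K" by (simp add: power_divide)
  finally have "cmod (\<Sum>j\<le>?K. exp_coeff ?K ?a j * of_real ?e ^ j) \<le> exp ((cmod z)\<^sup>2 / 16) * ((1 + cmod z) / kappa) ^ ?K" .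
  from mult_left_mono[OF this, of "cmod (exp (- z\<^sup>2 / 2))"]
  show ?thesis unfolding edgeworth_char_def norm_mult by (simp only: norm_ge_zero mult.assoc)
qed

lemma edgeworth_char_holomorphic: "edgeworth_char M K e holomorphic_on UNIV"
  unfolding edgeworth_char_def[abs_def] exp_coeff_def edgeworth_coeff_def
  by (intro holomorphic_intros) auto

lemma gnorm_edgeworth_char_le:
  assumes d: "0 < d" "d \<le> 1" and n: "0 < n"
  shows "gnorm (std_weight d s 1) J d t (\<lambda>t. edgeworth_char M (m - 2) (1 / sqrt (real n)) (of_real t)) \<le>
    (1 + real J) * (1 / kappa) ^ (m - 2) * exp (real (m - 1) * (real J + 2) * (1 + \<bar>t\<bar>) - t\<^sup>2 / 4)"
proof -
  let ?T = "(real J + 2) * (1 + \<bar>t\<bar>)"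
  have "gnorm (std_weight d s 1) J d t (\<lambda>t. edgeworth_char M (m - 2) (1 / sqrt (real n)) (of_real t)) \<le>
    (1 + real J) * (exp (- t\<^sup>2 / 4 + ?T) * ((1 / kappa) ^ (m - 2) * exp (real (m - 2) * ?T)))"
  proof (rule gnorm_entire_le[OF d _ edgeworth_char_holomorphic])
    fix u :: real and z :: complex assume z: "t \<le> u" "u \<le> t + real J" "cmod (of_real u - z) \<le> 1"
    have "((1 + cmod z) / kappa) ^ (m - 2) \<le> (?T / kappa) ^ (m - 2)"
      using norm_gauss_strip_le(2)[OF z] kappa by (intro power_mono divide_right_mono) auto
    also have "\<dots> = (1 / kappa) ^ (m - 2) * ?T ^ (m - 2)" by (simp add: power_divide)
    also have "\<dots> \<le> (1 / kappa) ^ (m - 2) * exp (real (m - 2) * ?T)"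
      using kappa by (intro mult_left_mono power_le_exp) auto
    finally have "cmod (exp (- z\<^sup>2 / 2)) * exp ((cmod z)\<^sup>2 / 16) * ((1 + cmod z) / kappa) ^ (m - 2)
      \<le> exp (- t\<^sup>2 / 4 + ?T) * ((1 / kappa) ^ (m - 2) * exp (real (m - 2) * ?T))"
      using norm_gauss_strip_le(1)[OF z] kappa by (intro mult_mono) auto
    then show "cmod (edgeworth_char M (m - 2) (1 / sqrt (real n)) z) \<le>
      exp (- t\<^sup>2 / 4 + ?T) * ((1 / kappa) ^ (m - 2) * exp (real (m - 2) * ?T))"
      using edgeworth_char_le[OF n, of z] by linarith
  qed (use s2 in simp)
  also have "\<dots> = (1 + real J) * (1 / kappa) ^ (m - 2) * (exp (- t\<^sup>2 / 4 + ?T) * exp (real (m - 2) * ?T))" by simp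
  also have "exp (- t\<^sup>2 / 4 + ?T) * exp (real (m - 2) * ?T) = exp (real (m - 1) * (real J + 2) * (1 + \<bar>t\<bar>) - t\<^sup>2 / 4)"
  proof -
    have "real (m - 1) = real (m - 2) + 1" using m_bounds(3) by simp
    then show ?thesis unfolding exp_add[symmetric] by (simp add: algebra_simps)
  qed
  finally show ?thesis .
qed

text \<open>The condition on t keeps the unit discs around [t, t + J] inside 1 + |z| <= kappa sqrt
  n, where the series remainder is controlled.\<close>

lemma gnorm_edgeworth_remainder_le:
  assumes d: "0 < d" "d \<le> 1" and n: "0 < n" and t: "\<bar>t\<bar> + real J + 2 \<le> kappa * sqrt (real n)"
  shows "gnorm (std_weight d s 1) J d t (\<lambda>t. E (of_real (t / sqrt (real n))) ^ n - edgeworth_char M (m - 2) (1 / sqrt (real n)) (of_real t)) \<le>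
    (1 + real J) * (1 / kappa) ^ (m - 1) * real n powr (- (real m - 1) / 2) * exp (real m * (real J + 2) * (1 + \<bar>t\<bar>) - t\<^sup>2 / 4)"
proof -
  let ?T = "(real J + 2) * (1 + \<bar>t\<bar>)"
  let ?r = "sqrt (real n)"
  define h where "h z = E (z / complex_of_real ?r) ^ n - edgeworth_char M (m - 2) (1 / ?r) z" for z
  define B where "B = exp (- t\<^sup>2 / 4 + ?T) * ((1 / kappa) ^ (m - 1) * exp (real (m - 1) * ?T) * real n powr (- (real m - 1) / 2))"
  have r: "0 < ?r" using n by simp
  have "gnorm (std_weight d s 1) J d t (\<lambda>t. h (of_real t)) \<le> (1 + real J) * B"
  proof (rule gnorm_entire_le[OF d])
    show "h holomorphic_on UNIV"
      unfolding h_def[abs_def]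
      by (intro holomorphic_intros holomorphic_on_scaled cumulant_poly_holomorphic edgeworth_char_holomorphic)
    fix u :: real and z :: complex assume z: "t \<le> u" "u \<le> t + real J" "cmod (of_real u - z) \<le> 1"
    have "cmod z \<le> cmod (complex_of_real u) + cmod (complex_of_real u - z)"
      using norm_triangle_ineq4[of "of_real u" "of_real u - z"] by simp
    then have "1 + cmod z \<le> kappa * ?r" using z t by simp
    then have "(1 + cmod z) / ?r \<le> kappa" using r by (simp add: divide_le_eq)
    from edgeworth_remainder_le[OF n this]
    have "cmod (h z) \<le> cmod (exp (- z\<^sup>2 / 2)) * exp ((cmod z)\<^sup>2 / 16) * ((1 + cmod z) / (kappa * ?r)) ^ (m - 1)"
      by (simp add: h_def)
    also have "\<dots> \<le> B"
      unfolding B_def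
    proof (rule mult_mono)
      have "((1 + cmod z) / (kappa * ?r)) ^ (m - 1) \<le> (?T / (kappa * ?r)) ^ (m - 1)"
        using norm_gauss_strip_le(2)[OF z] kappa r by (intro power_mono divide_right_mono) auto
      also have "\<dots> = (1 / kappa) ^ (m - 1) * ?T ^ (m - 1) * (1 / ?r ^ (m - 1))"
        by (simp add: power_divide power_mult_distrib)
      also have "1 / ?r ^ (m - 1) = real n powr (- (real m - 1) / 2)"
      proof -
        have "?r ^ (m - 1) = real n powr (real (m - 1) / 2)"
          unfolding powr_half_sqrt_real[OF n, symmetric] by (rule powr_realpow[OF r, symmetric])
        moreover have "real (m - 1) = real m - 1" using m_bounds(3) by simp
        moreover have "- (real m - 1) / 2 = - ((real m - 1) / 2)" by (rule minus_divide_left[symmetric])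
        ultimately show ?thesis by (simp only: powr_minus_divide)
      qed
      also have "(1 / kappa) ^ (m - 1) * ?T ^ (m - 1) * real n powr (- (real m - 1) / 2) \<le>
         (1 / kappa) ^ (m - 1) * exp (real (m - 1) * ?T) * real n powr (- (real m - 1) / 2)"
        using kappa by (intro mult_left_mono mult_right_mono power_le_exp) auto
      finally show "((1 + cmod z) / (kappa * ?r)) ^ (m - 1) \<le> (1 / kappa) ^ (m - 1) * exp (real (m - 1) * ?T) * real n powr (- (real m - 1) / 2)" .
    qed (use norm_gauss_strip_le(1)[OF z] kappa r in auto)
    finally show "cmod (h z) \<le> B" .
  qed (use s2 in simp)
  also have "(1 + real J) * B = (1 + real J) * (1 / kappa) ^ (m - 1) * real n powr (- (real m - 1) / 2) *
     (exp (- t\<^sup>2 / 4 + ?T) * exp (real (m - 1) * ?T))" by (simp only: B_def mult_ac)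
  also have "exp (- t\<^sup>2 / 4 + ?T) * exp (real (m - 1) * ?T) = exp (real m * (real J + 2) * (1 + \<bar>t\<bar>) - t\<^sup>2 / 4)"
  proof -
    have "real (m - 1) = real m - 1" using m_bounds(3) by simp
    then show ?thesis unfolding exp_add[symmetric] by (simp only:) (simp add: algebra_simps)
  qed
  finally show ?thesis by (simp add: h_def)
qed

end

section \<open>The estimates near and away from the origin\<close>

text \<open>The difference of powers is telescoped into n products, each with n - 1 factors of norm
  at most G besides the difference itself.\<close>

lemma (in diff_weight) gnorm_power_diff_le:
  assumes "gnorm v J d t f \<le> G" "gnorm v J d t g \<le> G" "0 < n"
  shows "gnorm v J d t (\<lambda>t. f t ^ n - g t ^ n) \<le> gnorm v J d t (\<lambda>t. f t - g t) * (real n * G ^ (n - 1))"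
proof -
  have G0: "0 \<le> G" using gnorm_nonneg[of d t f] assms(1) by linarith
  have "gnorm v J d t (\<lambda>t. f t ^ n - g t ^ n) \<le> gnorm v J d t (\<lambda>t. f t - g t) * gnorm v J d t (\<lambda>t. \<Sum>i<n. g t ^ (n - Suc i) * f t ^ i)"
    unfolding power_diff_sumr2 by (rule gnorm_mult)
  also have "gnorm v J d t (\<lambda>t. \<Sum>i<n. g t ^ (n - Suc i) * f t ^ i) \<le> (\<Sum>i<n. gnorm v J d t (\<lambda>t. g t ^ (n - Suc i) * f t ^ i))"
    by (rule gnorm_sum) simp
  also have "\<dots> \<le> (\<Sum>i<n. G ^ (n - 1))"
  proof (rule sum_mono)
    fix i assume i: "i \<in> {..<n}"
    have "gnorm v J d t (\<lambda>t. g t ^ (n - Suc i) * f t ^ i) \<le> gnorm v J d t (\<lambda>t. g t ^ (n - Suc i)) * gnorm v J d t (\<lambda>t. f t ^ i)"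
      by (rule gnorm_mult)
    also have "\<dots> \<le> G ^ (n - Suc i) * G ^ i"
      using assms G0 by (intro mult_mono order_trans[OF gnorm_power] power_mono gnorm_nonneg) auto
    also have "\<dots> = G ^ (n - 1)" using i by (simp flip: power_add)
    finally show "gnorm v J d t (\<lambda>t. g t ^ (n - Suc i) * f t ^ i) \<le> G ^ (n - 1)" .
  qed
  finally show ?thesis by (simp add: mult_left_mono gnorm_nonneg)
qed

lemma fdiff_pow_eq_0: "(\<And>i. i \<le> j \<Longrightarrow> f (t + real i * d) = 0) \<Longrightarrow> (fdiff d ^^ j) f t = 0"
proof (induction j arbitrary: t)
  case 0
  from 0[of 0] show ?case by simp
next
  case (Suc j)
  have "(fdiff d ^^ j) f (t + d) = 0"
  proof (rule Suc.IH)
    fix i assume "i \<le> j"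
    with Suc.prems[of "Suc i"] show "f (t + d + real i * d) = 0" by (simp add: algebra_simps)
  qed
  moreover have "(fdiff d ^^ j) f t = 0" by (rule Suc.IH) (use Suc.prems in auto)
  ultimately show ?case by (simp only: fdiff_pow_Suc diff_self)
qed

context std_moment_dist begin

lemma central_estimate:
  obtains C c N where "0 \<le> C" "0 < c" "c \<le> 1"
    "\<And>n t d. N \<le> n \<Longrightarrow> 0 < d \<Longrightarrow> d \<le> 1 \<Longrightarrow> \<bar>t\<bar> \<le> c * sqrt (real n) \<Longrightarrow>
      gnorm (std_weight d s 1) J d t (\<lambda>t. char M (t / sqrt (real n)) ^ n - edgeworth_char M (m - 2) (1 / sqrt (real n)) (of_real t)) \<le>
      C * (real n powr (- (s - 2) / 2) * eta (real J * (1 + \<bar>t\<bar>) / sqrt (real n)) + real n powr (- (real m - 1) / 2))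
        * exp (C * (1 + \<bar>t\<bar>) - t\<^sup>2 / 8)"
proof -
  obtain L c1 where L: "1 \<le> L" and c1: "0 < c1" "c1 \<le> 1"
    and E1: "\<And>z w r. cmod z \<le> r \<Longrightarrow> cmod w \<le> r \<Longrightarrow> r \<le> 1 \<Longrightarrow> cmod (E z - E w) \<le> L * r * cmod (z - w)"
    and E2: "\<And>z. cmod z \<le> 1 \<Longrightarrow> cmod (E z - moment_poly M m z) \<le> L * cmod z ^ Suc m"
    and E3: "\<And>u. \<bar>u\<bar> \<le> c1 \<Longrightarrow> cmod (E (of_real u)) \<le> exp (- u\<^sup>2 / 4)"
    by (rule E_bounds, rule that)
  obtain c2 where c2: "0 < c2" "c2 \<le> 1" and char2: "\<And>u. \<bar>u\<bar> \<le> c2 \<Longrightarrow> cmod (char M u) \<le> exp (- u\<^sup>2 / 4)"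
    by (rule char_near_0, rule that)
  \<comment> \<open>Halved because grid points and unit discs around them may lie J + 2 further out;
    for n >= N this is at most c sqrt n, so everything stays within 2 c sqrt n.\<close>
  define c where "c = min (min c1 c2) kappa / 2"
  have c: "0 < c" "2 * c \<le> c1" "2 * c \<le> c2" "2 * c \<le> kappa" "c \<le> 1"
    unfolding c_def using c1 c2 kappa by auto
  define N where "N = max 2 (nat \<lceil>((real J + 2) / c)\<^sup>2\<rceil>)"
  define D1 where "D1 = real J + 3 * real J * (2 ^ J * mom * (1 + real J))"
  define D2 where "D2 = real J + 3 * real J * (L * (1 + real J))"
  define D where "D = max D1 D2"
  define D3 where "D3 = s * real J + real (Suc m) * (1 + real J)"
  define D4 where "D4 = real m * (real J + 2)"
  define A where "A = (1 + real J) * (2 ^ J + L)"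
  define B where "B = (1 + real J) * (1 / kappa) ^ (m - 1)"
  define C where "C = A + B + D + D3 + D4"
  have D0: "0 \<le> D1" "0 \<le> D2" "0 \<le> D3" "0 \<le> D4" "0 \<le> A" "0 \<le> B"
    unfolding D1_def D2_def D3_def D4_def A_def B_def using L mom_ge_1 s2 kappa(1) by auto
  then have Dp: "0 \<le> D" "D1 \<le> D" "D2 \<le> D" by (auto simp: D_def)
  have C: "0 \<le> C" "A + B \<le> C" "D + D3 \<le> C" "D4 \<le> C" using D0 Dp by (auto simp: C_def)
  show thesis
  proof (rule that[OF C(1) c(1) c(5)])
    fix n :: nat and t d :: real
    assume n: "N \<le> n" and d: "0 < d" "d \<le> 1" and t: "\<bar>t\<bar> \<le> c * sqrt (real n)"
    let ?r = "sqrt (real n)"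
    have n2: "2 \<le> n" using n by (simp add: N_def)
    then have n0: "0 < n" and r: "0 < ?r" "?r * ?r = real n" by auto
    have "((real J + 2) / c)\<^sup>2 \<le> real n" using n unfolding N_def by linarith
    then have "(real J + 2) / c \<le> ?r" by (rule real_le_rsqrt)
    then have Jc: "real J + 2 \<le> c * ?r" using c(1) by (simp add: divide_le_eq mult.commute)
    have tk: "\<bar>t\<bar> + real J + 2 \<le> 2 * c * ?r" using t Jc by simp
    have mono: "2 * c * ?r \<le> x * ?r" if "2 * c \<le> x" for x using that r by (intro mult_right_mono) auto
    have t1: "\<bar>t\<bar> + real J + 1 \<le> ?r" using tk mono[of 1] c1 c(2) by simp
    have grid: "\<bar>(t + real i * d) / ?r\<bar> \<le> 2 * c" if "i \<le> J" for i
    proof -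
      have "0 \<le> real i * d" "real i * d \<le> real J" using mult_mono[of "real i" "real J" d 1] d that by auto
      then have "\<bar>t + real i * d\<bar> \<le> 2 * c * ?r" using tk by linarith
      then show ?thesis using r by (simp add: abs_divide divide_le_eq)
    qed
    have expeq: "exp (- ((t + real i * d) / ?r)\<^sup>2 / 4) = exp (- (t + real i * d)\<^sup>2 / (4 * real n))" for i
      using n0 by (simp add: power_divide)
    interpret diff_weight "std_weight d s 1" J
      by (rule diff_weight_std_weight) (use d s2 in auto)
    let ?p = "\<lambda>t. char M (t / ?r)" and ?q = "\<lambda>t. E (of_real (t / ?r))"
    define G where "G = exp ((- t\<^sup>2 / 4 + D * (1 + \<bar>t\<bar>)) / real n)"
    have "gnorm (std_weight d s 1) J d t ?p \<le> exp ((- t\<^sup>2 / 4 + D1 * (1 + \<bar>t\<bar>)) / real n)"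
      unfolding D1_def
    proof (rule gnorm_factor_le[OF d _ n0])
      show "\<bar>t\<bar> \<le> ?r" using t1 by simp
      show "cmod (?p (t + real i * d)) \<le> exp (- (t + real i * d)\<^sup>2 / (4 * real n))" if "i \<le> J" for i
        unfolding expeq[symmetric] using grid[OF that] c by (intro char2) auto
      show "cmod ((fdiff d ^^ j) ?p (t + real i * d)) \<le> fact j * d powr min (real j) s * (2 ^ J * mom * (1 + real J) * (1 + \<bar>t\<bar>) / real n)"
        if "1 \<le> j" "i + j \<le> J" for i j
        by (rule fdiff_scaled_char_le[OF d n0 that])
    qed (use s2 mom_ge_1 in auto)
    also have "\<dots> \<le> G"
      unfolding G_def using Dp by (simp add: divide_right_mono mult_right_mono)
    finally have p: "gnorm (std_weight d s 1) J d t ?p \<le> G" .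
    have "gnorm (std_weight d s 1) J d t ?q \<le> exp ((- t\<^sup>2 / 4 + D2 * (1 + \<bar>t\<bar>)) / real n)"
      unfolding D2_def
    proof (rule gnorm_factor_le[OF d _ n0])
      show "\<bar>t\<bar> \<le> ?r" using t1 by simp
      show "cmod (?q (t + real i * d)) \<le> exp (- (t + real i * d)\<^sup>2 / (4 * real n))" if "i \<le> J" for i
        unfolding expeq[symmetric] using grid[OF that] c by (intro E3) auto
      show "cmod ((fdiff d ^^ j) ?q (t + real i * d)) \<le> fact j * d powr min (real j) s * (L * (1 + real J) * (1 + \<bar>t\<bar>) / real n)"
        if "1 \<le> j" "i + j \<le> J" for i j
        by (rule fdiff_scaled_E_le[OF L E1 d n0 t1 that])
    qed (use s2 L in auto)
    also have "\<dots> \<le> G"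
      unfolding G_def using Dp by (simp add: divide_right_mono mult_right_mono)
    finally have q: "gnorm (std_weight d s 1) J d t ?q \<le> G" .
    have Gn: "G ^ (n - 1) \<le> exp (D * (1 + \<bar>t\<bar>) - t\<^sup>2 / 8)"
    proof -
      \<comment> \<open>The product has n - 1 factors G whose exponents are divided by n. For n >= 2
        at least half of t^2/4 survives, hence the t^2/8.\<close>
      have f: "1 / 2 \<le> real (n - 1) / real n" "real (n - 1) / real n \<le> 1" using n2 by (auto simp: field_simps of_nat_diff)
      have "real (n - 1) * ((- t\<^sup>2 / 4 + D * (1 + \<bar>t\<bar>)) / real n) =
        real (n - 1) / real n * (D * (1 + \<bar>t\<bar>)) - real (n - 1) / real n * (t\<^sup>2 / 4)"
        by (simp add: add_divide_distrib diff_divide_distrib algebra_simps)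
      also have "\<dots> \<le> 1 * (D * (1 + \<bar>t\<bar>)) - 1 / 2 * (t\<^sup>2 / 4)"
        by (intro diff_mono mult_right_mono f) (use Dp(1) in auto)
      finally show ?thesis unfolding G_def exp_of_nat_mult[symmetric] by simp
    qed
    let ?eta = "eta (real J * (1 + \<bar>t\<bar>) / ?r)"
    let ?X = "real n powr (- (s - 2) / 2) * ?eta" and ?Y = "real n powr (- (real m - 1) / 2)"
    let ?W = "exp (C * (1 + \<bar>t\<bar>) - t\<^sup>2 / 8)"
    have XY: "0 \<le> ?X" "0 \<le> ?Y" by (auto simp: eta_nonneg)
    have "gnorm (std_weight d s 1) J d t (\<lambda>t. ?p t ^ n - ?q t ^ n) \<le>
      gnorm (std_weight d s 1) J d t (\<lambda>t. ?p t - ?q t) * (real n * G ^ (n - 1))"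
      by (rule gnorm_power_diff_le[OF p q n0])
    also have "\<dots> \<le> (A * (real n powr (- s / 2) * ?eta + real n powr (- real (Suc m) / 2)) * exp (D3 * (1 + \<bar>t\<bar>)))
       * (real n * exp (D * (1 + \<bar>t\<bar>) - t\<^sup>2 / 8))"
      unfolding A_def D3_def using Gn L
      by (intro mult_mono gnorm_remainder_le[OF L E2 d n0 t1] mult_left_mono) (auto simp: G_def eta_nonneg)
    also have "\<dots> = A * (?X + ?Y) * (exp (D3 * (1 + \<bar>t\<bar>)) * exp (D * (1 + \<bar>t\<bar>) - t\<^sup>2 / 8))"
    proof -
      \<comment> \<open>The n telescoped products turn n^(-s/2) into n^(-(s-2)/2) and n^(-(m+1)/2)
        into n^(-(m-1)/2).\<close>
      have nn: "real n * real n powr a = real n powr (1 + a)" for a using n0 by (simp add: powr_add)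
      have e: "1 + - s / 2 = - (s - 2) / 2" "1 + - real (Suc m) / 2 = - (real m - 1) / 2"
        by (simp_all add: field_simps)
      have "real n * (real n powr (- s / 2) * ?eta + real n powr (- real (Suc m) / 2)) =
        (real n * real n powr (- s / 2)) * ?eta + real n * real n powr (- real (Suc m) / 2)"
        by (simp only: distrib_left mult.assoc)
      also have "\<dots> = ?X + ?Y" unfolding nn e ..
      finally have *: "real n * (real n powr (- s / 2) * ?eta + real n powr (- real (Suc m) / 2)) = ?X + ?Y" .
      have "A * x * w1 * (real n * w2) = A * (real n * x) * (w1 * w2)" for x w1 w2 by simp
      then show ?thesis unfolding *[symmetric] .
    qed
    also have "exp (D3 * (1 + \<bar>t\<bar>)) * exp (D * (1 + \<bar>t\<bar>) - t\<^sup>2 / 8) = exp ((D + D3) * (1 + \<bar>t\<bar>) - t\<^sup>2 / 8)"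
      by (simp add: algebra_simps flip: exp_add)
    also have "A * (?X + ?Y) * \<dots> \<le> A * (?X + ?Y) * ?W"
      using XY D0 C by (intro mult_left_mono) (auto simp: mult_right_mono)
    finally have 1: "gnorm (std_weight d s 1) J d t (\<lambda>t. ?p t ^ n - ?q t ^ n) \<le> A * (?X + ?Y) * ?W" .
    let ?g = "\<lambda>t. edgeworth_char M (m - 2) (1 / ?r) (of_real t)"
    have "\<bar>t\<bar> + real J + 2 \<le> kappa * ?r" using tk mono[OF c(4)] by simp
    from gnorm_edgeworth_remainder_le[OF d n0 this]
    have "gnorm (std_weight d s 1) J d t (\<lambda>t. ?q t ^ n - ?g t) \<le> B * ?Y * exp (D4 * (1 + \<bar>t\<bar>) - t\<^sup>2 / 4)"
      by (simp only: B_def D4_def)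
    also have "\<dots> \<le> B * ?Y * ?W"
    proof -
      have "D4 * (1 + \<bar>t\<bar>) \<le> C * (1 + \<bar>t\<bar>)" using C(4) by (intro mult_right_mono) auto
      moreover have "t\<^sup>2 / 8 \<le> t\<^sup>2 / 4" by simp
      ultimately show ?thesis using XY D0 by (intro mult_left_mono) (auto intro: diff_mono)
    qed
    also have "\<dots> \<le> B * (?X + ?Y) * ?W" using XY D0 by (intro mult_left_mono mult_right_mono) auto
    finally have "gnorm (std_weight d s 1) J d t (\<lambda>t. ?p t ^ n - ?q t ^ n) + gnorm (std_weight d s 1) J d t (\<lambda>t. ?q t ^ n - ?g t)
       \<le> A * (?X + ?Y) * ?W + B * (?X + ?Y) * ?W" using 1 by (intro add_mono)
    also have "\<dots> = (A + B) * (?X + ?Y) * ?W" by (simp only: distrib_right)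
    also have "\<dots> \<le> C * (?X + ?Y) * ?W" using XY C by (intro mult_right_mono) auto
    finally show "gnorm (std_weight d s 1) J d t (\<lambda>t. ?p t ^ n - ?g t) \<le> C * (?X + ?Y) * ?W"
      using gnorm_add[of d t "\<lambda>t. ?p t ^ n - ?q t ^ n" "\<lambda>t. ?q t ^ n - ?g t"] by simp
  qed
qed

text \<open>
  The weight with \<open>y = a / n\<close> makes the norm of \<open>f(\<cdot>/\<surd>n)\<close> at most \<open>a (1 + O(1/n))\<close>, so that its \<open>n\<close>-th power
  is of order \<open>a\<^sup>n\<close>; passing back to the plain difference costs only the factor \<open>y\<^bsup>-j\<^esup>\<close>.
\<close>
lemma outer_power_estimate:
  assumes d: "0 < d" "d \<le> 1" and n: "J + q \<le> n" "0 < q" and \<theta>: "0 < \<theta>" "\<theta> < 1"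
    and bd: "\<And>i. i \<le> J \<Longrightarrow> cmod (char M ((t + real i * d) / sqrt (real n))) \<le> \<theta>" and j: "j \<le> J"
  shows "cmod ((fdiff d ^^ j) (\<lambda>t. char M (t / sqrt (real n)) ^ n) t) \<le> fact j * d powr min (real j) s *
     (exp (real J * (2 ^ J * mom)) * real n ^ J * \<theta> ^ (n - (J + q)) *
       (\<Sum>i\<le>J. cmod (char M ((t + real i * d) / sqrt (real n))) ^ q))"
proof -
  let ?r = "sqrt (real n)"
  let ?p = "\<lambda>t. char M (t / ?r)"
  define S where "S = (\<lambda>i. cmod (?p (t + real i * d))) ` {..J}"
  define a where "a = Max S"
  define B where "B = 2 ^ J * mom"
  have n0: "0 < n" using n by simp
  then have r: "1 \<le> ?r" by simp
  have S: "finite S" "S \<noteq> {}" by (auto simp: S_def)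
  have aS: "a \<in> S" unfolding a_def by (rule Max_in[OF S])
  have a: "cmod (?p (t + real i * d)) \<le> a" if "i \<le> J" for i
    unfolding a_def using that by (intro Max_ge S) (auto simp: S_def)
  have a\<theta>: "0 \<le> a" "a \<le> \<theta>" using aS bd by (auto simp: S_def)
  obtain i0 where i0: "i0 \<le> J" "a = cmod (?p (t + real i0 * d))" using aS by (auto simp: S_def)
  have B0: "0 \<le> B" using mom_ge_1 by (simp add: B_def)
  have sumq: "a ^ q \<le> (\<Sum>i\<le>J. cmod (?p (t + real i * d)) ^ q)"
    unfolding i0(2) by (rule member_le_sum) (use i0(1) in auto)
  show ?thesis
  \<comment> \<open>For a = 0 the discount a / n would vanish, but then f is 0 at all grid
    points.\<close>
  proof (cases "a = 0")
    case True
    have "(fdiff d ^^ j) (\<lambda>t. ?p t ^ n) t = 0"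
      by (rule fdiff_pow_eq_0) (use a True n0 j in \<open>fastforce simp: power_0_left\<close>)
    then show ?thesis using \<theta> by (auto intro!: mult_nonneg_nonneg sum_nonneg)
  next
    case False
    then have a0: "0 < a" using a\<theta> by simp
    define y where "y = a / real n"
    have y: "0 < y" "y \<le> 1" using a0 a\<theta> \<theta> n0 by (auto simp: y_def divide_le_eq)
    interpret diff_weight "std_weight d s y" J
      by (rule diff_weight_std_weight) (use d s2 y in auto)
    have "gnorm (std_weight d s y) J d t ?p \<le> a + real J * (B * y)"
    proof (rule gnorm_std_weight_le)
      fix i j assume ij: "1 \<le> j" "i + j \<le> J"
      have "cmod ((fdiff d ^^ j) ?p (t + real i * d)) = cmod ((fdiff (d / ?r) ^^ j) (char M) ((t + real i * d) / ?r))"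
        by (simp only: fdiff_pow_scale)
      also have "\<dots> \<le> 2 ^ j * (d / ?r) powr min (real j) s * mom" by (rule fdiff_char_le) (use ij d r in auto)
      also have "\<dots> \<le> 2 ^ J * d powr min (real j) s * mom"
        using ij d r s2 mom_ge_1 by (intro mult_right_mono mult_mono powr_mono2 power_increasing) (auto simp: divide_le_eq_1_pos divide_le_eq mult_le_cancel_left1)
      also have "\<dots> = 1 * (d powr min (real j) s * B)" by (simp add: B_def)
      also have "\<dots> \<le> fact j * (d powr min (real j) s * B)" using B0 by (intro mult_right_mono) auto
      finally show "cmod ((fdiff d ^^ j) ?p (t + real i * d)) \<le> fact j * d powr min (real j) s * B" by (simp add: mult.assoc)
    qed (use d y s2 a0 B0 a in auto)
    also have "\<dots> = a * (1 + real J * B / real n)" by (simp add: y_def algebra_simps)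
    finally have g1: "gnorm (std_weight d s y) J d t ?p \<le> a * (1 + real J * B / real n)" .
    have "gnorm (std_weight d s y) J d t (\<lambda>t. ?p t ^ n) \<le> gnorm (std_weight d s y) J d t ?p ^ n" by (rule gnorm_power)
    also have "\<dots> \<le> (a * (1 + real J * B / real n)) ^ n" by (intro power_mono g1 gnorm_nonneg)
    also have "\<dots> = a ^ n * (1 + real J * B / real n) ^ n" by (rule power_mult_distrib)
    also have "\<dots> \<le> a ^ n * exp (real J * B / real n) ^ n"
      using a0 B0 by (intro mult_left_mono power_mono) (auto simp: exp_ge_add_one_self)
    also have "exp (real J * B / real n) ^ n = exp (real J * B)"
      using n0 by (simp flip: exp_of_nat_mult)
    finally have g: "gnorm (std_weight d s y) J d t (\<lambda>t. ?p t ^ n) \<le> a ^ n * exp (real J * B)" .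
    have "cmod ((fdiff d ^^ j) (\<lambda>t. ?p t ^ n) (t + real 0 * d)) \<le> std_weight d s y j * gnorm (std_weight d s y) J d t (\<lambda>t. ?p t ^ n)"
      by (rule norm_fdiff_le_gnorm) (use j in simp)
    also have "\<dots> \<le> std_weight d s y j * (a ^ n * exp (real J * B))"
      using v_pos[of j] by (intro mult_left_mono g) simp
    also have "\<dots> = fact j * d powr min (real j) s * (exp (real J * B) * (a ^ n / y ^ j))"
      by (simp add: std_weight_def)
    also have "\<dots> \<le> fact j * d powr min (real j) s * (exp (real J * B) * (real n ^ J * (\<theta> ^ (n - (J + q)) * a ^ q)))"
    proof (intro mult_left_mono)
      \<comment> \<open>Of the n factors a, at most J are spent on y^(-j), q are kept to make the
        bound integrable in t, and the other n - (J + q) give geometric decay.\<close>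
      have "a ^ n / y ^ j = real n ^ j * a ^ (n - j)"
        using a0 n0 n j by (simp add: y_def power_divide power_diff)
      also have "\<dots> \<le> real n ^ J * a ^ (n - J)"
        using a0 a\<theta> \<theta> n0 j by (intro mult_mono power_increasing power_decreasing) auto
      also have "n - J = (n - (J + q)) + q" using n by simp
      also have "a ^ ((n - (J + q)) + q) = a ^ (n - (J + q)) * a ^ q" by (rule power_add)
      also have "real n ^ J * (a ^ (n - (J + q)) * a ^ q) \<le> real n ^ J * (\<theta> ^ (n - (J + q)) * a ^ q)"
        using a0 a\<theta> by (intro mult_left_mono mult_right_mono power_mono) auto
      finally show "a ^ n / y ^ j \<le> real n ^ J * (\<theta> ^ (n - (J + q)) * a ^ q)" .
    qed (use d in auto)
    also have "\<dots> \<le> fact j * d powr min (real j) s * (exp (real J * B) * (real n ^ J * (\<theta> ^ (n - (J + q)) *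
         (\<Sum>i\<le>J. cmod (?p (t + real i * d)) ^ q))))"
      using \<theta> by (intro mult_left_mono sumq) auto
    finally show ?thesis by (simp add: B_def mult.assoc)
  qed
qed

end

section \<open>The Fourier transform of the error\<close>

lemma integrable_gauss_tail: "integrable lborel (\<lambda>t::real. exp (C * (1 + \<bar>t\<bar>) - t\<^sup>2 / 8))"
proof (rule Bochner_Integration.integrable_bound)
  have "integrable lborel (\<lambda>t. exp (C + 4 * C\<^sup>2) * (sqrt (2 * pi * (sqrt 8)\<^sup>2) * normal_density 0 (sqrt 8) t))"
    by (intro integrable_mult_right integrable_normal_density) simp
  also have "(\<lambda>t. exp (C + 4 * C\<^sup>2) * (sqrt (2 * pi * (sqrt 8)\<^sup>2) * normal_density 0 (sqrt 8) t)) = (\<lambda>t. exp (C + 4 * C\<^sup>2) * exp (- t\<^sup>2 / 16))"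
    by (simp add: normal_density_def fun_eq_iff)
  finally show "integrable lborel (\<lambda>t::real. exp (C + 4 * C\<^sup>2) * exp (- t\<^sup>2 / 16))" .
  show "AE t in lborel. norm (exp (C * (1 + \<bar>t\<bar>) - t\<^sup>2 / 8)) \<le> norm (exp (C + 4 * C\<^sup>2) * exp (- t\<^sup>2 / 16))"
  proof (rule AE_I2)
    fix t :: real
    \<comment> \<open>Completing the square: half of t^2/8 dominates C |t| up to the constant 4
      C^2.\<close>
    have "0 \<le> (\<bar>t\<bar> / 4 - 2 * C)\<^sup>2" by simp
    also have "(\<bar>t\<bar> / 4 - 2 * C)\<^sup>2 = t\<^sup>2 / 16 - C * \<bar>t\<bar> + 4 * C\<^sup>2"
      by (simp add: power2_diff power_divide power_mult_distrib)
    finally have "C * (1 + \<bar>t\<bar>) - t\<^sup>2 / 8 \<le> C + 4 * C\<^sup>2 + - t\<^sup>2 / 16" by (simp add: algebra_simps)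
    then show "norm (exp (C * (1 + \<bar>t\<bar>) - t\<^sup>2 / 8)) \<le> norm (exp (C + 4 * C\<^sup>2) * exp (- t\<^sup>2 / 16))"
      by (simp flip: exp_add)
  qed
qed simp

lemma powr_times_exp_tendsto_0: "0 < c \<Longrightarrow> (\<lambda>n. real n powr a * exp (- c * real n)) \<longlonglongrightarrow> 0"
  by real_asymp

lemma powr_times_power_tendsto_0:
  assumes "0 < \<theta>" "\<theta> < 1"
  shows "(\<lambda>n. real n powr a * \<theta> ^ (n - k)) \<longlonglongrightarrow> 0"
proof -
  have "(\<lambda>n. (real n powr a * exp (- (- ln \<theta>) * real n)) / \<theta> ^ k) \<longlonglongrightarrow> 0 / \<theta> ^ k"
    using assms by (intro tendsto_divide powr_times_exp_tendsto_0 tendsto_const) (auto simp: ln_less_zero)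
  then have "(\<lambda>n. (real n powr a * exp (- (- ln \<theta>) * real n)) / \<theta> ^ k) \<longlonglongrightarrow> 0" by simp
  then show ?thesis
  proof (rule Lim_transform_eventually)
    show "\<forall>\<^sub>F n in sequentially. real n powr a * exp (- (- ln \<theta>) * real n) / \<theta> ^ k = real n powr a * \<theta> ^ (n - k)"
      using eventually_ge_at_top[of k]
    proof eventually_elim
      case (elim n)
      have "exp (- (- ln \<theta>) * real n) = \<theta> ^ n"
        using assms exp_of_nat_mult[of n "ln \<theta>"] by (simp add: mult.commute)
      then show ?case using elim assms by (simp add: power_diff)
    qed
  qed
qed

context std_moment_dist begin

lemma eta_measurable [measurable]: "eta \<in> borel_measurable borel"
  unfolding eta_def[abs_def] by measurable

text \<open>For fixed t the argument of \<open>eta\<close> tends to 0, and \<open>eta\<close> is at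
  most \<open>mom\<close>, so a multiple of the Gaussian weight is a majorant.\<close>

lemma eta_integral_tendsto_0:
  "(\<lambda>n. \<integral>t. eta (real J * (1 + \<bar>t\<bar>) / sqrt (real n)) * exp (C * (1 + \<bar>t\<bar>) - t\<^sup>2 / 8) \<partial>lborel) \<longlonglongrightarrow> 0"
proof -
  have "(\<lambda>n. \<integral>t. eta (real J * (1 + \<bar>t\<bar>) / sqrt (real n)) * exp (C * (1 + \<bar>t\<bar>) - t\<^sup>2 / 8) \<partial>lborel) \<longlonglongrightarrow> (\<integral>t. 0 \<partial>(lborel::real measure))"
  proof (rule integral_dominated_convergence[where w = "\<lambda>t. mom * exp (C * (1 + \<bar>t\<bar>) - t\<^sup>2 / 8)"])
    show "integrable lborel (\<lambda>t. mom * exp (C * (1 + \<bar>t\<bar>) - t\<^sup>2 / 8))"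
      by (intro integrable_mult_right integrable_gauss_tail)
    show "AE t in lborel. (\<lambda>n. eta (real J * (1 + \<bar>t\<bar>) / sqrt (real n)) * exp (C * (1 + \<bar>t\<bar>) - t\<^sup>2 / 8)) \<longlonglongrightarrow> 0"
    proof (rule AE_I2)
      fix t :: real
      have "(\<lambda>n. real J * (1 + \<bar>t\<bar>) / sqrt (real n)) \<longlonglongrightarrow> 0"
        by real_asymp
      then have "(\<lambda>n. eta (real J * (1 + \<bar>t\<bar>) / sqrt (real n))) \<longlonglongrightarrow> 0"
        by (rule eta_tendsto_0) simp
      from tendsto_mult_left_zero[OF this]
      show "(\<lambda>n. eta (real J * (1 + \<bar>t\<bar>) / sqrt (real n)) * exp (C * (1 + \<bar>t\<bar>) - t\<^sup>2 / 8)) \<longlonglongrightarrow> 0" .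
    qed
    show "AE t in lborel. norm (eta (real J * (1 + \<bar>t\<bar>) / sqrt (real n)) * exp (C * (1 + \<bar>t\<bar>) - t\<^sup>2 / 8)) \<le> mom * exp (C * (1 + \<bar>t\<bar>) - t\<^sup>2 / 8)" for n
      by (intro AE_I2) (simp add: abs_mult eta_nonneg eta_le_mom)
  qed auto
  then show ?thesis by simp
qed

definition fourier_error :: "nat \<Rightarrow> real \<Rightarrow> complex" where
  "fourier_error n t = char M (t / sqrt (real n)) ^ n - edgeworth_char M (m - 2) (1 / sqrt (real n)) (of_real t)"

lemma integrable_scaled_char_power:
  assumes int: "integrable lborel (\<lambda>t. cmod (char M t) ^ q)" and n: "q \<le> n" "0 < n"
  shows "integrable lborel (\<lambda>t. char M (t / sqrt (real n)) ^ n)"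
proof (rule Bochner_Integration.integrable_bound)
  show "integrable lborel (\<lambda>t. cmod (char M (0 + (1 / sqrt (real n)) * t)) ^ q)"
    by (rule lborel_integrable_real_affine[OF int]) (use n in simp)
  show "AE t in lborel. norm (char M (t / sqrt (real n)) ^ n) \<le> norm (cmod (char M (0 + (1 / sqrt (real n)) * t)) ^ q)"
    using n(1) by (intro AE_I2) (simp add: norm_power power_decreasing cmod_char_le_1)
qed measurable

lemma integrable_fourier_error:
  assumes int: "integrable lborel (\<lambda>t. cmod (char M t) ^ q)" and n: "q \<le> n" "0 < n"
  shows "integrable lborel (fourier_error n)"
  unfolding fourier_error_def[abs_def]
  by (intro Bochner_Integration.integrable_diff integrable_scaled_char_power[OF int n] integrable_edgeworth_char)

lemma fourier_error_pointwise:
  assumes int: "integrable lborel (\<lambda>t. cmod (char M t) ^ q)" and q: "0 < q"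
  obtains C c \<theta> N where "0 \<le> C" "0 < c" "0 < \<theta>" "\<theta> < 1" "q \<le> N"
    "\<And>n t d j. N \<le> n \<Longrightarrow> 0 < d \<Longrightarrow> d \<le> 1 \<Longrightarrow> j \<le> J \<Longrightarrow>
      cmod ((fdiff d ^^ j) (fourier_error n) t) \<le> fact j * d powr min (real j) s *
       (C * (real n powr (- (s - 2) / 2) * eta (real J * (1 + \<bar>t\<bar>) / sqrt (real n)) + real n powr (- (real m - 1) / 2) + exp (- c * real n))
        * exp (C * (1 + \<bar>t\<bar>) - t\<^sup>2 / 8)
        + C * (real n ^ J * \<theta> ^ (n - (J + q)) * (\<Sum>i\<le>J. cmod (char M ((t + real i * d) / sqrt (real n))) ^ q)))"
proof -
  obtain C1 c N1 where C1: "0 \<le> C1" and c: "0 < c" "c \<le> 1" and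
    central: "\<And>n t d. N1 \<le> n \<Longrightarrow> 0 < d \<Longrightarrow> d \<le> 1 \<Longrightarrow> \<bar>t\<bar> \<le> c * sqrt (real n) \<Longrightarrow>
      gnorm (std_weight d s 1) J d t (\<lambda>t. char M (t / sqrt (real n)) ^ n - edgeworth_char M (m - 2) (1 / sqrt (real n)) (of_real t)) \<le>
      C1 * (real n powr (- (s - 2) / 2) * eta (real J * (1 + \<bar>t\<bar>) / sqrt (real n)) + real n powr (- (real m - 1) / 2))
        * exp (C1 * (1 + \<bar>t\<bar>) - t\<^sup>2 / 8)"
    by (rule central_estimate, rule that)
  \<comment> \<open>The threshold is c / 2 because grid points started at |t| > c sqrt n can come
    closer to 0 by J, which is at most (c / 2) sqrt n for n >= N.\<close>
  obtain \<theta> where \<theta>: "\<theta> < 1" "0 < \<theta>" "\<And>t. c / 2 \<le> \<bar>t\<bar> \<Longrightarrow> cmod (char M t) \<le> \<theta>"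
    using char_bounded_away[OF int_1 int q, of "c / 2"] c by auto
  define Cg where "Cg = (1 + real J) * (1 / kappa) ^ (m - 2)"
  define K where "K = real (m - 1) * (real J + 2)"
  define Ce where "Ce = exp (real J * (2 ^ J * mom))"
  define C where "C = C1 + Cg + K + Ce"
  have pos: "0 \<le> Cg" "0 \<le> K" "0 \<le> Ce" using kappa(1) by (auto simp: Cg_def K_def Ce_def)
  have C: "0 \<le> C" "C1 \<le> C" "Cg \<le> C" "K \<le> C" "Ce \<le> C" using C1 pos by (auto simp: C_def)
  define N where "N = max (max N1 (J + q)) (nat \<lceil>(2 * real J / c)\<^sup>2\<rceil>)"
  have cc: "0 < c\<^sup>2 / 8" using c by simp
  show thesis
  proof (rule that[OF C(1) cc \<theta>(2,1)])
    show "q \<le> N" by (simp add: N_def)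
    fix n :: nat and t d :: real and j
    assume n: "N \<le> n" and d: "0 < d" "d \<le> 1" and j: "j \<le> J"
    let ?r = "sqrt (real n)"
    let ?X = "real n powr (- (s - 2) / 2) * eta (real J * (1 + \<bar>t\<bar>) / ?r)" and ?Y = "real n powr (- (real m - 1) / 2)"
    let ?Z = "exp (- (c\<^sup>2 / 8) * real n)" and ?W = "exp (C * (1 + \<bar>t\<bar>) - t\<^sup>2 / 8)"
    let ?V = "real n ^ J * \<theta> ^ (n - (J + q)) * (\<Sum>i\<le>J. cmod (char M ((t + real i * d) / ?r)) ^ q)"
    have nn: "N1 \<le> n" "J + q \<le> n" using n by (auto simp: N_def)
    have n0: "0 < n" using nn q by simp
    then have r: "0 < ?r" by simp
    have "(2 * real J / c)\<^sup>2 \<le> real n" using n unfolding N_def by linarith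
    then have "2 * real J / c \<le> ?r" by (rule real_le_rsqrt)
    then have Jc: "real J \<le> c / 2 * ?r" using c by (simp add: divide_le_eq mult.commute)
    have XYZ: "0 \<le> ?X" "0 \<le> ?Y" "0 \<le> ?Z" "0 \<le> ?V"
      using \<theta> by (auto simp: eta_nonneg intro!: mult_nonneg_nonneg sum_nonneg)
    have w: "0 \<le> fact j * d powr min (real j) s" by simp
    interpret diff_weight "std_weight d s 1" J
      by (rule diff_weight_std_weight) (use d s2 in auto)
    have fe: "fourier_error n = (\<lambda>t. char M (t / ?r) ^ n - edgeworth_char M (m - 2) (1 / ?r) (of_real t))"
      by (simp add: fourier_error_def fun_eq_iff)
    show "cmod ((fdiff d ^^ j) (fourier_error n) t) \<le> fact j * d powr min (real j) s *
       (C * (?X + ?Y + ?Z) * ?W + C * ?V)"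
    proof (cases "\<bar>t\<bar> \<le> c * ?r")
      case True
      have "cmod ((fdiff d ^^ j) (fourier_error n) (t + real 0 * d)) \<le> std_weight d s 1 j * gnorm (std_weight d s 1) J d t (fourier_error n)"
        by (rule norm_fdiff_le_gnorm) (use j in simp)
      also have "\<dots> \<le> std_weight d s 1 j * (C1 * (?X + ?Y) * exp (C1 * (1 + \<bar>t\<bar>) - t\<^sup>2 / 8))"
        unfolding fe using v_pos[of j] by (intro mult_left_mono central[OF nn(1) d True]) simp
      also have "\<dots> \<le> std_weight d s 1 j * (C * (?X + ?Y + ?Z) * ?W)"
        using v_pos[of j] C XYZ C1 by (intro mult_left_mono mult_mono) (auto simp: mult_right_mono)
      also have "\<dots> \<le> std_weight d s 1 j * (C * (?X + ?Y + ?Z) * ?W + C * ?V)"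
        using v_pos[of j] C XYZ by (intro mult_left_mono) (auto intro!: mult_nonneg_nonneg)
      finally show ?thesis by (simp add: std_weight_def)
    next
      case False
      then have t: "c * ?r < \<bar>t\<bar>" by simp
      have grid: "cmod (char M ((t + real i * d) / ?r)) \<le> \<theta>" if "i \<le> J" for i
      proof (rule \<theta>(3))
        have "0 \<le> real i * d" "real i * d \<le> real J" using mult_mono[of "real i" "real J" d 1] d that by auto
        then have "c / 2 * ?r \<le> \<bar>t + real i * d\<bar>" using t Jc by linarith
        then show "c / 2 \<le> \<bar>(t + real i * d) / ?r\<bar>" using r by (simp add: abs_divide le_divide_eq)
      qed
      have 1: "cmod ((fdiff d ^^ j) (\<lambda>t. char M (t / ?r) ^ n) t) \<le> fact j * d powr min (real j) s * (Ce * ?V)"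
        using outer_power_estimate[OF d nn(2) q \<theta>(2,1) grid j] by (simp add: Ce_def mult.assoc)
      let ?g = "\<lambda>t. edgeworth_char M (m - 2) (1 / ?r) (of_real t)"
      have "cmod ((fdiff d ^^ j) ?g (t + real 0 * d)) \<le> std_weight d s 1 j * gnorm (std_weight d s 1) J d t ?g"
        by (rule norm_fdiff_le_gnorm) (use j in simp)
      also have "\<dots> \<le> std_weight d s 1 j * (Cg * exp (K * (1 + \<bar>t\<bar>) - t\<^sup>2 / 4))"
        unfolding Cg_def K_def using v_pos[of j] by (intro mult_left_mono gnorm_edgeworth_char_le d n0) simp
      also have "\<dots> \<le> std_weight d s 1 j * (C * (?Z * ?W))"
      \<comment> \<open>Since |t| > c sqrt n, half of t^2/4 pays for the factor exp(-c^2 n / 8); the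
        other half remains as a Gaussian.\<close>
      proof (rule mult_left_mono)
        have "(c * ?r)\<^sup>2 \<le> \<bar>t\<bar>\<^sup>2" using t c r by (intro power_mono) auto
        then have "c\<^sup>2 * real n \<le> t\<^sup>2" by (simp add: power_mult_distrib)
        moreover have "K * (1 + \<bar>t\<bar>) \<le> C * (1 + \<bar>t\<bar>)" using C by (intro mult_right_mono) auto
        ultimately have "K * (1 + \<bar>t\<bar>) - t\<^sup>2 / 4 \<le> - (c\<^sup>2 / 8) * real n + (C * (1 + \<bar>t\<bar>) - t\<^sup>2 / 8)" by simp
        then have "exp (K * (1 + \<bar>t\<bar>) - t\<^sup>2 / 4) \<le> ?Z * ?W" by (simp flip: exp_add)
        then show "Cg * exp (K * (1 + \<bar>t\<bar>) - t\<^sup>2 / 4) \<le> C * (?Z * ?W)"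
          using C pos by (intro mult_mono) auto
      qed (use v_pos[of j] in simp)
      finally have 2: "cmod ((fdiff d ^^ j) ?g t) \<le> fact j * d powr min (real j) s * (C * (?Z * ?W))"
        by (simp add: std_weight_def)
      have "cmod ((fdiff d ^^ j) (fourier_error n) t) \<le> cmod ((fdiff d ^^ j) (\<lambda>t. char M (t / ?r) ^ n) t) + cmod ((fdiff d ^^ j) ?g t)"
        unfolding fe fdiff_pow_diff by (rule norm_triangle_ineq4)
      also have "\<dots> \<le> fact j * d powr min (real j) s * (Ce * ?V) + fact j * d powr min (real j) s * (C * (?Z * ?W))"
        by (rule add_mono[OF 1 2])
      also have "\<dots> = fact j * d powr min (real j) s * (Ce * ?V + C * (?Z * ?W))" by (simp only: distrib_left)
      also have "\<dots> \<le> fact j * d powr min (real j) s * (C * ?V + C * ((?X + ?Y + ?Z) * ?W))"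
        using w C XYZ by (intro mult_left_mono[OF _ w] add_mono mult_right_mono mult_left_mono) auto
      finally show ?thesis by (simp only: mult.assoc add.commute)
    qed
  qed
qed

lemma fourier_error_integral:
  assumes int: "integrable lborel (\<lambda>t. cmod (char M t) ^ q)" and q: "0 < q"
  obtains \<beta> N where "\<beta> \<longlonglongrightarrow> 0" "q \<le> N"
    "\<And>n d j. N \<le> n \<Longrightarrow> 0 < d \<Longrightarrow> d \<le> 1 \<Longrightarrow> j \<le> J \<Longrightarrow>
      (\<integral>t. cmod ((fdiff d ^^ j) (fourier_error n) t) \<partial>lborel) \<le> fact j * d powr min (real j) s * (real n powr (- (s - 2) / 2) * \<beta> n)"
proof -
  obtain C c \<theta> N where C: "0 \<le> C" and c: "0 < c" and \<theta>: "0 < \<theta>" "\<theta> < 1" and N: "q \<le> N" and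
    pointwise: "\<And>n t d j. N \<le> n \<Longrightarrow> 0 < d \<Longrightarrow> d \<le> 1 \<Longrightarrow> j \<le> J \<Longrightarrow>
      cmod ((fdiff d ^^ j) (fourier_error n) t) \<le> fact j * d powr min (real j) s *
       (C * (real n powr (- (s - 2) / 2) * eta (real J * (1 + \<bar>t\<bar>) / sqrt (real n)) + real n powr (- (real m - 1) / 2) + exp (- c * real n))
        * exp (C * (1 + \<bar>t\<bar>) - t\<^sup>2 / 8)
        + C * (real n ^ J * \<theta> ^ (n - (J + q)) * (\<Sum>i\<le>J. cmod (char M ((t + real i * d) / sqrt (real n))) ^ q)))"
    by (rule fourier_error_pointwise[OF int q], rule that)
  let ?W = "\<lambda>t::real. exp (C * (1 + \<bar>t\<bar>) - t\<^sup>2 / 8)"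
  define IW where "IW = (\<integral>t. ?W t \<partial>lborel)"
  define Ie where "Ie n = (\<integral>t. eta (real J * (1 + \<bar>t\<bar>) / sqrt (real n)) * ?W t \<partial>lborel)" for n
  define Iq where "Iq = (\<integral>t. cmod (char M t) ^ q \<partial>lborel)"
  let ?a = "(s - 2) / 2"
  \<comment> \<open>The integrated pointwise bound with n^(-(s-2)/2) taken out. In the last exponent
    J comes from the outer estimate, 1/2 from the substitution t / sqrt n, and (s - 2)/2 from the
    factor taken out.\<close>
  define \<beta> where "\<beta> n = C * (Ie n + (real n powr (?a - (real m - 1) / 2) + real n powr ?a * exp (- c * real n)) * IW)
    + C * (1 + real J) * Iq * (real n powr (real J + 1 / 2 + ?a) * \<theta> ^ (n - (J + q)))" for n
  show thesis
  proof (rule that[OF _ N])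
    \<comment> \<open>The exponent equals (s - 1 - m)/2, negative because s < m + 1.\<close>
    have "(\<lambda>n. real n powr (?a - (real m - 1) / 2)) \<longlonglongrightarrow> 0"
      using m_bounds by (intro tendsto_neg_powr filterlim_real_sequentially) simp
    then have "\<beta> \<longlonglongrightarrow> C * (0 + (0 + 0) * IW) + C * (1 + real J) * Iq * 0"
      unfolding \<beta>_def Ie_def
      by (intro tendsto_intros eta_integral_tendsto_0 powr_times_exp_tendsto_0 powr_times_power_tendsto_0 c \<theta>)
    then show "\<beta> \<longlonglongrightarrow> 0" by simp
    fix n :: nat and d :: real and j
    assume n: "N \<le> n" and d: "0 < d" "d \<le> 1" and j: "j \<le> J"
    have n0: "0 < n" "q \<le> n" using n N q by auto
    let ?r = "sqrt (real n)"
    have r: "0 < ?r" using n0 by simp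
    let ?x = "real n powr (- (s - 2) / 2)" and ?y = "real n powr (- (real m - 1) / 2)" and ?z = "exp (- c * real n)"
    let ?v = "real n ^ J * \<theta> ^ (n - (J + q))"
    have iW: "integrable lborel ?W" by (rule integrable_gauss_tail)
    have ie: "integrable lborel (\<lambda>t. eta (real J * (1 + \<bar>t\<bar>) / ?r) * ?W t)"
    proof (rule Bochner_Integration.integrable_bound[OF integrable_mult_right[OF iW, of mom]])
      show "AE t in lborel. norm (eta (real J * (1 + \<bar>t\<bar>) / ?r) * ?W t) \<le> norm (mom * ?W t)"
        using mom_ge_1 by (intro AE_I2) (simp add: abs_mult eta_nonneg eta_le_mom)
    qed simp
    have iq: "integrable lborel (\<lambda>t. cmod (char M ((t + a) / ?r)) ^ q)"
      and Iq: "(\<integral>t. cmod (char M ((t + a) / ?r)) ^ q \<partial>lborel) = ?r * Iq" for a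
    proof -
      have e: "(\<lambda>t. cmod (char M (a / ?r + (1 / ?r) * t)) ^ q) = (\<lambda>t. cmod (char M ((t + a) / ?r)) ^ q)"
        by (simp add: add_divide_distrib add.commute)
      show "integrable lborel (\<lambda>t. cmod (char M ((t + a) / ?r)) ^ q)"
        using lborel_integrable_real_affine[OF int, of "1 / ?r" "a / ?r"] r unfolding e by simp
      have "Iq = \<bar>1 / ?r\<bar> *\<^sub>R (\<integral>t. cmod (char M (a / ?r + (1 / ?r) * t)) ^ q \<partial>lborel)"
        unfolding Iq_def by (rule lborel_integral_real_affine) (use r in simp)
      then show "(\<integral>t. cmod (char M ((t + a) / ?r)) ^ q \<partial>lborel) = ?r * Iq" unfolding e using r by simp
    qed
    let ?U = "\<lambda>t. C * (?x * (eta (real J * (1 + \<bar>t\<bar>) / ?r) * ?W t) + (?y + ?z) * ?W t)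
      + C * (?v * (\<Sum>i\<le>J. cmod (char M ((t + real i * d) / ?r)) ^ q))"
    have iU: "integrable lborel ?U"
      by (intro Bochner_Integration.integrable_add integrable_mult_right Bochner_Integration.integrable_sum ie iW iq)
    have "(\<integral>t. cmod ((fdiff d ^^ j) (fourier_error n) t) \<partial>lborel) \<le> (\<integral>t. fact j * d powr min (real j) s * ?U t \<partial>lborel)"
    proof (rule integral_mono)
      show "integrable lborel (\<lambda>t. cmod ((fdiff d ^^ j) (fourier_error n) t))"
        by (intro integrable_norm fdiff_pow_lborel_integrable integrable_fourier_error[OF int] n0)
      show "integrable lborel (\<lambda>t. fact j * d powr min (real j) s * ?U t)" by (rule integrable_mult_right[OF iU])
      fix t
      show "cmod ((fdiff d ^^ j) (fourier_error n) t) \<le> fact j * d powr min (real j) s * ?U t"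
      proof -
        have "C * (x * e + y + z) * w + C * (a * b * S) = C * (x * (e * w) + (y + z) * w) + C * ((a * b) * S)" for x e y z w a b S
          by (simp add: algebra_simps)
        then show ?thesis using pointwise[OF n d j, of t] by (simp only:)
      qed
    qed
    also have "\<dots> = fact j * d powr min (real j) s * (\<integral>t. ?U t \<partial>lborel)" by simp
    also have "(\<integral>t. ?U t \<partial>lborel) = C * (?x * Ie n + (?y + ?z) * IW) + C * (?v * ((1 + real J) * (?r * Iq)))"
      unfolding Ie_def IW_def
      by (simp only: Bochner_Integration.integral_add Bochner_Integration.integral_sum integral_mult_right_zero
          Bochner_Integration.integrable_add integrable_mult_right Bochner_Integration.integrable_sum ie iW iq Iq) simp
    also have "\<dots> = ?x * \<beta> n"
    proof -
      have p: "?x * real n powr b = real n powr (b - ?a)" for b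
      proof -
        have "- (s - 2) / 2 + b = b - ?a" by (simp add: field_simps)
        then show ?thesis by (simp only: powr_add[symmetric])
      qed
      have x1: "?x * real n powr ?a = 1" using p[of ?a] n0 by simp
      have y: "?y = ?x * real n powr (?a - (real m - 1) / 2)" unfolding p by (simp add: minus_divide_left)
      have "real n ^ J * ?r = real n powr (real J + 1 / 2)"
        using n0 by (simp add: powr_add powr_realpow powr_half_sqrt)
      also have "\<dots> = ?x * real n powr (real J + 1 / 2 + ?a)" unfolding p by simp
      finally have v: "real n ^ J * ?r = ?x * real n powr (real J + 1 / 2 + ?a)" .
      have "?x * \<beta> n = C * (?x * Ie n + (?x * real n powr (?a - (real m - 1) / 2) + (?x * real n powr ?a) * ?z) * IW)
         + C * (1 + real J) * Iq * ((?x * real n powr (real J + 1 / 2 + ?a)) * \<theta> ^ (n - (J + q)))"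
        unfolding \<beta>_def by (simp add: algebra_simps)
      also have "\<dots> = C * (?x * Ie n + (?y + 1 * ?z) * IW) + C * (1 + real J) * Iq * ((real n ^ J * ?r) * \<theta> ^ (n - (J + q)))"
        unfolding x1 v[symmetric] y[symmetric] ..
      finally show ?thesis by (simp add: mult_ac)
    qed
    finally show "(\<integral>t. cmod ((fdiff d ^^ j) (fourier_error n) t) \<partial>lborel) \<le>
      fact j * d powr min (real j) s * (real n powr (- (s - 2) / 2) * \<beta> n)" .
  qed
qed

lemma inverse_fourier_error_bound:
  assumes int: "integrable lborel (\<lambda>t. cmod (char M t) ^ q)" and q: "0 < q"
  obtains \<beta> N where "\<beta> \<longlonglongrightarrow> 0" "q \<le> N"
    "\<And>n x. N \<le> n \<Longrightarrow> (1 + \<bar>x\<bar> powr s) * cmod (inverse_fourier (fourier_error n) x) \<le> real n powr (- (s - 2) / 2) * \<beta> n"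
proof -
  obtain \<beta> N where \<beta>: "\<beta> \<longlonglongrightarrow> 0" and N: "q \<le> N" and
    est: "\<And>n d j. N \<le> n \<Longrightarrow> 0 < d \<Longrightarrow> d \<le> 1 \<Longrightarrow> j \<le> J \<Longrightarrow>
      (\<integral>t. cmod ((fdiff d ^^ j) (fourier_error n) t) \<partial>lborel) \<le> fact j * d powr min (real j) s * (real n powr (- (s - 2) / 2) * \<beta> n)"
    by (rule fourier_error_integral[OF int q], rule that)
  \<comment> \<open>The factorial is that of the weight at order J; pi^s is the value of (|x| d)^s
    for d = pi/|x|.\<close>
  define F where "F = fact J * (1 + pi powr s)"
  have F1: "1 \<le> (fact J :: real)" by simp
  show thesis
  proof (rule that[of "\<lambda>n. ((1 + 4 powr s) + F) * \<beta> n", OF _ N])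
    show "(\<lambda>n. ((1 + 4 powr s) + F) * \<beta> n) \<longlonglongrightarrow> 0"
      using tendsto_mult_right_zero[OF \<beta>] by simp
    fix n :: nat and x :: real assume n: "N \<le> n"
    let ?b = "real n powr (- (s - 2) / 2) * \<beta> n" and ?h = "inverse_fourier (fourier_error n) x"
    have i: "integrable lborel (fourier_error n)" using n N q by (intro integrable_fourier_error[OF int]) auto
    have "(\<integral>t. cmod (fourier_error n t) \<partial>lborel) \<le> ?b" using est[OF n, of 1 0] s2 by simp
    then have b0: "0 \<le> ?b" by (rule order_trans[rotated]) simp
    have F0: "0 \<le> F" by (simp add: F_def)
    have "(1 + \<bar>x\<bar> powr s) * cmod ?h \<le> ((1 + 4 powr s) + F) * ?b"
    \<comment> \<open>The threshold 4 exceeds pi, so beyond it d = pi/|x| is at most 1; below it the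
      weight is bounded and the order 0 estimate suffices.\<close>
    proof (cases "\<bar>x\<bar> \<le> 4")
      case True
      have "cmod ?h \<le> (\<integral>t. cmod (fourier_error n t) \<partial>lborel) / (2 * pi)" by (rule norm_inverse_fourier_le)
      also have "\<dots> \<le> ?b / 1"
        using \<open>(\<integral>t. cmod (fourier_error n t) \<partial>lborel) \<le> ?b\<close> b0 pi_gt3 by (intro frac_le) auto
      finally have "(1 + \<bar>x\<bar> powr s) * cmod ?h \<le> (1 + 4 powr s) * ?b"
        using True s2 by (intro mult_mono add_left_mono powr_mono2) auto
      also have "\<dots> \<le> ((1 + 4 powr s) + F) * ?b" using F0 b0 by (intro mult_right_mono) auto
      finally show ?thesis .
    next
      case False
      define d where "d = pi / \<bar>x\<bar>"
      have d: "0 < d" "d \<le> 1" using False pi_less_4 by (auto simp: d_def divide_le_eq)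
      have "iexp (d * x) = -1"
      proof (cases "0 < x")
        case True
        then have "d * x = pi" by (simp add: d_def)
        then show ?thesis by (simp only: exp_pi_i') 
      next
        case neg: False
        then have "d * x = - pi" using False by (simp add: d_def)
        then have "iexp (d * x) = inverse (exp (\<i> * of_real pi))" by (simp only: of_real_minus mult_minus_right exp_minus)
        then show ?thesis by (simp add: exp_pi_i')
      qed
      then have "(\<integral>t. iexp (- (t * x)) * (fdiff d ^^ J) (fourier_error n) t \<partial>lborel) = (-2) ^ J * (\<integral>t. iexp (- (t * x)) * fourier_error n t \<partial>lborel)"
        using fourier_fdiff_pow[OF i, where d = d and k = J and x = x] by simp
      then have "inverse_fourier ((fdiff d ^^ J) (fourier_error n)) x = (-2) ^ J * ?h"
        by (simp add: inverse_fourier_def)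
      then have "2 ^ J * cmod ?h = cmod (inverse_fourier ((fdiff d ^^ J) (fourier_error n)) x)"
        by (simp add: norm_mult norm_power)
      also have "\<dots> \<le> (\<integral>t. cmod ((fdiff d ^^ J) (fourier_error n) t) \<partial>lborel) / (2 * pi)"
        by (rule norm_inverse_fourier_le)
      also have "\<dots> \<le> (fact J * d powr min (real J) s * ?b) / 1"
        using est[OF n d, of J] b0 pi_gt3 by (intro frac_le) auto
      also have "min (real J) s = s" using m_bounds by (simp add: J_def)
      finally have h: "2 ^ J * cmod ?h \<le> fact J * d powr s * ?b" by simp
      have "1 * cmod ?h \<le> 2 ^ J * cmod ?h" by (intro mult_right_mono) auto
      then have h': "cmod ?h \<le> fact J * d powr s * ?b" using h by linarith
      have xs: "\<bar>x\<bar> powr s * d powr s = pi powr s" "d powr s \<le> 1"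
        using False d s2 powr_mono2[of s d 1] by (auto simp: d_def powr_divide)
      have "(1 + \<bar>x\<bar> powr s) * cmod ?h \<le> (1 + \<bar>x\<bar> powr s) * (fact J * d powr s * ?b)"
        by (intro mult_left_mono h') simp
      also have "\<dots> = fact J * (d powr s + \<bar>x\<bar> powr s * d powr s) * ?b" by (simp add: algebra_simps)
      also have "\<dots> \<le> F * ?b"
        unfolding xs(1) F_def using xs(2) b0 by (intro mult_right_mono mult_left_mono) auto
      also have "\<dots> \<le> ((1 + 4 powr s) + F) * ?b" using b0 by (intro mult_right_mono) auto
      finally show ?thesis .
    qed
    then show "(1 + \<bar>x\<bar> powr s) * cmod ?h \<le> real n powr (- (s - 2) / 2) * (((1 + 4 powr s) + F) * \<beta> n)"
      by (simp only: mult_ac)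
  qed
qed

end

section \<open>The local limit theorem\<close>

lemma inverse_fourier_diff:
  assumes "integrable lborel f" "integrable lborel g"
  shows "inverse_fourier (\<lambda>t. f t - g t) x = inverse_fourier f x - inverse_fourier g x"
proof -
  have "(\<integral>t. iexp (- (t * x)) * (f t - g t) \<partial>lborel) =
    (\<integral>t. iexp (- (t * x)) * f t \<partial>lborel) - (\<integral>t. iexp (- (t * x)) * g t \<partial>lborel)"
    unfolding right_diff_distrib
    by (intro Bochner_Integration.integral_diff integrable_iexp_mult assms)
  then show ?thesis by (simp add: inverse_fourier_def diff_divide_distrib)
qed

lemma (in prob_space) char_normalized_sum:
  assumes "indep_vars (\<lambda>_. borel) X {1..}"
    and iid: "\<forall>n\<ge>1. distr M borel (X n) = distr M borel (X 1)"
  shows "char (distr M borel (normalized_sum X n)) t = char (distr M borel (X 1)) (t / sqrt (real n)) ^ n"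
proof -
  have rv: "X i \<in> borel_measurable M" if "1 \<le> i" for i
    using assms(1) that unfolding indep_vars_def2 by auto
  have "indep_vars (\<lambda>_. borel) X {1..n}" by (rule indep_vars_subset[OF assms(1)]) auto
  then have ind: "indep_vars (\<lambda>_. borel) (\<lambda>i \<omega>. X i \<omega> / sqrt (real n)) {1..n}"
    by (rule indep_vars_compose2) auto
  have "char (distr M borel (normalized_sum X n)) t = char (distr M borel (\<lambda>\<omega>. \<Sum>i\<in>{1..n}. X i \<omega> / sqrt (real n))) t"
    by (simp add: normalized_sum_def[abs_def] sum_divide_distrib)
  also have "\<dots> = (\<Prod>i\<in>{1..n}. char (distr M borel (\<lambda>\<omega>. X i \<omega> / sqrt (real n))) t)"
    by (rule char_distr_sum[OF ind])
  also have "\<dots> = (\<Prod>i\<in>{1..n}. char (distr M borel (X 1)) (t / sqrt (real n)))"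
  proof (rule prod.cong[OF refl])
    fix i assume "i \<in> {1..n}"
    then have i: "1 \<le> i" by simp
    note [measurable] = rv[OF i]
    show "char (distr M borel (\<lambda>\<omega>. X i \<omega> / sqrt (real n))) t = char (distr M borel (X 1)) (t / sqrt (real n))"
      unfolding iid[rule_format, OF i, symmetric] char_def by (simp add: integral_distr)
  qed
  finally show ?thesis by simp
qed

theorem theorem1p1:
  fixes M :: "'a measure" and X :: "nat \<Rightarrow> 'a \<Rightarrow> real" and s :: real and m n0 :: nat
  assumes "prob_space M"
    and "prob_space.indep_vars M (\<lambda>_. borel) X {1..}"
    and "\<forall>n\<ge>1. distr M borel (X n) = distr M borel (X 1)"
    and "integral\<^sup>L M (X 1) = 0"
    and "integral\<^sup>L M (\<lambda>\<omega>. (X 1 \<omega>)\<^sup>2) = 1"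
    and "s \<ge> 2"
    and "integrable M (\<lambda>\<omega>. \<bar>X 1 \<omega>\<bar> powr s)"
    and "m = nat \<lfloor>s\<rfloor>"
    and "n0 \<ge> 1"
    and "\<exists>\<rho>0 C. distributed M lborel (normalized_sum X n0) (\<lambda>x. ennreal (\<rho>0 x))
           \<and> (\<forall>x::real. 0 \<le> \<rho>0 x \<and> \<rho>0 x \<le> C)"
  shows "\<exists>\<rho> :: nat \<Rightarrow> real \<Rightarrow> real.
     (\<forall>\<^sub>F n in sequentially. continuous_on UNIV (\<rho> n) \<and> (\<forall>x. 0 \<le> \<rho> n x)
        \<and> distributed M lborel (normalized_sum X n) (\<lambda>x. ennreal (\<rho> n x)))
   \<and> (\<lambda>(n, x). (1 + \<bar>x\<bar> ^ m) * (\<rho> n x - edgeworth_density (distr M borel (X 1)) m n x))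
        \<in> o[uniformly_in_x](\<lambda>(n, x). real n powr (- (s - 2) / 2))
   \<and> (\<exists>r1 r2 r3 :: nat \<Rightarrow> real \<Rightarrow> real.
        (\<lambda>(n, x). r1 n x) \<in> o[uniformly_in_x](\<lambda>(n, x). real n powr (- (s - 2) / 2))
      \<and> (\<lambda>(n, x). r2 n x) \<in> O[uniformly_in_x](\<lambda>(n, x). real n powr (- (real m - 1) / 2))
      \<and> (\<lambda>(n, x). r3 n x) \<in> o[uniformly_in_x](\<lambda>(n, x). real n powr (- (s - 2)))
      \<and> (\<forall>\<^sub>F n in sequentially. \<forall>x.
           (1 + \<bar>x\<bar> powr s) * (\<rho> n x - edgeworth_density (distr M borel (X 1)) m n x)
             = r1 n x + (1 + \<bar>x\<bar> powr (s - real m)) * (r2 n x + r3 n x)))"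
proof -
  interpret P: prob_space M by (rule assms(1))
  have rv: "X i \<in> borel_measurable M" if "1 \<le> i" for i
    using assms(2) that unfolding P.indep_vars_def2 by auto
  note [measurable] = rv[of 1, simplified]
  define \<mu> where "\<mu> = distr M borel (X 1)"
  define \<nu> where "\<nu> n = distr M borel (normalized_sum X n)" for n
  have S_rv[measurable]: "normalized_sum X n \<in> borel_measurable M" for n
    unfolding normalized_sum_def[abs_def] by (intro borel_measurable_divide borel_measurable_sum borel_measurable_const rv) auto
  interpret D: std_moment_dist \<mu> s m
  proof (intro std_moment_dist.intro std_moment_dist_axioms.intro)
    show "real_distribution \<mu>" unfolding \<mu>_def by (rule P.real_distribution_distr) simp
    show "integrable \<mu> (\<lambda>x. \<bar>x\<bar> powr s)" unfolding \<mu>_def using assms(7) by (simp add: integrable_distr_eq)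
    show "(\<integral>x. x \<partial>\<mu>) = 0" "(\<integral>x. x\<^sup>2 \<partial>\<mu>) = 1" unfolding \<mu>_def using assms(4,5) by (simp_all add: integral_distr)
  qed (rule assms)+
  interpret N: real_distribution "\<nu> n" for n
    unfolding \<nu>_def by (rule P.real_distribution_distr) simp
  have char_\<nu>: "char (\<nu> n) t = char \<mu> (t / sqrt (real n)) ^ n" for n t
    unfolding \<nu>_def \<mu>_def by (rule P.char_normalized_sum[OF assms(2,3)])
  have lborel_\<nu>: "distr M lborel (normalized_sum X n) = \<nu> n" for n
    unfolding \<nu>_def by (rule distr_cong) auto
  \<comment> \<open>At the point sqrt n0 t, the squared modulus of the characteristic function of
    S_(n0) is the modulus of that of X_1 at t to the power 2 n0.\<close>
  define q where "q = 2 * n0"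
  have q: "0 < q" using assms(9) by (simp add: q_def)
  have int: "integrable lborel (\<lambda>t. cmod (char \<mu> t) ^ q)"
  proof -
    obtain \<rho>0 C where dist: "distributed M lborel (normalized_sum X n0) (\<lambda>x. ennreal (\<rho>0 x))"
      and b: "\<And>x. 0 \<le> \<rho>0 x" "\<And>x. \<rho>0 x \<le> C" using assms(10) by blast
    \<comment> \<open>\<open>distributed\<close> provides measurability of the
      \<open>ennreal\<close> version only; nonnegativity allows it to be undone.\<close>
    have "(\<lambda>x. enn2real (ennreal (\<rho>0 x))) \<in> borel_measurable borel"
      using distributed_borel_measurable[OF dist] by (intro borel_measurable_enn2real) simp
    then have "\<rho>0 \<in> borel_measurable borel" using b(1) by simp
    moreover have "\<nu> n0 = density lborel (\<lambda>x. ennreal (\<rho>0 x))"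
      using distributed_distr_eq_density[OF dist] lborel_\<nu>[of n0] by simp
    ultimately have "integrable lborel (\<lambda>t. (cmod (char (\<nu> n0) t))\<^sup>2)"
      by (intro N.integrable_char_square) (use b in auto)
    then have "integrable lborel (\<lambda>t. (cmod (char (\<nu> n0) (0 + sqrt (real n0) * t)))\<^sup>2)"
      by (rule lborel_integrable_real_affine) (use assms(9) in simp)
    then show ?thesis
      using assms(9) by (simp add: char_\<nu> norm_power q_def power_mult[symmetric] mult.commute)
  qed
  define \<rho> where "\<rho> n x = Re (inverse_fourier (char (\<nu> n)) x)" for n x
  have int_\<nu>: "integrable lborel (char (\<nu> n))" if "q \<le> n" for n
    using D.integrable_scaled_char_power[OF int that] q that by (simp add: char_\<nu>[abs_def])
  obtain \<beta> N where \<beta>: "\<beta> \<longlonglongrightarrow> 0" and N: "q \<le> N" and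
    bound: "\<And>n x. N \<le> n \<Longrightarrow> (1 + \<bar>x\<bar> powr s) * cmod (inverse_fourier (D.fourier_error n) x) \<le> real n powr (- (s - 2) / 2) * \<beta> n"
    by (rule D.inverse_fourier_error_bound[OF int q], rule that)
  let ?e = "\<lambda>n x. \<rho> n x - edgeworth_density \<mu> m n x"
  have err: "(1 + \<bar>x\<bar> powr s) * \<bar>?e n x\<bar> \<le> real n powr (- (s - 2) / 2) * \<beta> n" if n: "N \<le> n" for n x
  proof -
    have n': "q \<le> n" "0 < n" using n N q by auto
    have "inverse_fourier (D.fourier_error n) x = inverse_fourier (char (\<nu> n)) x - of_real (edgeworth_density \<mu> m n x)"
      unfolding D.fourier_error_def[abs_def] char_\<nu>[symmetric]
      by (subst inverse_fourier_diff[OF int_\<nu>[OF n'(1)] integrable_edgeworth_char])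
        (simp add: inverse_fourier_edgeworth_char[OF n'(2)])
    then have "?e n x = Re (inverse_fourier (D.fourier_error n) x)" by (simp add: \<rho>_def)
    then have "\<bar>?e n x\<bar> \<le> cmod (inverse_fourier (D.fourier_error n) x)" by (simp add: abs_Re_le_cmod)
    then have "(1 + \<bar>x\<bar> powr s) * \<bar>?e n x\<bar> \<le> (1 + \<bar>x\<bar> powr s) * cmod (inverse_fourier (D.fourier_error n) x)"
      by (intro mult_left_mono) auto
    with bound[OF n, of x] show ?thesis by linarith
  qed
  have small: "\<forall>\<^sub>F n in sequentially. \<forall>x. (1 + \<bar>x\<bar> powr s) * \<bar>?e n x\<bar> \<le> c * real n powr (- (s - 2) / 2)" if "c > 0" for c
    using order_tendstoD(2)[OF \<beta> that] eventually_ge_at_top[of N]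
  proof eventually_elim
    case (elim n)
    have "\<beta> n * real n powr (- (s - 2) / 2) \<le> c * real n powr (- (s - 2) / 2)"
      using elim(1) by (intro mult_right_mono) auto
    with err[OF elim(2)] show ?case by (intro allI order_trans[OF err[OF elim(2)]]) (simp only: mult.commute)
  qed
  have dens: "\<forall>\<^sub>F n in sequentially. continuous_on UNIV (\<rho> n) \<and> (\<forall>x. 0 \<le> \<rho> n x)
        \<and> distributed M lborel (normalized_sum X n) (\<lambda>x. ennreal (\<rho> n x))"
    using eventually_ge_at_top[of q]
  proof eventually_elim
    case (elim n)
    have cont: "continuous_on UNIV (\<rho> n)"
      unfolding \<rho>_def[abs_def] by (intro continuous_intros continuous_on_inverse_fourier int_\<nu> elim)
    have [measurable]: "\<rho> n \<in> borel_measurable borel" by (rule borel_measurable_continuous_onI[OF cont])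
    have "\<nu> n = density lborel (\<lambda>x. ennreal (\<rho> n x))"
      using N.density_of_integrable_char(1)[OF int_\<nu>[OF elim]] by (simp add: \<rho>_def)
    moreover have "0 \<le> \<rho> n x" for x
      using N.density_of_integrable_char(2)[OF int_\<nu>[OF elim]] by (simp add: \<rho>_def)
    ultimately show ?case
      using cont lborel_\<nu>[of n] by (simp add: distributed_def)
  qed
  have "(\<lambda>(n, x). (1 + \<bar>x\<bar> ^ m) * ?e n x) \<in> o[uniformly_in_x](\<lambda>(n, x). real n powr (- (s - 2) / 2))"
    unfolding smallo_uniformly_in_x
  proof (intro allI impI)
    fix c :: real assume "c > 0"
    then have "\<forall>\<^sub>F n in sequentially. \<forall>x. (1 + \<bar>x\<bar> powr s) * \<bar>?e n x\<bar> \<le> c / 2 * real n powr (- (s - 2) / 2)"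
      by (intro small) simp
    then show "\<forall>\<^sub>F n in sequentially. \<forall>x. \<bar>(1 + \<bar>x\<bar> ^ m) * ?e n x\<bar> \<le> c * \<bar>real n powr (- (s - 2) / 2)\<bar>"
    proof eventually_elim
      case (elim n)
      show ?case
      proof
        fix x :: real
        \<comment> \<open>As m <= s, the weight 1 + |x|^m is at most twice the weight 1 + |x|^s,
          which \<open>small\<close> already controls.\<close>
        have "\<bar>x\<bar> ^ m \<le> 1 + \<bar>x\<bar> powr s"
        proof (cases "\<bar>x\<bar> \<le> 1")
          case True
          then show ?thesis by (intro order_trans[OF power_le_one]) auto
        next
          case False
          then have "\<bar>x\<bar> ^ m = \<bar>x\<bar> powr real m" by (simp add: powr_realpow)
          also have "\<dots> \<le> \<bar>x\<bar> powr s" using False D.m_bounds by (intro powr_mono) auto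
          finally show ?thesis by simp
        qed
        moreover have "1 + a \<le> 2 * (1 + p)" if "a \<le> 1 + p" "0 \<le> p" for a p :: real
          using that by simp
        ultimately have "1 + \<bar>x\<bar> ^ m \<le> 2 * (1 + \<bar>x\<bar> powr s)" using powr_ge_zero by blast
        then have "(1 + \<bar>x\<bar> ^ m) * \<bar>?e n x\<bar> \<le> 2 * (1 + \<bar>x\<bar> powr s) * \<bar>?e n x\<bar>"
          by (intro mult_right_mono) auto
        also have "\<dots> = 2 * ((1 + \<bar>x\<bar> powr s) * \<bar>?e n x\<bar>)" by simp
        also have "\<dots> \<le> 2 * (c / 2 * real n powr (- (s - 2) / 2))" using elim by (intro mult_left_mono) auto
        finally show "\<bar>(1 + \<bar>x\<bar> ^ m) * ?e n x\<bar> \<le> c * \<bar>real n powr (- (s - 2) / 2)\<bar>" by (simp add: abs_mult)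
      qed
    qed
  qed
  moreover have "(\<lambda>(n, x). (1 + \<bar>x\<bar> powr s) * ?e n x) \<in> o[uniformly_in_x](\<lambda>(n, x). real n powr (- (s - 2) / 2))"
    unfolding smallo_uniformly_in_x
  proof (intro allI impI)
    fix c :: real assume "c > 0"
    from small[OF this]
    show "\<forall>\<^sub>F n in sequentially. \<forall>x. \<bar>(1 + \<bar>x\<bar> powr s) * ?e n x\<bar> \<le> c * \<bar>real n powr (- (s - 2) / 2)\<bar>"
      by eventually_elim (simp add: abs_mult)
  qed
  moreover have "(\<lambda>(n, x). 0 :: real) \<in> O[uniformly_in_x](\<lambda>(n, x). real n powr (- (real m - 1) / 2))"
    unfolding bigo_uniformly_in_x by (intro exI[of _ 1]) simp
  moreover have "(\<lambda>(n, x). 0 :: real) \<in> o[uniformly_in_x](\<lambda>(n, x). real n powr (- (s - 2)))"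
    unfolding smallo_uniformly_in_x by simp
  ultimately show ?thesis
    unfolding \<mu>_def[symmetric]
    by (intro exI[of _ \<rho>] conjI exI[of _ "\<lambda>n x. (1 + \<bar>x\<bar> powr s) * ?e n x"] exI[of _ "\<lambda>_ _. 0"] dens) auto
qed

end
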